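(* The Kinoshita graph $\mathbb{K}\subset S^3$ is nontrivial. That is, there is no ambient isotopy of $S^3$ taking the Kinoshita graph $\mathbb{K}$ to the trivial spatial $\theta$-graph $\mathbb{T}$.
   Context: We work in the tame (equivalently PL or smooth) category, with $S^3=\mathbb{R}^3\cup\{\infty\}$. A spatial $\theta$-graph is a tame embedding in $S^3$ of the graph with two vertices, three edges and no loops (each edge joins the two vertices). An ambient isotopy of $S^3$ taking $G$ to $G'$ is a continuous family of homeomorphisms $h_t:S^3\to S^3$, $t\in[0,1]$, with $h_0=\mathrm{id}$ and $h_1(G)=G'$. The trivial spatial $\theta$-graph $\mathbb{T}$ is the planar one: the union of the unit circle in $\mathbb{R}^2\times\{0\}\subset\mathbb{R}^3$ and one of its diameters, with vertices at the endpoints of the diameter. A spatial $\theta$-graph is trivial if some ambient isotopy of $S^3$ takes it to $\mathbb{T}$, and nontrivial otherwise. Definition of the Kinoshita graph $\mathbb{K}$ by a diagram with 7 crossings. A tangle diagram is drawn in a square with four endpoints, at the corners NW, NE, SW, SE. Let $[+1]$ be the tangle diagram consisting of the two diagonals of the square, crossing once, in which the over-strand is the diagonal of positive slope (from SW to NE). Let $[-1]$ be the same with the over-strand being the diagonal of negative slope (from NW to SE). The horizontal sum $T+T'$ puts $T'$ to the right of $T$ and joins NE of $T$ to NW of $T'$ and SE of $T$ to SW of $T'$. The vertical sum $T*T'$ puts $T'$ below $T$ and joins SW of $T$ to NW of $T'$ and SE of $T$ to NE of $T'$. In both cases the joins are made by short arcs without crossings, and the four remaining endpoints become the corners of the new tangle.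 Put $$A=[+1]*[+1]*[+1],\qquad F=\bigl([-1]+[-1]\bigr)*[-1]*[-1],\qquad M=A+F.$$ (In the usual rational tangle notation, $A$ is the rational tangle $1/3$ and $F$ is the rational tangle $-2/5$.) In $M$, one strand joins NW to SE and the other joins SW to NE. Now place a vertex $v$ in the plane above the square containing $M$ and a vertex $w$ below it. Join $v$ to the NW and NE endpoints of $M$ and join $w$ to the SW and SE endpoints of $M$, by arcs outside the square with no crossings and disjoint except at $v$ and $w$. Finally add an edge $e$ from $v$ to $w$ with no crossings, running outside the square to the right of the whole diagram. The resulting diagram represents a spatial $\theta$-graph with vertices $v,w$ and three edges: $e$ and the two edges containing the strands of $M$. This spatial $\theta$-graph is $\mathbb{K}$. (Interchanging the roles of $[+1]$ and $[-1]$ throughout gives its mirror image. Since $\mathbb{T}$ is its own mirror image, the choice does not affect the triviality or nontriviality of $\mathbb{K}$.) *)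

theory Defs
  imports "HOL-Analysis.Analysis"
begin

text \<open>
  The 3-sphere is $\mathbb{R}^3\cup\{\infty\}$; the point at infinity is \<^term>\<open>None\<close>.
\<close>

definition S3 :: "(real ^ 3) option topology" where
  "S3 = Alexandroff_compactification euclidean"

text \<open>Only the values \<open>h t\<close> for \<open>0 \<le> t \<le> 1\<close> are constrained.\<close>

definition ambient_isotopy :: "(real \<Rightarrow> (real ^ 3) option \<Rightarrow> (real ^ 3) option) \<Rightarrow> bool" where
  "ambient_isotopy h \<longleftrightarrow>
     continuous_map (prod_topology (top_of_set {0..1}) S3) S3 (\<lambda>(t, x). h t x) \<and>
     (\<forall>t\<in>{0..1}. homeomorphic_map S3 S3 (h t)) \<and>
     (\<forall>x\<in>topspace S3. h 0 x = x)"

definition ambient_isotopic :: "(real ^ 3) option set \<Rightarrow> (real ^ 3) option set \<Rightarrow> bool" where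
  "ambient_isotopic G G' \<longleftrightarrow> (\<exists>h. ambient_isotopy h \<and> h 1 ` G = G')"

definition trivial_theta_graph :: "(real ^ 3) option set" where
  "trivial_theta_graph =
     Some ` ({p. p $ 1 ^ 2 + p $ 2 ^ 2 = 1 \<and> p $ 3 = 0} \<union>
             closed_segment (vector [-1, 0, 0]) (vector [1, 0, 0]))"

definition nontrivial :: "(real ^ 3) option set \<Rightarrow> bool" where
  "nontrivial G \<longleftrightarrow> \<not> ambient_isotopic G trivial_theta_graph"

text \<open>
  A diagram is encoded by a polygonal subset of $\mathbb{R}^3$ whose projection along the third
  axis is the drawn diagram; at a crossing, the strand with the larger third coordinate is
  the over-strand.  A tangle diagram is drawn in the square $[-1,1]^2$, and its four
  endpoints are the corners of that square, at height \<open>0\<close>.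
\<close>

type_synonym tangle = "(real ^ 3) set"

definition NW :: "real ^ 3" where "NW = vector [-1, 1, 0]"
definition NE :: "real ^ 3" where "NE = vector [1, 1, 0]"
definition SW :: "real ^ 3" where "SW = vector [-1, -1, 0]"
definition SE :: "real ^ 3" where "SE = vector [1, -1, 0]"

text \<open>The over-strand climbs to height \<open>1\<close> above the centre; the under-strand stays at height \<open>0\<close>.\<close>

definition pos_crossing :: tangle where
  "pos_crossing =
     closed_segment SW (vector [0, 0, 1]) \<union> closed_segment (vector [0, 0, 1]) NE \<union>
     closed_segment NW SE"

definition neg_crossing :: tangle where
  "neg_crossing =
     closed_segment NW (vector [0, 0, 1]) \<union> closed_segment (vector [0, 0, 1]) SE \<union>
     closed_segment SW NE"

text \<open>
  For a sum, each summand is shrunk by the factor \<open>1/4\<close> and moved into one half of the square.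
  Its corners are then joined to those of the other summand and to the corners of the
  square by straight segments at height \<open>0\<close> outside the two small squares.
\<close>

definition place :: "real ^ 3 \<Rightarrow> real ^ 3 \<Rightarrow> real ^ 3" where
  "place c p = c + (1/4) *\<^sub>R p"

definition hsum :: "tangle \<Rightarrow> tangle \<Rightarrow> tangle" where
  "hsum T T' =
     (let l = place (vector [-1/2, 0, 0]); r = place (vector [1/2, 0, 0]) in
        l ` T \<union> r ` T' \<union>
        closed_segment (l NE) (r NW) \<union> closed_segment (l SE) (r SW) \<union>
        closed_segment NW (l NW) \<union> closed_segment SW (l SW) \<union>
        closed_segment NE (r NE) \<union> closed_segment SE (r SE))"

definition vsum :: "tangle \<Rightarrow> tangle \<Rightarrow> tangle" where
  "vsum T T' =
     (let u = place (vector [0, 1/2, 0]); d = place (vector [0, -1/2, 0]) in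
        u ` T \<union> d ` T' \<union>
        closed_segment (u SW) (d NW) \<union> closed_segment (u SE) (d NE) \<union>
        closed_segment NW (u NW) \<union> closed_segment NE (u NE) \<union>
        closed_segment SW (d SW) \<union> closed_segment SE (d SE))"

definition tangle_A :: tangle where
  "tangle_A = vsum (vsum pos_crossing pos_crossing) pos_crossing"

definition tangle_F :: tangle where
  "tangle_F = vsum (vsum (hsum neg_crossing neg_crossing) neg_crossing) neg_crossing"

definition tangle_M :: tangle where
  "tangle_M = hsum tangle_A tangle_F"

definition kinoshita_graph :: "(real ^ 3) option set" where
  "kinoshita_graph =
     (let v = vector [0, 2, 0]; w = vector [0, -2, 0]; m = vector [3, 0, 0] in
        Some ` (tangle_M \<union>
                closed_segment v NW \<union> closed_segment v NE \<union>
                closed_segment w SW \<union> closed_segment w SE \<union>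
                closed_segment v m \<union> closed_segment m w))"

end

theory Submission
  imports Defs
begin

text \<open>
  A local system on the complement of a graph is given by an atlas of trivialisations over open
  sets whose transition functions are locally constant with values in a group.  The complement of
  the trivial graph is the union of two open half-spaces joined along three discs, so the
  monodromy of any local system on it is generated by two elements.  The structure group used here
  is that of the maps \<open>u \<mapsto> a u + b\<close> of the affine plane over the field with four elements; any two
  of its elements have a common nonzero fixed vector in a three-dimensional linear
  representation, so every local system on the complement of the trivial graph has a nowhere
  zero flat section.  Colouring the faces of the diagram of the Kinoshita graph with group
  elements, subject to one relation at each crossing, gives a local system on its complement.  There
  is a colouring whose colours have no common nonzero fixed vector, and this local system has no
  nonzero flat section.  The colouring comes from a character into the field with four elements at
  which the Alexander module of the Kinoshita graph has larger rank than that of the trivial graph.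
\<close>

section \<open>Flat atlases\<close>

text \<open>Deleting any one edge of the Kinoshita graph leaves an unknot, so an obstruction has to
  involve the meridians of all three edges at once. An element \<open>aff a b c\<close> fixes
  \<open>(x, y, z)\<close> exactly when \<open>b * x + c * y + (a - 1) * z = 0\<close>: one equation
  in three unknowns. Two such equations always have a common nonzero solution, three need not; with
  an affine line in place of the plane there would be two unknowns, and already two elements could
  fail. Once the linear parts of a colouring are fixed by a character, its translation parts solve a
  homogeneous linear system. For a free group of rank two the solutions have dimension two; for the
  Kinoshita graph at the chosen character the dimension is at least three. Conjugation by
  translations accounts for one dimension, and two others become the two coordinates of the plane.
  The character sends the meridians of the three edges, oriented alike, to the same primitive cube
  root of unity, whence the field with four elements. Fundamental groups are avoided by gluing
  trivialisations over convex sets, whose intersections are again convex and so connected.\<close>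

text \<open>
  The structure group is a \<^class>\<open>group_add\<close>, written additively although it need not be commutative.
  Trivialisations agree if they differ by a constant on the left.
\<close>

definition agree_at :: "'a topology \<Rightarrow> 'a \<Rightarrow> ('a \<Rightarrow> 'g::group_add) \<Rightarrow> ('a \<Rightarrow> 'g) \<Rightarrow> bool" where
  "agree_at X x \<phi> \<psi> \<longleftrightarrow> (\<exists>W c. openin X W \<and> x \<in> W \<and> (\<forall>y\<in>W. \<psi> y = c + \<phi> y))"

lemma agree_at_sym:
  assumes "agree_at X x \<phi> \<psi>"
  shows "agree_at X x \<psi> \<phi>"
proof -
  obtain W c where W: "openin X W" "x \<in> W" "\<forall>y\<in>W. \<psi> y = c + \<phi> y"
    using assms unfolding agree_at_def by blast
  then have "\<forall>y\<in>W. \<phi> y = - c + \<psi> y"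
    by (simp flip: add.assoc)
  then show ?thesis
    unfolding agree_at_def using W by blast
qed

lemma agree_at_trans:
  assumes "agree_at X x \<phi> \<psi>" "agree_at X x \<psi> \<eta>"
  shows "agree_at X x \<phi> \<eta>"
proof -
  obtain W c where W: "openin X W" "x \<in> W" "\<forall>y\<in>W. \<psi> y = c + \<phi> y"
    using assms(1) unfolding agree_at_def by blast
  obtain V d where V: "openin X V" "x \<in> V" "\<forall>y\<in>V. \<eta> y = d + \<psi> y"
    using assms(2) unfolding agree_at_def by blast
  have "\<forall>y\<in>W \<inter> V. \<eta> y = (d + c) + \<phi> y"
    using W V by (simp add: add.assoc)
  then show ?thesis
    unfolding agree_at_def using W V by (metis IntI openin_Int)
qed

lemma agree_at_shift:
  assumes "agree_at X x \<phi> \<psi>" "openin X W" "x \<in> W" "\<And>y. y \<in> W \<Longrightarrow> \<eta> y = c + \<psi> y"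
  shows "agree_at X x \<phi> \<eta>"
  using agree_at_trans[OF assms(1)] assms(2-) unfolding agree_at_def by blast

text \<open>Charts are compared point by point because overlaps are disconnected in general: the
  charts above and below a diagram overlap in one part for each face, and each face has its own
  transition constant.\<close>

definition flat_atlas :: "'a topology \<Rightarrow> ('a set \<times> ('a \<Rightarrow> 'g::group_add)) set \<Rightarrow> bool" where
  "flat_atlas X \<A> \<longleftrightarrow>
     (\<forall>U \<phi>. (U, \<phi>) \<in> \<A> \<longrightarrow> openin X U) \<and>
     (\<forall>x\<in>topspace X. \<exists>U \<phi>. (U, \<phi>) \<in> \<A> \<and> x \<in> U) \<and>
     (\<forall>U \<phi> V \<psi> x. (U, \<phi>) \<in> \<A> \<longrightarrow> (V, \<psi>) \<in> \<A> \<longrightarrow> x \<in> U \<longrightarrow> x \<in> V \<longrightarrow> agree_at X x \<phi> \<psi>)"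

lemma flat_atlasD:
  assumes "flat_atlas X \<A>"
  shows "(U, \<phi>) \<in> \<A> \<Longrightarrow> openin X U"
    and "x \<in> topspace X \<Longrightarrow> \<exists>U \<phi>. (U, \<phi>) \<in> \<A> \<and> x \<in> U"
    and "(U, \<phi>) \<in> \<A> \<Longrightarrow> (V, \<psi>) \<in> \<A> \<Longrightarrow> x \<in> U \<Longrightarrow> x \<in> V \<Longrightarrow> agree_at X x \<phi> \<psi>"
  using assms unfolding flat_atlas_def by blast+

text \<open>A potential: a trivialisation compatible with the atlas that need not belong to it. This
  takes the place of passing to a maximal atlas.\<close>

definition flat_on ::
    "'a topology \<Rightarrow> ('a set \<times> ('a \<Rightarrow> 'g::group_add)) set \<Rightarrow> 'a set \<Rightarrow> ('a \<Rightarrow> 'g) \<Rightarrow> bool" where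
  "flat_on X \<A> U \<psi> \<longleftrightarrow>
     (\<forall>x V \<phi>. x \<in> U \<longrightarrow> (V, \<phi>) \<in> \<A> \<longrightarrow> x \<in> V \<longrightarrow> agree_at X x \<phi> \<psi>)"

lemma flat_onI:
  "(\<And>x V \<phi>. x \<in> U \<Longrightarrow> (V, \<phi>) \<in> \<A> \<Longrightarrow> x \<in> V \<Longrightarrow> agree_at X x \<phi> \<psi>) \<Longrightarrow> flat_on X \<A> U \<psi>"
  unfolding flat_on_def by simp

lemma flat_onD:
  "flat_on X \<A> U \<psi> \<Longrightarrow> x \<in> U \<Longrightarrow> (V, \<phi>) \<in> \<A> \<Longrightarrow> x \<in> V \<Longrightarrow> agree_at X x \<phi> \<psi>"
  unfolding flat_on_def by simp

lemma flat_on_chart: "flat_atlas X \<A> \<Longrightarrow> (U, \<phi>) \<in> \<A> \<Longrightarrow> flat_on X \<A> U \<phi>"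
  by (rule flat_onI) (rule flat_atlasD(3))

lemma flat_on_subset: "flat_on X \<A> U \<psi> \<Longrightarrow> V \<subseteq> U \<Longrightarrow> flat_on X \<A> V \<psi>"
  unfolding flat_on_def by blast

lemma flat_on_cong_open:
  assumes "flat_on X \<A> U \<psi>" "openin X U" "\<And>x. x \<in> U \<Longrightarrow> \<eta> x = c + \<psi> x"
  shows "flat_on X \<A> U \<eta>"
  by (rule flat_onI) (use agree_at_shift[OF flat_onD[OF assms(1)] assms(2) _ assms(3)] in blast)

lemma flat_on_Un: "flat_on X \<A> U \<psi> \<Longrightarrow> flat_on X \<A> V \<psi> \<Longrightarrow> flat_on X \<A> (U \<union> V) \<psi>"
  unfolding flat_on_def by blast

text \<open>Moves the local system from the complement of the Kinoshita graph to that of the trivial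
  graph, along the inverse of the final homeomorphism of the isotopy.\<close>

lemma flat_atlas_pullback:
  assumes "flat_atlas X \<A>" "continuous_map Y X f"
  shows "flat_atlas Y ((\<lambda>(U, \<phi>). ({y \<in> topspace Y. f y \<in> U}, \<phi> \<circ> f)) ` \<A>)"
proof -
  have agr: "agree_at Y y (\<phi> \<circ> f) (\<psi> \<circ> f)" if "agree_at X (f y) \<phi> \<psi>" "y \<in> topspace Y" for y \<phi> \<psi>
  proof -
    obtain W c where W: "openin X W" "f y \<in> W" "\<forall>x\<in>W. \<psi> x = c + \<phi> x"
      using \<open>agree_at X (f y) \<phi> \<psi>\<close> unfolding agree_at_def by blast
    have "openin Y {y \<in> topspace Y. f y \<in> W}"
      using openin_continuous_map_preimage[OF assms(2) W(1)] .
    then show ?thesis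
      unfolding agree_at_def using W that(2)
      by (intro exI[of _ "{y \<in> topspace Y. f y \<in> W}"] exI[of _ c]) auto
  qed
  let ?B = "(\<lambda>(U, \<phi>). ({y \<in> topspace Y. f y \<in> U}, \<phi> \<circ> f)) ` \<A>"
  have elim: "\<exists>V \<psi>. (V, \<psi>) \<in> \<A> \<and> U = {y \<in> topspace Y. f y \<in> V} \<and> \<phi> = \<psi> \<circ> f"
    if "(U, \<phi>) \<in> ?B" for U \<phi> using that by auto
  have intro: "({y \<in> topspace Y. f y \<in> V}, \<psi> \<circ> f) \<in> ?B" if "(V, \<psi>) \<in> \<A>" for V \<psi>
    using that by force
  show ?thesis
    unfolding flat_atlas_def
  proof (intro conjI allI impI ballI)
    fix U \<phi> assume "(U, \<phi>) \<in> ?B"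
    then obtain V \<psi> where "(V, \<psi>) \<in> \<A>" "U = {y \<in> topspace Y. f y \<in> V}"
      using elim by blast
    then show "openin Y U"
      using openin_continuous_map_preimage[OF assms(2) flat_atlasD(1)[OF assms(1)]] by simp
  next
    fix y assume y: "y \<in> topspace Y"
    then have "f y \<in> topspace X"
      using assms(2) by (auto simp: continuous_map_def)
    then obtain V \<psi> where V: "(V, \<psi>) \<in> \<A>" "f y \<in> V"
      using flat_atlasD(2)[OF assms(1)] by blast
    show "\<exists>U \<phi>. (U, \<phi>) \<in> ?B \<and> y \<in> U"
      by (rule exI, rule exI, rule conjI[OF intro[OF V(1)]]) (use y V in simp)
  next
    fix U \<phi> V \<psi> x assume *: "(U, \<phi>) \<in> ?B" "(V, \<psi>) \<in> ?B" "x \<in> U" "x \<in> V"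
    obtain U' \<phi>' V' \<psi>' where "(U', \<phi>') \<in> \<A>" "U = {y \<in> topspace Y. f y \<in> U'}" "\<phi> = \<phi>' \<circ> f"
      "(V', \<psi>') \<in> \<A>" "V = {y \<in> topspace Y. f y \<in> V'}" "\<psi> = \<psi>' \<circ> f"
      using elim[OF *(1)] elim[OF *(2)] by blast
    then show "agree_at Y x \<phi> \<psi>"
      using agr[OF flat_atlasD(3)[OF assms(1)]] *(3,4) by blast
  qed
qed

text \<open>Near each point the two potentials differ by a constant on the left, so
  \<open>\<eta> x - \<psi> x\<close> is locally constant, hence constant on a connected set.\<close>

lemma flat_on_connected_unique:
  fixes \<A> :: "('a::topological_space set \<times> ('a \<Rightarrow> 'g::group_add)) set"
  assumes "flat_atlas (top_of_set Y) \<A>" "connected W" "W \<subseteq> Y"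
    and "flat_on (top_of_set Y) \<A> U \<psi>" "flat_on (top_of_set Y) \<A> V \<eta>" "W \<subseteq> U" "W \<subseteq> V"
  obtains c where "\<And>x. x \<in> W \<Longrightarrow> \<eta> x = c + \<psi> x"
proof -
  have "(\<lambda>x. \<eta> x - \<psi> x) constant_on W"
  proof (rule locally_constant_imp_constant[OF \<open>connected W\<close>])
    fix a assume a: "a \<in> W"
    then obtain V \<phi> where V: "(V, \<phi>) \<in> \<A>" "a \<in> V"
      using flat_atlasD(2)[OF assms(1), of a] assms(3) by auto
    have "agree_at (top_of_set Y) a \<psi> \<eta>"
      using agree_at_trans[OF agree_at_sym[OF flat_onD[OF assms(4) _ V]] flat_onD[OF assms(5) _ V]]
        a assms(6,7) by blast
    then obtain N c where N: "openin (top_of_set Y) N" "a \<in> N" "\<forall>y\<in>N. \<eta> y = c + \<psi> y"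
      unfolding agree_at_def by blast
    have "openin (top_of_set W) (W \<inter> N)"
      using N(1) assms(3) by (metis inf.absorb_iff2 inf_commute openin_subtopology_Int2 subtopology_subtopology)
    moreover have "\<forall>x\<in>W \<inter> N. \<eta> x - \<psi> x = \<eta> a - \<psi> a"
      using N by simp
    ultimately show "\<exists>T. openin (top_of_set W) T \<and> a \<in> T \<and> (\<forall>x\<in>T. \<eta> x - \<psi> x = \<eta> a - \<psi> a)"
      using a N(2) by blast
  qed
  then obtain c where "\<And>x. x \<in> W \<Longrightarrow> \<eta> x - \<psi> x = c"
    unfolding constant_on_def by blast
  then have "\<And>x. x \<in> W \<Longrightarrow> \<eta> x = c + \<psi> x"
    by (metis diff_add_cancel)
  then show ?thesis using that by blast
qed

section \<open>Potentials over convex open sets\<close>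

definition tube :: "'a::real_normed_vector set \<Rightarrow> real \<Rightarrow> 'a set" where
  "tube S e = (\<Union>x\<in>S. \<Union>y\<in>ball 0 e. {x + y})"

lemma open_tube: "open (tube S e)"
  unfolding tube_def by (simp add: open_sums)

lemma convex_tube: "convex S \<Longrightarrow> convex (tube S e)"
  unfolding tube_def by (intro convex_sums convex_ball)

lemma tube_eq: "tube S e = {x. \<exists>s\<in>S. dist s x < e}"
proof -
  have "x \<in> tube S e" if "s \<in> S" "dist s x < e" for s x
    unfolding tube_def using that
    by (intro UN_I[of s] UN_I[of "x - s"]) (auto simp: dist_norm norm_minus_commute)
  moreover have "\<exists>s\<in>S. dist s x < e" if "x \<in> tube S e" for x
  proof -
    obtain s y where "s \<in> S" "norm y < e" "x = s + y"
      using \<open>x \<in> tube S e\<close> by (auto simp: tube_def)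
    then show ?thesis
      by (intro bexI[of _ s]) (simp_all add: dist_norm)
  qed
  ultimately show ?thesis
    by blast
qed

text \<open>Bisection reduces the claim to short pieces, which lie in one chart, and to gluing.
  Tubes around adjacent pieces are convex, so their intersection is connected and the two potentials
  differ there by a single constant, which is absorbed into the second one.\<close>

lemma flat_on_segment_tube:
  fixes Y :: "'a::real_normed_vector set" and \<A> :: "('a set \<times> ('a \<Rightarrow> 'g::group_add)) set"
  assumes atlas: "flat_atlas (top_of_set Y) \<A>" and "open Y" and seg: "closed_segment a b \<subseteq> Y"
  shows "\<exists>e>0. \<exists>\<psi>. tube (closed_segment a b) e \<subseteq> Y \<and>
           flat_on (top_of_set Y) \<A> (tube (closed_segment a b) e) \<psi>"
proof -
  define \<gamma> where "\<gamma> t = a + t *\<^sub>R (b - a)" for t :: real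
  define P where "P s t \<longleftrightarrow> (\<exists>e>0. \<exists>\<psi>. tube (\<gamma> ` {s..t}) e \<subseteq> Y \<and>
           flat_on (top_of_set Y) \<A> (tube (\<gamma> ` {s..t}) e) \<psi>)" for s t
  have \<gamma>_conv: "convex (\<gamma> ` {s..t})" for s t
  proof -
    have "\<gamma> ` {s..t} = (\<lambda>x. a + x) ` ((\<lambda>t. t *\<^sub>R (b - a)) ` {s..t})"
      by (auto simp: \<gamma>_def image_image)
    moreover have "convex ((\<lambda>t. t *\<^sub>R (b - a)) ` {s..t})"
      by (intro convex_linear_image linear_scale_left convex_real_interval)
    ultimately show ?thesis
      by (simp add: convex_translation)
  qed
  have \<gamma>_seg: "\<gamma> ` {0..1} = closed_segment a b"
    by (auto simp: \<gamma>_def closed_segment_image_interval algebra_simps image_def)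
  have "P 0 1"
  proof (rule Bolzano)
    show "(0::real) \<le> 1" by simp
  next
    fix r s t :: real
    assume P: "P r s" "P s t" and le: "r \<le> s" "s \<le> t"
    obtain e \<psi> where e: "e > 0" "tube (\<gamma> ` {r..s}) e \<subseteq> Y"
        "flat_on (top_of_set Y) \<A> (tube (\<gamma> ` {r..s}) e) \<psi>"
      using P(1) unfolding P_def by blast
    obtain d \<eta> where d: "d > 0" "tube (\<gamma> ` {s..t}) d \<subseteq> Y"
        "flat_on (top_of_set Y) \<A> (tube (\<gamma> ` {s..t}) d) \<eta>"
      using P(2) unfolding P_def by blast
    define m where "m = min e d"
    let ?A = "tube (\<gamma> ` {r..s}) m" and ?B = "tube (\<gamma> ` {s..t}) m"
    have m: "m > 0" using e d by (simp add: m_def)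
    have sub: "?A \<subseteq> tube (\<gamma> ` {r..s}) e" "?B \<subseteq> tube (\<gamma> ` {s..t}) d"
      by (auto simp: tube_eq m_def)
    have fl: "flat_on (top_of_set Y) \<A> ?A \<psi>" "flat_on (top_of_set Y) \<A> ?B \<eta>"
      using flat_on_subset e(3) d(3) sub by blast+
    have "connected (?A \<inter> ?B)"
      by (intro convex_connected convex_Int convex_tube \<gamma>_conv)
    moreover have AY: "?A \<subseteq> Y" "?B \<subseteq> Y" using sub e(2) d(2) by auto
    ultimately obtain c where c: "\<And>x. x \<in> ?A \<inter> ?B \<Longrightarrow> \<psi> x = c + \<eta> x"
      using flat_on_connected_unique[OF atlas _ _ fl(2) fl(1), of "?A \<inter> ?B"] by blast
    define \<theta> where "\<theta> x = (if x \<in> ?A then \<psi> x else c + \<eta> x)" for x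
    have op: "openin (top_of_set Y) ?A" "openin (top_of_set Y) ?B"
      using open_tube AY \<open>open Y\<close> by (auto simp: openin_open_eq)
    have "flat_on (top_of_set Y) \<A> ?A \<theta>"
      by (rule flat_on_cong_open[OF fl(1) op(1), of _ 0]) (simp add: \<theta>_def)
    moreover have "flat_on (top_of_set Y) \<A> ?B \<theta>"
      by (rule flat_on_cong_open[OF fl(2) op(2), of _ c]) (use c in \<open>simp add: \<theta>_def\<close>)
    moreover have "tube (\<gamma> ` {r..t}) m = ?A \<union> ?B"
      using ivl_disj_un_two_touch(4)[OF le] by (auto simp: tube_def image_Un simp flip: ivl_disj_un_two_touch(4)[OF le])
    ultimately show "P r t"
      unfolding P_def using m AY flat_on_Un by (metis Un_least)
  next
    fix x :: real assume x: "0 \<le> x" "x \<le> 1"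
    then have "\<gamma> x \<in> Y" using seg \<gamma>_seg by (metis atLeastAtMost_iff image_eqI subsetD)
    then obtain V \<phi> where V: "(V, \<phi>) \<in> \<A>" "\<gamma> x \<in> V"
      using flat_atlasD(2)[OF atlas, of "\<gamma> x"] by auto
    have VY: "openin (top_of_set Y) V" using flat_atlasD(1)[OF atlas V(1)] .
    then have "open V" using \<open>open Y\<close> by (simp add: openin_open_eq)
    then obtain e where e: "e > 0" "ball (\<gamma> x) e \<subseteq> V" using V(2) open_contains_ball by blast
    have "continuous (at x) \<gamma>" unfolding \<gamma>_def by (intro continuous_intros)
    then obtain d where d: "d > 0" "\<And>y. dist y x < d \<Longrightarrow> dist (\<gamma> y) (\<gamma> x) < e / 2"
      using e(1) unfolding continuous_at_eps_delta by (metis half_gt_zero)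
    have "P s t" if "s \<le> x" "x \<le> t" "t - s < d" for s t
    proof -
      have "tube (\<gamma> ` {s..t}) (e/2) \<subseteq> V"
      proof
        fix y assume "y \<in> tube (\<gamma> ` {s..t}) (e/2)"
        then obtain u where u: "u \<in> {s..t}" "dist (\<gamma> u) y < e/2" by (auto simp: tube_eq)
        have "dist u x < d" using u that by (auto simp: dist_real_def)
        then have "dist (\<gamma> u) (\<gamma> x) < e/2" using d by blast
        then have "dist (\<gamma> x) y < e" using u(2) dist_triangle[of "\<gamma> x" y "\<gamma> u"] by (simp add: dist_commute)
        then show "y \<in> V" using e by auto
      qed
      moreover have "flat_on (top_of_set Y) \<A> V \<phi>"
        using flat_on_chart[OF atlas V(1)] .
      moreover have "V \<subseteq> Y" using VY openin_imp_subset by blast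
      ultimately show ?thesis
        unfolding P_def using e(1) flat_on_subset by (meson half_gt_zero order_trans)
    qed
    then show "\<exists>d>0. \<forall>s t. s \<le> x \<and> x \<le> t \<and> t - s < d \<longrightarrow> P s t"
      using d(1) by blast
  qed
  then show ?thesis unfolding P_def \<gamma>_seg .
qed

text \<open>Potentials are continued along segments from a base point \<open>a\<close> and
  normalised to vanish there. Two tubes meet in a convex set containing \<open>a\<close>, so their
  potentials agree on it. Hence near \<open>x\<close> the diagonal function
  \<open>\<psi> y y\<close> coincides with the single potential \<open>\<psi> x\<close>.\<close>

lemma flat_on_convex:
  fixes Y :: "'a::real_normed_vector set" and \<A> :: "('a set \<times> ('a \<Rightarrow> 'g::group_add)) set"
  assumes atlas: "flat_atlas (top_of_set Y) \<A>" and "open Y" and "convex U" "open U" "U \<subseteq> Y"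
  obtains \<psi> where "flat_on (top_of_set Y) \<A> U \<psi>"
proof (cases "U = {}")
  case True
  then show ?thesis using that unfolding flat_on_def by blast
next
  case False
  then obtain a where a: "a \<in> U" by blast
  have "\<exists>e \<psi>. e > 0 \<and> tube (closed_segment a x) e \<subseteq> Y \<and>
          flat_on (top_of_set Y) \<A> (tube (closed_segment a x) e) \<psi> \<and> \<psi> a = 0" if "x \<in> U" for x
  proof -
    have "closed_segment a x \<subseteq> Y"
      using a that assms(3,5) by (meson closed_segment_subset order_trans)
    then obtain e \<psi> where e: "e > 0" "tube (closed_segment a x) e \<subseteq> Y"
          "flat_on (top_of_set Y) \<A> (tube (closed_segment a x) e) \<psi>"
      using flat_on_segment_tube[OF atlas \<open>open Y\<close>] by blast
    have "flat_on (top_of_set Y) \<A> (tube (closed_segment a x) e) (\<lambda>y. - \<psi> a + \<psi> y)"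
      by (rule flat_on_cong_open[OF e(3)]) (use e \<open>open Y\<close> in \<open>auto simp: openin_open_eq open_tube\<close>)
    then show ?thesis using e by (intro exI[of _ e] exI[of _ "\<lambda>y. - \<psi> a + \<psi> y"]) auto
  qed
  then obtain e \<psi> where *: "\<And>x. x \<in> U \<Longrightarrow> e x > 0 \<and> tube (closed_segment a x) (e x) \<subseteq> Y \<and>
          flat_on (top_of_set Y) \<A> (tube (closed_segment a x) (e x)) (\<psi> x) \<and> \<psi> x a = 0"
    by metis
  define W where "W x = tube (closed_segment a x) (e x)" for x
  have mem: "a \<in> W x" "x \<in> W x" if "x \<in> U" for x
    using *[OF that] by (auto simp: W_def tube_eq intro: bexI[of _ a] bexI[of _ x])
  have W: "W x \<subseteq> Y" "flat_on (top_of_set Y) \<A> (W x) (\<psi> x)" "\<psi> x a = 0" "open (W x)" "convex (W x)" if "x \<in> U" for x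
    using *[OF that] by (simp_all add: W_def open_tube convex_tube)
  have same: "\<psi> x z = \<psi> y z" if xy: "x \<in> U" "y \<in> U" "z \<in> W x" "z \<in> W y" for x y z
  proof -
    have "connected (W x \<inter> W y)" using W that by (simp add: convex_Int convex_connected)
    moreover have "W x \<inter> W y \<subseteq> Y" using W that by blast
    ultimately obtain c where c: "\<And>z. z \<in> W x \<inter> W y \<Longrightarrow> \<psi> x z = c + \<psi> y z"
      using flat_on_connected_unique[OF atlas _ _ W(2)[OF xy(2)] W(2)[OF xy(1)], of "W x \<inter> W y"]
      by blast
    from c[of a] have "c = 0" using W(3) mem xy by simp
    with c xy show ?thesis by simp
  qed
  have "flat_on (top_of_set Y) \<A> U (\<lambda>x. \<psi> x x)"
  proof (rule flat_onI)
    fix x V \<phi> assume x: "x \<in> U" and V: "(V, \<phi>) \<in> \<A>" "x \<in> V"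
    have agr: "agree_at (top_of_set Y) x \<phi> (\<psi> x)"
      using flat_onD[OF W(2)[OF x] mem(2)[OF x] V] .
    have "openin (top_of_set Y) (W x \<inter> U)"
      using W(1,4)[OF x] \<open>open U\<close> \<open>open Y\<close> by (auto simp: openin_open_eq)
    moreover have "\<psi> y y = 0 + \<psi> x y" if "y \<in> W x \<inter> U" for y
      using same[of y x y] mem(2) that x by simp
    ultimately show "agree_at (top_of_set Y) x \<phi> (\<lambda>x. \<psi> x x)"
      using mem(2)[OF x] x by (intro agree_at_shift[OF agr, of "W x \<inter> U" _ 0]) simp_all
  qed
  then show ?thesis using that by blast
qed

section \<open>The complement of the trivial graph\<close>

definition theta :: "(real ^ 3) set" where
  "theta = {p. p $ 1 ^ 2 + p $ 2 ^ 2 = 1 \<and> p $ 3 = 0} \<union> {p. \<bar>p $ 1\<bar> \<le> 1 \<and> p $ 2 = 0 \<and> p $ 3 = 0}"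

lemma closed_segment_diameter:
  "closed_segment (vector [-1, 0, 0]) (vector [1, 0, 0]) = {p :: real ^ 3. \<bar>p $ 1\<bar> \<le> 1 \<and> p $ 2 = 0 \<and> p $ 3 = 0}"
proof (intro equalityI subsetI)
  fix p :: "real ^ 3" assume "p \<in> closed_segment (vector [-1, 0, 0]) (vector [1, 0, 0])"
  then obtain u where u: "0 \<le> u" "u \<le> 1" "p = (1 - u) *\<^sub>R vector [-1, 0, 0] + u *\<^sub>R vector [1, 0, 0]"
    by (auto simp: closed_segment_def)
  have "p $ 1 = 2 * u - 1" "p $ 2 = 0" "p $ 3 = 0"
    unfolding u(3) by (simp_all add: vector_3)
  then show "p \<in> {p. \<bar>p $ 1\<bar> \<le> 1 \<and> p $ 2 = 0 \<and> p $ 3 = 0}"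
    using u(1,2) by (simp add: abs_le_iff)
next
  fix p :: "real ^ 3" assume p: "p \<in> {p. \<bar>p $ 1\<bar> \<le> 1 \<and> p $ 2 = 0 \<and> p $ 3 = 0}"
  show "p \<in> closed_segment (vector [-1, 0, 0]) (vector [1, 0, 0])"
    unfolding closed_segment_def using p
    by (intro CollectI exI[of _ "(p $ 1 + 1) / 2"]) (auto simp: vec_eq_iff forall_3 vector_3 abs_le_iff field_simps)
qed

lemma trivial_theta_graph_eq: "trivial_theta_graph = Some ` theta"
  unfolding trivial_theta_graph_def theta_def closed_segment_diameter ..

lemma open_compl_theta: "open (- theta)"
proof -
  have "closed {p :: real ^ 3. p $ 1 ^ 2 + p $ 2 ^ 2 = 1 \<and> p $ 3 = 0}"
    by (intro closed_Collect_conj closed_Collect_eq continuous_intros)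
  moreover have "closed {p :: real ^ 3. \<bar>p $ 1\<bar> \<le> 1 \<and> p $ 2 = 0 \<and> p $ 3 = 0}"
    by (intro closed_Collect_conj closed_Collect_eq closed_Collect_le continuous_intros)
  ultimately show ?thesis
    unfolding theta_def by (intro open_Compl closed_Un)
qed

text \<open>The two bounded regions that the graph cuts out of its plane are half discs. Thickened
  vertically without bound they stay convex, avoid the graph and meet both open half-spaces.\<close>

definition half_disc_prism :: "real \<Rightarrow> (real ^ 3) set" where
  "half_disc_prism s = {p. p $ 1 ^ 2 + p $ 2 ^ 2 < 1 \<and> 0 < s * p $ 2}"

text \<open>The unbounded region of the plane is not convex. It is covered by the half-spaces beyond
  the vertical tangent planes of the unit circle.\<close>

definition outer_half_space :: "real \<times> real \<Rightarrow> (real ^ 3) set" where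
  "outer_half_space u = {p. 1 < fst u * p $ 1 + snd u * p $ 2}"

definition unit_circle :: "(real \<times> real) set" where
  "unit_circle = {u. fst u ^ 2 + snd u ^ 2 = 1}"

lemma half_disc_prism:
  "convex (half_disc_prism s)" "open (half_disc_prism s)" "half_disc_prism s \<subseteq> - theta"
proof -
  let ?f = "\<lambda>p::real^3. vector [p $ 1, p $ 2] :: real ^ 2"
  have lin: "linear ?f"
    by (rule linearI) (simp_all add: vec_eq_iff forall_2)
  have "half_disc_prism s = ?f -` ball 0 1 \<inter> (\<lambda>p. s * p $ 2) -` {0<..}"
    by (auto simp: half_disc_prism_def norm_vec_def L2_set_def sum_2 power2_eq_square real_sqrt_lt_1_iff)
  moreover have "convex (?f -` ball 0 1)"
    by (rule convex_linear_vimage[OF lin convex_ball])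
  moreover have "convex ((\<lambda>p::real^3. s * p $ 2) -` {0<..})"
    by (rule convex_linear_vimage) (auto intro!: linearI simp: algebra_simps)
  ultimately show "convex (half_disc_prism s)"
    by (simp add: convex_Int)
  show "open (half_disc_prism s)"
    unfolding half_disc_prism_def by (intro open_Collect_conj open_Collect_less continuous_intros)
  show "half_disc_prism s \<subseteq> - theta"
    by (auto simp: half_disc_prism_def theta_def)
qed

lemma outer_half_space:
  assumes "u \<in> unit_circle"
  shows "convex (outer_half_space u)" "open (outer_half_space u)" "outer_half_space u \<subseteq> - theta"
proof -
  have "outer_half_space u = (\<lambda>p. fst u * p $ 1 + snd u * p $ 2) -` {1<..}"
    by (auto simp: outer_half_space_def)
  moreover have "convex \<dots>"
    by (rule convex_linear_vimage) (auto intro!: linearI simp: algebra_simps)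
  ultimately show "convex (outer_half_space u)"
    by simp
  show "open (outer_half_space u)"
    unfolding outer_half_space_def by (intro open_Collect_less continuous_intros)
  have "p \<notin> theta" if p: "p \<in> outer_half_space u" for p
  proof -
    have "(fst u * p $ 1 + snd u * p $ 2)\<^sup>2 \<le> (fst u ^ 2 + snd u ^ 2) * (p $ 1 ^ 2 + p $ 2 ^ 2)"
      using zero_le_power2[of "fst u * p $ 2 - snd u * p $ 1"] by (simp add: power2_eq_square algebra_simps)
    moreover have "1 < (fst u * p $ 1 + snd u * p $ 2)\<^sup>2"
      using p by (simp add: outer_half_space_def)
    ultimately have "1 < p $ 1 ^ 2 + p $ 2 ^ 2"
      using assms by (simp add: unit_circle_def)
    moreover have "p $ 1 ^ 2 \<le> 1" if "\<bar>p $ 1\<bar> \<le> 1"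
      using that by (simp add: abs_square_le_1)
    ultimately show ?thesis
      by (auto simp: theta_def)
  qed
  then show "outer_half_space u \<subseteq> - theta" by blast
qed

lemma compl_theta_cases:
  assumes "p \<notin> theta" "p $ 3 = 0"
  shows "p \<in> half_disc_prism 1 \<or> p \<in> half_disc_prism (-1) \<or> (\<exists>u\<in>unit_circle. p \<in> outer_half_space u)"
proof (cases "p $ 1 ^ 2 + p $ 2 ^ 2 > 1")
  case True
  \<comment> \<open>A point outside the circle lies in the half-space of its own direction: the
    inner product of its projection with the unit vector in that direction is
    \<open>r\<close>.\<close>
  define r where "r = sqrt (p $ 1 ^ 2 + p $ 2 ^ 2)"
  have r: "r > 1" "r * r = p $ 1 ^ 2 + p $ 2 ^ 2"
    using True by (simp_all add: r_def)
  have "p $ 1 / r * p $ 1 + p $ 2 / r * p $ 2 = r"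
    using r by (simp add: field_simps power2_eq_square)
  moreover have "(p $ 1 / r)\<^sup>2 + (p $ 2 / r)\<^sup>2 = 1"
  proof -
    have "(p $ 1 / r)\<^sup>2 + (p $ 2 / r)\<^sup>2 = (p $ 1 ^ 2 + p $ 2 ^ 2) / (r * r)"
      by (simp add: power_divide power2_eq_square add_divide_distrib)
    then show ?thesis using r True by auto
  qed
  ultimately show ?thesis
    using r by (intro disjI2 bexI[of _ "(p $ 1 / r, p $ 2 / r)"]) (simp_all add: unit_circle_def outer_half_space_def)
next
  case False
  then have lt: "p $ 1 ^ 2 + p $ 2 ^ 2 < 1"
    using assms by (auto simp: theta_def)
  then have "p $ 1 ^ 2 \<le> 1"
    using zero_le_power2[of "p $ 2"] by linarith
  then have "\<bar>p $ 1\<bar> \<le> 1"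
    by (simp add: abs_square_le_1)
  then have "p $ 2 \<noteq> 0"
    using assms by (auto simp: theta_def)
  then show ?thesis
    using lt by (auto simp: half_disc_prism_def)
qed

text \<open>
  Potentials on the two half-spaces are compared along three discs (the third one passes through
  infinity); normalising one comparison leaves two group elements.
\<close>

lemma theta_flat_section:
  fixes act :: "'g::group_add \<Rightarrow> 'f \<Rightarrow> 'f"
  assumes atlas: "flat_atlas (top_of_set (- theta)) \<A>"
    and act_add: "\<And>g h v. act (g + h) v = act g (act h v)"
    and act_0: "\<And>v. act 0 v = v"
    and fixed: "\<And>g h. \<exists>v. P v \<and> act g v = v \<and> act h v = v"
    and P_act: "\<And>g v. P v \<Longrightarrow> P (act g v)"
  shows "\<exists>\<sigma>. (\<forall>x. P (\<sigma> x)) \<and> (\<forall>x V \<phi>. x \<notin> theta \<longrightarrow> (V, \<phi>) \<in> \<A> \<longrightarrow> x \<in> V \<longrightarrow>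
           (\<exists>W v. open W \<and> x \<in> W \<and> (\<forall>y\<in>W. act (\<phi> y) (\<sigma> y) = v)))"
proof -
  let ?Y = "- theta"
  define H where "H s = {p :: real ^ 3. 0 < s * p $ 3}" for s
  have H: "convex (H s)" "open (H s)" "H s \<subseteq> ?Y" for s
  proof -
    have "H s = (\<lambda>p. s * p $ 3) -` {0<..}" by (auto simp: H_def)
    moreover have "convex ((\<lambda>p::real^3. s * p $ 3) -` {0<..})"
      by (rule convex_linear_vimage) (auto intro!: linearI simp: algebra_simps)
    ultimately show "convex (H s)" by simp
    show "open (H s)" unfolding H_def by (intro open_Collect_less continuous_intros)
    show "H s \<subseteq> ?Y" by (auto simp: H_def theta_def)
  qed
  note conv = flat_on_convex[OF atlas open_compl_theta]
  note uniq = flat_on_connected_unique[OF atlas]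
  obtain \<psi>p where \<psi>p: "flat_on (top_of_set ?Y) \<A> (H 1) \<psi>p"
    using conv[OF H(1) H(2) H(3)] by blast
  obtain \<psi>m where \<psi>m: "flat_on (top_of_set ?Y) \<A> (H (-1)) \<psi>m"
    using conv[OF H(1) H(2) H(3)] by blast
  \<comment> \<open>A constant on the left makes the potential over \<open>C\<close> equal to
    \<open>\<psi>p\<close> above the plane. Then \<open>c\<close> alone records the comparison of
    the two half-spaces through \<open>C\<close>.\<close>
  have norm: "\<exists>\<psi> c. flat_on (top_of_set ?Y) \<A> C \<psi> \<and> (\<forall>x\<in>C \<inter> H 1. \<psi> x = \<psi>p x) \<and>
        (\<forall>x\<in>C \<inter> H (-1). \<psi> x = c + \<psi>m x)" if C: "convex C" "open C" "C \<subseteq> ?Y" for C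
  proof -
    obtain \<psi> where \<psi>: "flat_on (top_of_set ?Y) \<A> C \<psi>"
      using conv[OF C] by blast
    obtain b where b: "\<And>x. x \<in> C \<inter> H 1 \<Longrightarrow> \<psi>p x = b + \<psi> x"
      using uniq[OF _ _ \<psi> \<psi>p, of "C \<inter> H 1"] C H by (metis Int_lower1 Int_lower2 convex_Int convex_connected order_trans)
    obtain c where c: "\<And>x. x \<in> C \<inter> H (-1) \<Longrightarrow> \<psi> x = c + \<psi>m x"
      using uniq[OF _ _ \<psi>m \<psi>, of "C \<inter> H (-1)"] C H by (metis Int_lower1 Int_lower2 convex_Int convex_connected order_trans)
    have "flat_on (top_of_set ?Y) \<A> C (\<lambda>x. b + \<psi> x)"
      by (rule flat_on_cong_open[OF \<psi>]) (use C open_compl_theta in \<open>auto simp: openin_open_eq\<close>)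
    then show ?thesis
      using b c by (intro exI[of _ "\<lambda>x. b + \<psi> x"] exI[of _ "b + c"]) (auto simp: add.assoc)
  qed
  obtain \<psi>D aD where D: "\<And>s. flat_on (top_of_set ?Y) \<A> (half_disc_prism s) (\<psi>D s)"
    "\<And>s x. x \<in> half_disc_prism s \<Longrightarrow> x \<in> H 1 \<Longrightarrow> \<psi>D s x = \<psi>p x"
    "\<And>s x. x \<in> half_disc_prism s \<Longrightarrow> x \<in> H (-1) \<Longrightarrow> \<psi>D s x = aD s + \<psi>m x"
    using norm[OF half_disc_prism] by (metis IntI)
  have "\<exists>\<psi> c. flat_on (top_of_set ?Y) \<A> (outer_half_space u) \<psi> \<and> (\<forall>x\<in>outer_half_space u \<inter> H 1. \<psi> x = \<psi>p x) \<and>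
        (\<forall>x\<in>outer_half_space u \<inter> H (-1). \<psi> x = c + \<psi>m x)" if "u \<in> unit_circle" for u
    using norm[OF outer_half_space[OF that]] .
  then obtain \<psi>L c where L: "\<And>u. u \<in> unit_circle \<Longrightarrow> flat_on (top_of_set ?Y) \<A> (outer_half_space u) (\<psi>L u)"
    "\<And>u x. u \<in> unit_circle \<Longrightarrow> x \<in> outer_half_space u \<Longrightarrow> x \<in> H 1 \<Longrightarrow> \<psi>L u x = \<psi>p x"
    "\<And>u x. u \<in> unit_circle \<Longrightarrow> x \<in> outer_half_space u \<Longrightarrow> x \<in> H (-1) \<Longrightarrow> \<psi>L u x = c u + \<psi>m x"
    by (metis IntI)
  have meet: "\<psi>L u x = \<psi>L u' x \<and> c u = c u'"
    if u: "u \<in> unit_circle" "u' \<in> unit_circle" and x: "x \<in> outer_half_space u" "x \<in> outer_half_space u'" for u u' x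
  proof -
    let ?W = "outer_half_space u \<inter> outer_half_space u'"
    have W: "connected ?W" "?W \<subseteq> ?Y"
      using outer_half_space[OF u(1)] outer_half_space[OF u(2)] by (auto simp: convex_Int convex_connected)
    obtain d where d: "\<And>x. x \<in> ?W \<Longrightarrow> \<psi>L u' x = d + \<psi>L u x"
      using uniq[OF W L(1)[OF u(1)] L(1)[OF u(2)]] by blast
    \<comment> \<open>The overlap is invariant under vertical translation, so it has points above
      and below the plane. Above, the normalisation forces \<open>d = 0\<close>; below, the two
      constants must then be equal.\<close>
    define y where "y z = (vector [x $ 1, x $ 2, z] :: real ^ 3)" for z
    have y: "y z \<in> ?W" for z
      using x by (simp add: y_def outer_half_space_def vector_3)
    have H1: "y 1 \<in> H 1" "y (-1) \<in> H (-1)"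
      by (simp_all add: y_def H_def vector_3)
    have "d = 0"
      using d[OF y, of 1] L(2)[OF u(1) _ H1(1)] L(2)[OF u(2) _ H1(1)] y
      by (metis IntD1 IntD2 add.left_neutral add_right_cancel)
    moreover have "c u = c u'"
      using d[OF y, of "-1"] L(3)[OF u(1) _ H1(2)] L(3)[OF u(2) _ H1(2)] y \<open>d = 0\<close> by simp
    ultimately show ?thesis using d x by simp
  qed
  have e: "(1, 0) \<in> unit_circle" "(0, 1) \<in> unit_circle" by (simp_all add: unit_circle_def)
  have c1: "c u = c (1, 0)" if u: "u \<in> unit_circle" "fst u \<noteq> -1" for u
  proof -
    have "fst u ^ 2 \<le> 1"
      using u(1) zero_le_power2[of "snd u"] unfolding unit_circle_def mem_Collect_eq by linarith
    then have "\<bar>fst u\<bar> \<le> 1"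
      by (simp add: abs_square_le_1)
    then have pos: "0 < 1 + fst u" using u(2) by (auto simp: abs_le_iff)
    \<comment> \<open>The multiple of \<open>u + (1, 0)\<close> whose inner products with
      \<open>u\<close> and with \<open>(1, 0)\<close> both equal 2. It exists unless
      \<open>u\<close> is antipodal to \<open>(1, 0)\<close>.\<close>
    let ?t = "2 / (1 + fst u)"
    have t: "?t * (1 + fst u) = 2" using pos by (simp add: field_simps)
    have "snd u * snd u = (1 - fst u) * (1 + fst u)"
      using u(1) by (simp add: unit_circle_def power2_eq_square algebra_simps)
    then have "snd u * (?t * snd u) = (1 - fst u) * (?t * (1 + fst u))"
      by (simp add: algebra_simps)
    then have "fst u * (?t * (1 + fst u)) + snd u * (?t * snd u) = 2"
      unfolding t by simp
    with t have "vector [?t * (1 + fst u), ?t * snd u, 0] \<in> outer_half_space u"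
      "vector [?t * (1 + fst u), ?t * snd u, 0] \<in> outer_half_space (1, 0)"
      by (simp_all add: outer_half_space_def vector_3)
    then show ?thesis using meet[OF u(1) e(1)] by blast
  qed
  have c: "c u = c (1, 0)" if u: "u \<in> unit_circle" for u
  proof (cases "fst u = -1")
    case True
    then have "u = (-1, 0)" using u by (simp add: unit_circle_def prod_eq_iff)
    \<comment> \<open>The half-spaces of \<open>(-1, 0)\<close> and \<open>(1, 0)\<close> are
      disjoint, so the comparison goes through that of \<open>(0, 1)\<close>.\<close>
    then have "vector [-2, 2, 0] \<in> outer_half_space u" "vector [-2, 2, 0] \<in> outer_half_space (0, 1)"
      by (simp_all add: outer_half_space_def vector_3)
    then have "c u = c (0, 1)" using meet[OF u e(2)] by blast
    then show ?thesis using c1[OF e(2)] by simp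
  qed (rule c1[OF u])
  \<comment> \<open>Moving the lower potential by \<open>c (1, 0)\<close> makes the passage through
    the unbounded region trivial. One group element remains for each half disc.\<close>
  define g where "g s = aD s - c (1, 0)" for s
  obtain v where v: "P v" "act (g 1) v = v" "act (g (-1)) v = v"
    using fixed by blast
  have neg: "act (- h) v = v" if "act h v = v" for h
    by (metis act_0 act_add left_minus that)
  define \<psi>m' where "\<psi>m' x = c (1, 0) + \<psi>m x" for x
  define \<psi> where "\<psi> x = (if x \<in> H 1 then \<psi>p x else if x \<in> H (-1) then \<psi>m' x
     else if x \<in> half_disc_prism 1 then \<psi>D 1 x else if x \<in> half_disc_prism (-1) then \<psi>D (-1) x
     else \<psi>L (SOME u. u \<in> unit_circle \<and> x \<in> outer_half_space u) x)" for x
  \<comment> \<open>Changing the potential on the left by an element that fixes \<open>v\<close>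
    does not change \<open>act (- \<psi> x) v\<close>. So near each point \<open>\<sigma>\<close>
    can be computed from the potential of any piece containing that point.\<close>
  define \<sigma> where "\<sigma> x = act (- \<psi> x) v" for x
  have sect: "\<exists>W v. open W \<and> x \<in> W \<and> (\<forall>y\<in>W. act (\<phi> y) (\<sigma> y) = v)"
    if C: "flat_on (top_of_set ?Y) \<A> C \<theta>" "open C" "x \<in> C" "\<And>y. y \<in> C \<Longrightarrow> \<sigma> y = act (- \<theta> y) v"
      and V: "(V, \<phi>) \<in> \<A>" "x \<in> V" for x C \<theta> V \<phi>
  proof -
    obtain W d where W: "openin (top_of_set ?Y) W" "x \<in> W" "\<forall>y\<in>W. \<theta> y = d + \<phi> y"
      using flat_onD[OF C(1,3) V] unfolding agree_at_def by blast
    have "open W" using W(1) open_compl_theta by (simp add: openin_open_eq)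
    moreover have "act (\<phi> y) (\<sigma> y) = act (- d) v" if "y \<in> W \<inter> C" for y
    proof -
      have "\<phi> y + - (d + \<phi> y) = - d"
        by (simp only: minus_add flip: add.assoc) simp
      then show ?thesis
        using W(3) C(4) that by (simp flip: act_add)
    qed
    ultimately show ?thesis using W(2) C by (intro exI[of _ "W \<inter> C"]) auto
  qed
  have disj: "x \<in> H 1 \<Longrightarrow> x \<notin> H (-1)" for x by (simp add: H_def)
  have HC: "x \<in> H (-1) \<Longrightarrow> \<sigma> x = act (- \<psi>m' x) v" for x
    using disj by (auto simp: \<sigma>_def \<psi>_def)
  have fl_m': "flat_on (top_of_set ?Y) \<A> (H (-1)) \<psi>m'"
    by (rule flat_on_cong_open[OF \<psi>m, where c = "c (1, 0)"])
      (use H open_compl_theta in \<open>auto simp: openin_open_eq \<psi>m'_def\<close>)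
  have D': "\<sigma> x = act (- \<psi>D s x) v" if s: "s = 1 \<or> s = -1" and x: "x \<in> half_disc_prism s" for s x
  proof -
    consider "x \<in> H 1" | "x \<in> H (-1)" | "x \<notin> H 1" "x \<notin> H (-1)" by blast
    then show ?thesis
    proof cases
      case 1
      then show ?thesis using D(2)[OF x 1] by (simp add: \<sigma>_def \<psi>_def)
    next
      case 2
      have "\<psi>D s x = g s + \<psi>m' x"
        using D(3)[OF x 2] by (simp add: g_def \<psi>m'_def flip: add.assoc)
      moreover have "act (- g s) v = v" using neg v s by blast
      moreover have "act (- (g s + \<psi>m' x)) v = act (- \<psi>m' x) (act (- g s) v)"
        by (simp only: minus_add act_add)
      ultimately show ?thesis using HC[OF 2] by simp
    next
      case 3
      have "x \<notin> half_disc_prism 1" if "s = -1" using that x by (simp add: half_disc_prism_def)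
      then show ?thesis using 3 s x by (auto simp: \<sigma>_def \<psi>_def)
    qed
  qed
  have L': "\<sigma> x = act (- \<psi>L u x) v" if u: "u \<in> unit_circle" and x: "x \<in> outer_half_space u" for u x
  proof -
    consider "x \<in> H 1" | "x \<in> H (-1)" | "x \<notin> H 1" "x \<notin> H (-1)" by blast
    then show ?thesis
    proof cases
      case 1
      then show ?thesis using L(2)[OF u x 1] by (simp add: \<sigma>_def \<psi>_def)
    next
      case 2
      then show ?thesis using L(3)[OF u x 2] HC c[OF u] by (simp add: \<psi>m'_def)
    next
      case 3
      let ?u = "SOME u. u \<in> unit_circle \<and> x \<in> outer_half_space u"
      have "?u \<in> unit_circle \<and> x \<in> outer_half_space ?u"
        by (rule someI[of _ u]) (use u x in blast)
      then have "\<psi>L ?u x = \<psi>L u x" using meet u x by blast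
      moreover have "x \<notin> half_disc_prism s" for s
      proof
        assume "x \<in> half_disc_prism s"
        then have "x $ 1 ^ 2 + x $ 2 ^ 2 < 1" by (simp add: half_disc_prism_def)
        moreover have "(fst u * x $ 1 + snd u * x $ 2)\<^sup>2 \<le> (fst u ^ 2 + snd u ^ 2) * (x $ 1 ^ 2 + x $ 2 ^ 2)"
          using zero_le_power2[of "fst u * x $ 2 - snd u * x $ 1"] by (simp add: power2_eq_square algebra_simps)
        moreover have "1 < (fst u * x $ 1 + snd u * x $ 2)\<^sup>2"
          using x by (simp add: outer_half_space_def)
        ultimately show False using u by (simp add: unit_circle_def)
      qed
      ultimately show ?thesis using 3 by (simp add: \<sigma>_def \<psi>_def)
    qed
  qed
  show ?thesis
  proof (intro exI[of _ \<sigma>] conjI allI impI)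
    show "P (\<sigma> x)" for x unfolding \<sigma>_def by (rule P_act[OF v(1)])
    fix x V \<phi> assume x: "x \<notin> theta" and V: "(V, \<phi>) \<in> \<A>" "x \<in> V"
    consider "x \<in> H 1" | "x \<in> H (-1)" | s where "s = 1 \<or> s = -1" "x \<in> half_disc_prism s"
      | u where "u \<in> unit_circle" "x \<in> outer_half_space u"
      using compl_theta_cases[OF x] by (force simp: H_def)
    then show "\<exists>W v. open W \<and> x \<in> W \<and> (\<forall>y\<in>W. act (\<phi> y) (\<sigma> y) = v)"
    proof cases
      case 1
      show ?thesis by (rule sect[OF \<psi>p H(2) 1 _ V]) (simp add: \<sigma>_def \<psi>_def)
    next
      case 2
      show ?thesis by (rule sect[OF fl_m' H(2) 2 HC V])
    next
      case (3 s)
      show ?thesis by (rule sect[OF D(1) half_disc_prism(2) 3(2) D'[OF 3(1)] V])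
    next
      case (4 u)
      show ?thesis by (rule sect[OF L(1)[OF 4(1)] outer_half_space(2)[OF 4(1)] 4(2) L'[OF 4(1)] V])
    qed
  qed
qed

section \<open>Coloured tangle diagrams\<close>

definition loc_const :: "'a::topological_space set \<Rightarrow> ('a \<Rightarrow> 'b) \<Rightarrow> bool" where
  "loc_const S f \<longleftrightarrow> (\<forall>x\<in>S. \<exists>U. open U \<and> x \<in> U \<and> (\<forall>y\<in>U \<inter> S. f y = f x))"

lemma loc_constI:
  "(\<And>x. x \<in> S \<Longrightarrow> \<exists>U. open U \<and> x \<in> U \<and> (\<forall>y\<in>U \<inter> S. f y = f x)) \<Longrightarrow> loc_const S f"
  unfolding loc_const_def by blast

lemma loc_constD:
  assumes "loc_const S f" "x \<in> S"
  obtains U where "open U" "x \<in> U" "\<And>y. y \<in> U \<Longrightarrow> y \<in> S \<Longrightarrow> f y = f x"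
proof -
  obtain U where "open U" "x \<in> U" "\<forall>y\<in>U \<inter> S. f y = f x"
    using assms unfolding loc_const_def by blast
  then show ?thesis using that[of U] by simp
qed

lemma loc_const_vimage:
  assumes "loc_const S f" "continuous_on UNIV g"
  shows "loc_const (g -` S) (f \<circ> g)"
proof (rule loc_constI)
  fix x assume "x \<in> g -` S"
  then obtain U where "open U" "g x \<in> U" "\<And>y. y \<in> U \<Longrightarrow> y \<in> S \<Longrightarrow> f y = f (g x)"
    using loc_constD[OF assms(1)] by (metis vimageD)
  then show "\<exists>U. open U \<and> x \<in> U \<and> (\<forall>y\<in>U \<inter> g -` S. (f \<circ> g) y = (f \<circ> g) x)"
    using open_vimage[OF _ assms(2)] by (intro exI[of _ "g -` U"]) auto
qed

lemma loc_const_cong: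
  "S = T \<Longrightarrow> (\<And>x. x \<in> T \<Longrightarrow> f x = g x) \<Longrightarrow> loc_const S f \<longleftrightarrow> loc_const T g"
  unfolding loc_const_def by (metis IntD2)

text \<open>For face colours, whose planar domains are closed pieces meeting along their sides: a
  point off one piece has a neighbourhood missing it. The version for open sets serves the regions
  between two strands.\<close>

lemma loc_const_Un_closed:
  assumes "closed S1" "closed S2" "loc_const (S1 - N) f" "loc_const (S2 - N) f"
  shows "loc_const (S1 \<union> S2 - N) f"
proof (rule loc_constI)
  have *: "\<exists>U. open U \<and> x \<in> U \<and> (\<forall>y\<in>U \<inter> (S - N). f y = f x)"
    if "closed S" "loc_const (S - N) f" "x \<notin> N" for S x
  proof (cases "x \<in> S")
    case True
    then show ?thesis using that unfolding loc_const_def by blast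
  next
    case False
    then show ?thesis using that by (intro exI[of _ "- S"]) auto
  qed
  fix x assume "x \<in> S1 \<union> S2 - N"
  then obtain U V where "open U" "x \<in> U" "\<forall>y\<in>U \<inter> (S1 - N). f y = f x"
    "open V" "x \<in> V" "\<forall>y\<in>V \<inter> (S2 - N). f y = f x"
    using *[OF assms(1,3)] *[OF assms(2,4)] by (metis DiffD2)
  then show "\<exists>U. open U \<and> x \<in> U \<and> (\<forall>y\<in>U \<inter> (S1 \<union> S2 - N). f y = f x)"
    by (intro exI[of _ "U \<inter> V"]) auto
qed

lemma loc_const_Un_open:
  assumes "open M1" "open M2" "loc_const (M1 - N) f" "loc_const (M2 - N) f"
  shows "loc_const (M1 \<union> M2 - N) f"
proof (rule loc_constI)
  have *: "\<exists>U. open U \<and> x \<in> U \<and> (\<forall>y\<in>U \<inter> (M1 \<union> M2 - N). f y = f x)"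
    if M: "open M" "loc_const (M - N) f" "x \<in> M" "x \<notin> N" for M x
  proof -
    have "x \<in> M - N" using M by simp
    then obtain U where "open U" "x \<in> U" "\<And>y. y \<in> U \<Longrightarrow> y \<in> M - N \<Longrightarrow> f y = f x"
      by (rule loc_constD[OF M(2)]) blast
    then have "open (U \<inter> M)" "x \<in> U \<inter> M" "\<forall>y\<in>U \<inter> M \<inter> (M1 \<union> M2 - N). f y = f x"
      using M by (blast intro: open_Int)+
    then show ?thesis by blast
  qed
  fix x assume "x \<in> M1 \<union> M2 - N"
  then consider "x \<in> M1" "x \<notin> N" | "x \<in> M2" "x \<notin> N" by auto
  then show "\<exists>U. open U \<and> x \<in> U \<and> (\<forall>y\<in>U \<inter> (M1 \<union> M2 - N). f y = f x)"
    by cases (rule *[OF assms(1,3)], assumption+, rule *[OF assms(2,4)], assumption+)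
qed

section \<open>Colourings of diagrams and their gluing\<close>

definition proj :: "real ^ 3 \<Rightarrow> real \<times> real" where
  "proj p = (p $ 1, p $ 2)"

text \<open>Off the shadow the vertical ray upwards misses the diagram, off the roof the one
  downwards does, and over a face both do. The complements of these sets are the two large charts,
  as in the Dehn presentation of a knot group.\<close>

definition shadow :: "(real ^ 3) set \<Rightarrow> (real ^ 3) set" where
  "shadow T = {p. \<exists>t\<in>T. proj t = proj p \<and> p $ 3 \<le> t $ 3}"

definition roof :: "(real ^ 3) set \<Rightarrow> (real ^ 3) set" where
  "roof T = {p. \<exists>t\<in>T. proj t = proj p \<and> t $ 3 \<le> p $ 3}"

lemma proj_eq_iff: "p = q \<longleftrightarrow> proj p = proj q \<and> p $ 3 = q $ 3"
  by (auto simp: proj_def vec_eq_iff forall_3)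

lemma continuous_on_proj [continuous_intros]: "continuous_on A proj"
  unfolding proj_def by (intro continuous_intros)

text \<open>
  A colouring \<open>h\<close> of the faces of a diagram describes a local system on the complement of \<open>T\<close>: its
  trivialisation over the points with nothing of \<open>T\<close> above differs by \<open>h\<close> from the one over the
  points with nothing of \<open>T\<close> below.  The remaining points lie between two strands; they are covered
  by \<open>M\<close>, with trivialisation given by \<open>m\<close>.
\<close>

definition colouring :: "(real \<times> real) set \<Rightarrow> (real ^ 3) set \<Rightarrow>
    (real \<times> real \<Rightarrow> 'g::group_add) \<Rightarrow> (real \<times> real \<Rightarrow> 'g) \<Rightarrow> (real ^ 3) set \<Rightarrow> bool" where
  "colouring S T h m M \<longleftrightarrow>
     proj ` T \<subseteq> S \<and> loc_const (S - proj ` T) h \<and> open M \<and> M \<inter> T = {} \<and>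
     loc_const (M - shadow T) (\<lambda>p. m (proj p)) \<and>
     loc_const (M - roof T) (\<lambda>p. m (proj p) - h (proj p)) \<and>
     shadow T \<inter> roof T \<subseteq> T \<union> M"

text \<open>A diagram lying at height 0 has no point strictly between two of its strands, so the
  empty region suffices. Vertices are covered by this case: a vertex imposes no relation on the
  colours around it.\<close>

lemma colouring_planar:
  assumes "proj ` T \<subseteq> S" "loc_const (S - proj ` T) h" "\<And>t. t \<in> T \<Longrightarrow> t $ 3 = 0"
  shows "colouring S T h m {}"
proof -
  have "p \<in> T" if p: "p \<in> shadow T" "p \<in> roof T" for p
  proof -
    obtain t t' where "t \<in> T" "proj t = proj p" "p $ 3 \<le> t $ 3" "t' \<in> T" "t' $ 3 \<le> p $ 3"
      using p by (auto simp: shadow_def roof_def)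
    then show ?thesis using assms(3) by (metis order.antisym proj_eq_iff)
  qed
  then show ?thesis using assms(1,2) by (auto simp: colouring_def loc_const_def)
qed

text \<open>A colouring refers to heights only through their order, so it survives any map that
  preserves this order and covers an injection of the plane. Both the placements in a sum and the
  planar reflections have this form.\<close>

lemma colouring_vimage:
  assumes col: "colouring S T h m M"
    and g: "continuous_on UNIV g" "surj g" "\<And>p q. g p $ 3 \<le> g q $ 3 \<longleftrightarrow> p $ 3 \<le> q $ 3"
    and k: "continuous_on UNIV k" "inj k" "\<And>p. proj (g p) = k (proj p)"
  shows "colouring (k -` S) (g -` T) (h \<circ> k) (m \<circ> k) (g -` M)"
proof -
  have kk: "k x = k y \<longleftrightarrow> x = y" for x y using inj_eq[OF k(2)] .
  have ex: "(\<exists>t\<in>g -` T. proj t = proj p \<and> Q (g t)) \<longleftrightarrow> (\<exists>t\<in>T. proj t = proj (g p) \<and> Q t)" for p Q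
  proof
    assume "\<exists>t\<in>g -` T. proj t = proj p \<and> Q (g t)"
    then obtain t where "g t \<in> T" "proj t = proj p" "Q (g t)" by blast
    then show "\<exists>t\<in>T. proj t = proj (g p) \<and> Q t" using k(3) by (intro bexI[of _ "g t"]) simp_all
  next
    assume "\<exists>t\<in>T. proj t = proj (g p) \<and> Q t"
    then obtain t where t: "t \<in> T" "proj t = proj (g p)" "Q t" by blast
    obtain t' where t': "t = g t'" using g(2) by (rule surjE)
    then show "\<exists>t\<in>g -` T. proj t = proj p \<and> Q (g t)"
      using t k(3) kk by (intro bexI[of _ t']) simp_all
  qed
  have sh: "shadow (g -` T) = g -` shadow T"
    using ex[of _ "\<lambda>t. g _ $ 3 \<le> t $ 3"] by (auto simp: shadow_def g(3))
  have ro: "roof (g -` T) = g -` roof T"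
    using ex[of _ "\<lambda>t. t $ 3 \<le> g _ $ 3"] by (auto simp: roof_def g(3))
  have pr: "proj ` (g -` T) = k -` (proj ` T)"
  proof (intro set_eqI iffI)
    fix q assume "q \<in> k -` proj ` T"
    then obtain t where t: "t \<in> T" "k q = proj t" by auto
    obtain p where "t = g p" using g(2) by (rule surjE)
    with t have "g p \<in> T" "k q = proj (g p)" by simp_all
    then show "q \<in> proj ` (g -` T)" using k(3) kk by (metis imageI vimageI2)
  qed (auto simp flip: k(3))
  note col = col[unfolded colouring_def]
  have 1: "loc_const (k -` S - proj ` (g -` T)) (h \<circ> k)"
    using loc_const_vimage[of "S - proj ` T" h k] k(1) col by (simp add: pr vimage_Diff)
  have 2: "loc_const (g -` M - shadow (g -` T)) (\<lambda>p. (m \<circ> k) (proj p))"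
    using loc_const_vimage[of "M - shadow T" "\<lambda>p. m (proj p)" g] g(1) col
    by (simp add: sh vimage_Diff comp_def k(3))
  have 3: "loc_const (g -` M - roof (g -` T)) (\<lambda>p. (m \<circ> k) (proj p) - (h \<circ> k) (proj p))"
    using loc_const_vimage[of "M - roof T" "\<lambda>p. m (proj p) - h (proj p)" g] g(1) col
    by (simp add: ro vimage_Diff comp_def k(3))
  show ?thesis
    unfolding colouring_def using 1 2 3 col open_vimage[OF _ g(1)] by (auto simp: sh ro pr)
qed

text \<open>The pieces meet over common sides, where diagrams and face colours coincide. The regions
  between strands keep away from these sides, so each of their conditions concerns one piece
  only.\<close>

lemma colouring_Un:
  assumes c1: "colouring S1 T1 h1 m1 M1" and c2: "colouring S2 T2 h2 m2 M2"
    and cl: "closed S1" "closed S2"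
    and T: "\<And>p. p \<in> T1 \<Longrightarrow> proj p \<in> S2 \<Longrightarrow> p \<in> T2" "\<And>p. p \<in> T2 \<Longrightarrow> proj p \<in> S1 \<Longrightarrow> p \<in> T1"
    and h: "\<And>q. q \<in> S1 \<Longrightarrow> q \<in> S2 \<Longrightarrow> q \<notin> proj ` T1 \<Longrightarrow> h1 q = h2 q"
    and M: "\<And>p. p \<in> M1 \<Longrightarrow> proj p \<in> S1 - S2" "\<And>p. p \<in> M2 \<Longrightarrow> proj p \<in> S2 - S1"
  shows "colouring (S1 \<union> S2) (T1 \<union> T2) (\<lambda>q. if q \<in> S1 then h1 q else h2 q)
           (\<lambda>q. if q \<in> S1 then m1 q else m2 q) (M1 \<union> M2)" (is "colouring ?S ?T ?h ?m ?M")
proof -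
  note c1 = c1[unfolded colouring_def] and c2 = c2[unfolded colouring_def]
  have P: "proj p \<in> S1" if "p \<in> T1" for p using c1 that by blast
  have P': "proj p \<in> S2" if "p \<in> T2" for p using c2 that by blast
  have pr1: "q \<in> proj ` ?T \<longleftrightarrow> q \<in> proj ` T1" if "q \<in> S1" for q using T(2) that by (auto simp: image_iff)
  have pr2: "q \<in> proj ` ?T \<longleftrightarrow> q \<in> proj ` T2" if "q \<in> S2" for q using T(1) that by (auto simp: image_iff)
  have ex1: "(\<exists>t\<in>?T. proj t = proj p \<and> Q t) \<longleftrightarrow> (\<exists>t\<in>T1. proj t = proj p \<and> Q t)" if "proj p \<in> S1" for p Q
    using T(2) that by (metis UnE UnI1)
  have ex2: "(\<exists>t\<in>?T. proj t = proj p \<and> Q t) \<longleftrightarrow> (\<exists>t\<in>T2. proj t = proj p \<and> Q t)" if "proj p \<in> S2" for p Q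
    using T(1) that by (metis UnE UnI2)
  have sh1: "p \<in> shadow ?T \<longleftrightarrow> p \<in> shadow T1" and ro1: "p \<in> roof ?T \<longleftrightarrow> p \<in> roof T1" if "proj p \<in> S1" for p
    using ex1[OF that] by (simp_all add: shadow_def roof_def)
  have sh2: "p \<in> shadow ?T \<longleftrightarrow> p \<in> shadow T2" and ro2: "p \<in> roof ?T \<longleftrightarrow> p \<in> roof T2" if "proj p \<in> S2" for p
    using ex2[OF that] by (simp_all add: shadow_def roof_def)
  have "loc_const (S1 - proj ` ?T) ?h \<longleftrightarrow> loc_const (S1 - proj ` T1) h1"
    by (rule loc_const_cong) (use pr1 in auto)
  moreover have "loc_const (S2 - proj ` ?T) ?h \<longleftrightarrow> loc_const (S2 - proj ` T2) h2"
  proof (rule loc_const_cong)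
    show "S2 - proj ` ?T = S2 - proj ` T2" using pr2 by auto
    fix q assume "q \<in> S2 - proj ` T2"
    then show "?h q = h2 q" using h[of q] pr1[of q] pr2[of q] by auto
  qed
  ultimately have 1: "loc_const (?S - proj ` ?T) ?h"
    using c1 c2 by (intro loc_const_Un_closed[OF cl]) blast+
  have "loc_const (M1 - shadow ?T) (\<lambda>p. ?m (proj p)) \<longleftrightarrow> loc_const (M1 - shadow T1) (\<lambda>p. m1 (proj p))"
    by (rule loc_const_cong) (use sh1 M(1) in auto)
  moreover have "loc_const (M2 - shadow ?T) (\<lambda>p. ?m (proj p)) \<longleftrightarrow> loc_const (M2 - shadow T2) (\<lambda>p. m2 (proj p))"
    by (rule loc_const_cong) (use sh2 M(2) in auto)
  ultimately have 2: "loc_const (?M - shadow ?T) (\<lambda>p. ?m (proj p))"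
    using c1 c2 by (intro loc_const_Un_open) blast+
  have "loc_const (M1 - roof ?T) (\<lambda>p. ?m (proj p) - ?h (proj p)) \<longleftrightarrow>
      loc_const (M1 - roof T1) (\<lambda>p. m1 (proj p) - h1 (proj p))"
    by (rule loc_const_cong) (use ro1 M(1) in auto)
  moreover have "loc_const (M2 - roof ?T) (\<lambda>p. ?m (proj p) - ?h (proj p)) \<longleftrightarrow>
      loc_const (M2 - roof T2) (\<lambda>p. m2 (proj p) - h2 (proj p))"
    by (rule loc_const_cong) (use ro2 M(2) in auto)
  ultimately have 3: "loc_const (?M - roof ?T) (\<lambda>p. ?m (proj p) - ?h (proj p))"
    using c1 c2 by (intro loc_const_Un_open) blast+
  have 4: "shadow ?T \<inter> roof ?T \<subseteq> ?T \<union> ?M"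
  proof
    fix p assume p: "p \<in> shadow ?T \<inter> roof ?T"
    then obtain t where "t \<in> ?T" "proj t = proj p" by (auto simp: shadow_def)
    then consider "proj p \<in> S1" | "proj p \<in> S2" using P P' by (metis UnE)
    then show "p \<in> ?T \<union> ?M"
    proof cases
      case 1
      then show ?thesis using sh1 ro1 p c1 by blast
    next
      case 2
      then show ?thesis using sh2 ro2 p c2 by blast
    qed
  qed
  have 5: "?M \<inter> ?T = {}" using c1 c2 M P P' by blast
  show ?thesis unfolding colouring_def using 1 2 3 4 5 c1 c2 by auto
qed

section \<open>Tangles with coloured boundary faces; the two crossings\<close>

definition square :: "(real \<times> real) set" where
  "square = {q. \<bar>fst q\<bar> \<le> 1 \<and> \<bar>snd q\<bar> \<le> 1}"

text \<open>The last four arguments are the colours of the faces at the top, right, bottom and left.\<close>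

definition tangle_colouring ::
    "tangle \<Rightarrow> (real \<times> real \<Rightarrow> 'g::group_add) \<Rightarrow> 'g \<Rightarrow> 'g \<Rightarrow> 'g \<Rightarrow> 'g \<Rightarrow> bool" where
  "tangle_colouring T h n e s w \<longleftrightarrow>
     (\<exists>m M. colouring square T h m M \<and> (\<forall>p\<in>M. \<bar>p $ 1\<bar> < 1 \<and> \<bar>p $ 2\<bar> < 1)) \<and>
     (\<forall>x. \<bar>x\<bar> < 1 \<longrightarrow> h (x, 1) = n \<and> h (x, -1) = s \<and> h (1, x) = e \<and> h (-1, x) = w) \<and>
     (\<forall>p\<in>T. \<bar>p $ 1\<bar> = 1 \<or> \<bar>p $ 2\<bar> = 1 \<longrightarrow> p \<in> {NW, NE, SW, SE}) \<and> {NW, NE, SW, SE} \<subseteq> T \<and>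
     compact T"

text \<open>Slopes are cross-multiplied, so that with numerical endpoints equalities between
  polygonal sets become linear arithmetic.\<close>

lemma closed_segment_graph:
  assumes "a < a'"
  shows "closed_segment (vector [a, b, c]) (vector [a', b', c']) =
    {p :: real ^ 3. a \<le> p $ 1 \<and> p $ 1 \<le> a' \<and> (p $ 2 - b) * (a' - a) = (p $ 1 - a) * (b' - b) \<and>
       (p $ 3 - c) * (a' - a) = (p $ 1 - a) * (c' - c)}"
proof (intro equalityI subsetI)
  fix p :: "real ^ 3" assume "p \<in> closed_segment (vector [a, b, c]) (vector [a', b', c'])"
  then obtain u where u: "0 \<le> u" "u \<le> 1" "p = (1 - u) *\<^sub>R vector [a, b, c] + u *\<^sub>R vector [a', b', c']"
    by (auto simp: closed_segment_def)
  have p: "p $ 1 = a + u * (a' - a)" "p $ 2 = b + u * (b' - b)" "p $ 3 = c + u * (c' - c)"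
    unfolding u(3) by (simp_all add: vector_3 algebra_simps)
  have "0 \<le> u * (a' - a)" "u * (a' - a) \<le> 1 * (a' - a)"
    using u(1,2) assms by (simp, intro mult_right_mono) auto
  then show "p \<in> {p. a \<le> p $ 1 \<and> p $ 1 \<le> a' \<and> (p $ 2 - b) * (a' - a) = (p $ 1 - a) * (b' - b) \<and>
       (p $ 3 - c) * (a' - a) = (p $ 1 - a) * (c' - c)}"
    unfolding p mem_Collect_eq by (auto simp: algebra_simps)
next
  fix p :: "real ^ 3" assume "p \<in> {p. a \<le> p $ 1 \<and> p $ 1 \<le> a' \<and> (p $ 2 - b) * (a' - a) = (p $ 1 - a) * (b' - b) \<and>
       (p $ 3 - c) * (a' - a) = (p $ 1 - a) * (c' - c)}"
  then have p: "a \<le> p $ 1" "p $ 1 \<le> a'" "(p $ 2 - b) * (a' - a) = (p $ 1 - a) * (b' - b)"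
       "(p $ 3 - c) * (a' - a) = (p $ 1 - a) * (c' - c)" by auto
  define u where "u = (p $ 1 - a) / (a' - a)"
  have u: "0 \<le> u" "u \<le> 1" using p assms by (simp_all add: u_def)
  have "p $ 1 - a = u * (a' - a)" "p $ 2 - b = u * (b' - b)" "p $ 3 - c = u * (c' - c)"
    using p assms by (simp_all add: u_def eq_divide_eq)
  then have "p = (1 - u) *\<^sub>R vector [a, b, c] + u *\<^sub>R vector [a', b', c']"
    by (simp add: vec_eq_iff forall_3 vector_3 algebra_simps)
  then show "p \<in> closed_segment (vector [a, b, c]) (vector [a', b', c'])"
    using u by (auto simp: closed_segment_def)
qed

lemma pos_crossing_eq:
  "pos_crossing = {p. \<bar>p $ 1\<bar> \<le> 1 \<and> (p $ 2 = p $ 1 \<and> p $ 3 = 1 - \<bar>p $ 1\<bar> \<or> p $ 2 = - (p $ 1) \<and> p $ 3 = 0)}"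
  unfolding pos_crossing_def NW_def NE_def SW_def SE_def
  by (subst closed_segment_graph, simp)+ (auto simp: algebra_simps abs_if)

lemma neg_crossing_eq:
  "neg_crossing = {p. \<bar>p $ 1\<bar> \<le> 1 \<and> (p $ 2 = - (p $ 1) \<and> p $ 3 = 1 - \<bar>p $ 1\<bar> \<or> p $ 2 = p $ 1 \<and> p $ 3 = 0)}"
  unfolding neg_crossing_def NW_def NE_def SW_def SE_def
  by (subst closed_segment_graph, simp)+ (auto simp: algebra_simps abs_if)

text \<open>The relation says that the meridian of the over-strand does not change where the other
  strand passes beneath: \<open>- n + e\<close> is read off at its upper right half and
  \<open>- w + s\<close> at its lower left half.\<close>

lemma tangle_colouring_pos_crossing:
  fixes n e s w :: "'g::group_add"
  assumes rel: "- n + e = - w + s"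
  obtains h where "tangle_colouring pos_crossing h n e s w"
proof -
  define h where "h q = (if fst q > snd q then (if fst q + snd q > 0 then e else s)
      else (if fst q + snd q > 0 then n else w))" for q :: "real \<times> real"
  \<comment> \<open>Seen from between the strands, the over-strand lies above and the under-strand
    below. So \<open>m\<close>, which compares with the upper chart, jumps across the over-strand
    only, and \<open>m - h\<close>, which compares with the lower chart, must jump across the
    under-strand only.\<close>
  define m where "m q = (if fst q > snd q then - n + e else 0)" for q :: "real \<times> real"
  \<comment> \<open>The open prism over the square, without the over-strand and everything above it
    and without the under-strand and everything below it.\<close>
  define M where "M = {p :: real ^ 3. \<bar>p $ 1\<bar> < 1 \<and> \<bar>p $ 2\<bar> < 1 \<and>
      (p $ 1 \<noteq> p $ 2 \<or> p $ 3 < 1 - \<bar>p $ 1\<bar>) \<and> (p $ 1 \<noteq> - (p $ 2) \<or> p $ 3 > 0)}"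
  let ?T = pos_crossing
  have over: "\<exists>t\<in>?T. proj t = proj p \<and> t $ 3 = 1 - \<bar>p $ 1\<bar>" if "p $ 1 = p $ 2" "\<bar>p $ 1\<bar> \<le> 1" for p
    using that by (intro bexI[of _ "vector [p $ 1, p $ 2, 1 - \<bar>p $ 1\<bar>]"]) (simp_all add: pos_crossing_eq proj_def vector_3)
  have under: "\<exists>t\<in>?T. proj t = proj p \<and> t $ 3 = 0" if "p $ 1 = - p $ 2" "\<bar>p $ 1\<bar> \<le> 1" for p
    using that by (intro bexI[of _ "vector [p $ 1, p $ 2, 0]"]) (simp_all add: pos_crossing_eq proj_def vector_3)
  have pr: "q \<in> proj ` ?T" if "\<bar>fst q\<bar> \<le> 1" "fst q = snd q \<or> fst q = - snd q" for q
  proof -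
    let ?p = "vector [fst q, snd q, 0] :: real ^ 3"
    have "proj ?p = q" by (simp add: proj_def vector_3)
    moreover have "\<exists>t\<in>?T. proj t = proj ?p"
      using over[of ?p] under[of ?p] that by (auto simp: vector_3)
    ultimately show ?thesis by (metis imageI)
  qed
  have 1: "loc_const (square - proj ` ?T) h"
  proof (rule loc_constI)
    fix q assume "q \<in> square - proj ` ?T"
    then have q: "fst q \<noteq> snd q" "fst q \<noteq> - snd q"
      using pr[of q] by (auto simp: square_def)
    define U where "U = {q' :: real \<times> real. (if fst q < snd q then fst q' < snd q' else snd q' < fst q') \<and>
       (if 0 < fst q + snd q then 0 < fst q' + snd q' else fst q' + snd q' < 0)}"
    have "open U" unfolding U_def
      by (cases "fst q < snd q"; cases "0 < fst q + snd q"; simp; intro open_Collect_conj open_Collect_less continuous_intros)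
    moreover have "q \<in> U" using q by (auto simp: U_def)
    moreover have "h q' = h q" if "q' \<in> U" for q' using that q by (auto simp: U_def h_def split: if_splits)
    ultimately show "\<exists>U. open U \<and> q \<in> U \<and> (\<forall>y\<in>U \<inter> (square - proj ` ?T). h y = h q)" by blast
  qed
  have "open M" unfolding M_def
    by (intro open_Collect_conj open_Collect_disj open_Collect_less open_Collect_neq continuous_intros)
  have 2: "loc_const (M - shadow ?T) (\<lambda>p. m (proj p))"
  proof (rule loc_constI)
    fix p assume p: "p \<in> M - shadow ?T"
    then have ne: "p $ 1 \<noteq> p $ 2" using over[of p] by (force simp: M_def shadow_def)
    define U where "U = {p' :: real ^ 3. if p $ 1 < p $ 2 then p' $ 1 < p' $ 2 else p' $ 2 < p' $ 1}"
    have "open U" unfolding U_def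
      by (cases "p $ 1 < p $ 2"; simp; intro open_Collect_less continuous_intros)
    moreover have "p \<in> U" using ne by (auto simp: U_def)
    moreover have "m (proj p') = m (proj p)" if "p' \<in> U" for p'
      using that ne by (auto simp: U_def m_def proj_def split: if_splits)
    ultimately show "\<exists>U. open U \<and> p \<in> U \<and> (\<forall>y\<in>U \<inter> (M - shadow ?T). m (proj y) = m (proj p))" by blast
  qed
  have 3: "loc_const (M - roof ?T) (\<lambda>p. m (proj p) - h (proj p))"
  proof (rule loc_constI)
    fix p assume p: "p \<in> M - roof ?T"
    then have ne: "p $ 1 + p $ 2 \<noteq> 0" using under[of p] by (force simp: M_def roof_def)
    define U where "U = {p' :: real ^ 3. if 0 < p $ 1 + p $ 2 then 0 < p' $ 1 + p' $ 2 else p' $ 1 + p' $ 2 < 0}"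
    have "open U" unfolding U_def
      by (cases "0 < p $ 1 + p $ 2"; simp; intro open_Collect_less continuous_intros)
    moreover have "p \<in> U" using ne by (auto simp: U_def)
    moreover have "m (proj p') - h (proj p') = (if 0 < p $ 1 + p $ 2 then - n else - w)" if "p' \<in> U" for p'
    proof -
      \<comment> \<open>The crossing relation enters here: it makes \<open>m - h\<close> equal on
        the two faces \<open>w\<close> and \<open>s\<close>, which lie on the same side of the
        under-strand.\<close>
      have "(- n + e) - e = - n" "(- n + e) - s = - w" by simp (simp add: rel)
      then show ?thesis using that ne by (auto simp: U_def m_def h_def proj_def split: if_splits)
    qed
    ultimately show "\<exists>U. open U \<and> p \<in> U \<and>
        (\<forall>y\<in>U \<inter> (M - roof ?T). m (proj y) - h (proj y) = m (proj p) - h (proj p))"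
      by (intro exI[of _ U]) auto
  qed
  have "p \<in> ?T \<union> M" if p: "p \<in> shadow ?T" "p \<in> roof ?T" for p
  proof -
    obtain t t' where "t \<in> ?T" "proj t = proj p" "p $ 3 \<le> t $ 3" "t' \<in> ?T" "proj t' = proj p" "t' $ 3 \<le> p $ 3"
      using p by (auto simp: shadow_def roof_def)
    then have le: "p $ 3 \<le> t $ 3" "t' $ 3 \<le> p $ 3" "\<bar>p $ 1\<bar> \<le> 1"
      and t: "p $ 2 = p $ 1 \<and> t $ 3 = 1 - \<bar>p $ 1\<bar> \<or> p $ 2 = - (p $ 1) \<and> t $ 3 = 0"
      and t': "p $ 2 = p $ 1 \<and> t' $ 3 = 1 - \<bar>p $ 1\<bar> \<or> p $ 2 = - (p $ 1) \<and> t' $ 3 = 0"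
      by (simp_all add: pos_crossing_eq proj_def)
    show ?thesis
    proof (cases "p $ 1 = 0 \<and> p $ 2 = 0")
      case True
      then have "0 \<le> p $ 3" "p $ 3 \<le> 1" using le t t' by auto
      then show ?thesis using True by (auto simp: pos_crossing_eq M_def)
    next
      case False
      then have "t $ 3 = t' $ 3" using t t' by linarith
      then have "p $ 3 = t $ 3" using le by linarith
      then show ?thesis using t le by (auto simp: pos_crossing_eq)
    qed
  qed
  moreover have "M \<inter> ?T = {}" by (auto simp: M_def pos_crossing_eq)
  moreover have "proj ` ?T \<subseteq> square" by (auto simp: square_def pos_crossing_eq proj_def)
  ultimately have "colouring square ?T h m M"
    unfolding colouring_def using 1 2 3 \<open>open M\<close> by blast
  moreover have "compact ?T" by (simp add: pos_crossing_def compact_Un)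
  moreover have "\<forall>p\<in>?T. \<bar>p $ 1\<bar> = 1 \<or> \<bar>p $ 2\<bar> = 1 \<longrightarrow> p \<in> {NW, NE, SW, SE}"
    unfolding pos_crossing_eq NW_def NE_def SW_def SE_def
    by (auto simp: vec_eq_iff forall_3 vector_3 abs_if split: if_splits)
  moreover have "{NW, NE, SW, SE} \<subseteq> ?T"
    by (auto simp: pos_crossing_def)
  moreover have "\<forall>p\<in>M. \<bar>p $ 1\<bar> < 1 \<and> \<bar>p $ 2\<bar> < 1" by (auto simp: M_def)
  moreover have "\<forall>x. \<bar>x\<bar> < 1 \<longrightarrow> h (x, 1) = n \<and> h (x, -1) = s \<and> h (1, x) = e \<and> h (-1, x) = w"
    by (auto simp: h_def)
  ultimately have "tangle_colouring ?T h n e s w" unfolding tangle_colouring_def by blast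
  then show ?thesis using that by blast
qed

text \<open>The reflection \<open>(x, y, z) \<mapsto> (x, - y, z)\<close> keeps heights and reverses
  slopes, so it turns one crossing into the other and exchanges top and bottom. Negating both sides
  of \<open>rel\<close> gives the relation of the positive crossing with \<open>n\<close> and
  \<open>s\<close> exchanged.\<close>

lemma tangle_colouring_neg_crossing:
  fixes n e s w :: "'g::group_add"
  assumes rel: "- n + w = - e + s"
  obtains h where "tangle_colouring neg_crossing h n e s w"
proof -
  define g where "g p = (vector [p $ 1, - p $ 2, p $ 3] :: real ^ 3)" for p :: "real ^ 3"
  define k where "k q = (fst q, - snd q)" for q :: "real \<times> real"
  have g_nth [simp]: "g p $ 1 = p $ 1" "g p $ 2 = - p $ 2" "g p $ 3 = p $ 3" for p
    by (simp_all add: g_def vector_3)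
  have "- s + e = - (- e + s)" by (simp add: minus_add)
  also have "\<dots> = - w + n" by (simp add: minus_add flip: rel)
  finally obtain h where "tangle_colouring pos_crossing h s e n w"
    using tangle_colouring_pos_crossing by blast
  then obtain m M where col: "colouring square pos_crossing h m M" "\<forall>p\<in>M. \<bar>p $ 1\<bar> < 1 \<and> \<bar>p $ 2\<bar> < 1"
    and h: "\<And>x. \<bar>x\<bar> < 1 \<Longrightarrow> h (x, 1) = s \<and> h (x, -1) = n \<and> h (1, x) = e \<and> h (-1, x) = w"
    unfolding tangle_colouring_def by auto
  have "linear g" by (rule linearI) (simp_all add: vec_eq_iff forall_3)
  then have gc: "continuous_on UNIV g" by (simp add: linear_continuous_on linear_linear)
  have gg: "g (g p) = p" for p by (simp add: vec_eq_iff forall_3)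
  have kc: "continuous_on UNIV k" unfolding k_def by (intro continuous_intros)
  have "surj g" using gg by (rule surjI)
  have "colouring (k -` square) (g -` pos_crossing) (h \<circ> k) (m \<circ> k) (g -` M)"
    by (rule colouring_vimage[OF col(1) gc \<open>surj g\<close> _ kc]) (auto simp: inj_def k_def proj_def)
  moreover have "k -` square = square" by (auto simp: k_def square_def)
  moreover have "g -` pos_crossing = neg_crossing"
    by (auto simp: pos_crossing_eq neg_crossing_eq)
  moreover have "\<forall>p\<in>g -` M. \<bar>p $ 1\<bar> < 1 \<and> \<bar>p $ 2\<bar> < 1" using col(2) by auto
  moreover have "\<forall>x. \<bar>x\<bar> < 1 \<longrightarrow> (h \<circ> k) (x, 1) = n \<and> (h \<circ> k) (x, -1) = s \<and> (h \<circ> k) (1, x) = e \<and> (h \<circ> k) (-1, x) = w"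
    using h by (auto simp: k_def)
  moreover have "\<forall>p\<in>neg_crossing. \<bar>p $ 1\<bar> = 1 \<or> \<bar>p $ 2\<bar> = 1 \<longrightarrow> p \<in> {NW, NE, SW, SE}"
    unfolding neg_crossing_eq NW_def NE_def SW_def SE_def
    by (auto simp: vec_eq_iff forall_3 vector_3 abs_if split: if_splits)
  moreover have "{NW, NE, SW, SE} \<subseteq> neg_crossing" by (auto simp: neg_crossing_def)
  moreover have "compact neg_crossing" by (simp add: neg_crossing_def compact_Un)
  ultimately have "tangle_colouring neg_crossing (h \<circ> k) n e s w"
    unfolding tangle_colouring_def by auto
  then show ?thesis using that by blast
qed

section \<open>Reflection in the diagonal from NW to SE\<close>

definition flip :: "real ^ 3 \<Rightarrow> real ^ 3" where
  "flip p = vector [- p $ 2, - p $ 1, p $ 3]"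

lemma flip_nth [simp]: "flip p $ 1 = - p $ 2" "flip p $ 2 = - p $ 1" "flip p $ 3 = p $ 3"
  by (simp_all add: flip_def vector_3)

lemma flip_flip [simp]: "flip (flip p) = p"
  by (simp add: vec_eq_iff forall_3)

lemma linear_flip: "linear flip"
  by (rule linearI) (simp_all add: vec_eq_iff forall_3)

lemma flip_image: "flip ` T = flip -` T"
  by (metis (no_types) flip_flip bij_betw_def bij_betw_inv_into bij_vimage_eq_inv_image inv_f_eq involuntory_imp_bij ext)

lemma flip_corners [simp]: "flip NW = NW" "flip SE = SE" "flip NE = SW" "flip SW = NE"
  by (simp_all add: vec_eq_iff forall_3 vector_3 NW_def SE_def NE_def SW_def)

lemma tangle_colouring_flip:
  assumes "tangle_colouring T h n e s w"
  obtains h' where "tangle_colouring (flip ` T) h' w s e n"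
proof -
  define k where "k q = (- snd q, - fst q)" for q :: "real \<times> real"
  obtain m M where col: "colouring square T h m M" "\<forall>p\<in>M. \<bar>p $ 1\<bar> < 1 \<and> \<bar>p $ 2\<bar> < 1"
    and h: "\<And>x. \<bar>x\<bar> < 1 \<Longrightarrow> h (x, 1) = n \<and> h (x, -1) = s \<and> h (1, x) = e \<and> h (-1, x) = w"
    and T: "\<forall>p\<in>T. \<bar>p $ 1\<bar> = 1 \<or> \<bar>p $ 2\<bar> = 1 \<longrightarrow> p \<in> {NW, NE, SW, SE}" "{NW, NE, SW, SE} \<subseteq> T" "compact T"
    using assms unfolding tangle_colouring_def by auto
  have gc: "continuous_on UNIV flip"
    using linear_flip by (simp add: linear_continuous_on linear_linear)
  have kc: "continuous_on UNIV k" unfolding k_def by (intro continuous_intros)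
  have "surj flip" by (rule surjI) (rule flip_flip)
  have "colouring (k -` square) (flip -` T) (h \<circ> k) (m \<circ> k) (flip -` M)"
    by (rule colouring_vimage[OF col(1) gc \<open>surj flip\<close> _ kc]) (auto simp: inj_def k_def proj_def)
  moreover have "k -` square = square" by (auto simp: k_def square_def)
  moreover have "\<forall>p\<in>flip -` M. \<bar>p $ 1\<bar> < 1 \<and> \<bar>p $ 2\<bar> < 1" using col(2) by force
  moreover have "\<forall>x. \<bar>x\<bar> < 1 \<longrightarrow> (h \<circ> k) (x, 1) = w \<and> (h \<circ> k) (x, -1) = e \<and> (h \<circ> k) (1, x) = s \<and> (h \<circ> k) (-1, x) = n"
    using h by (auto simp: k_def)
  moreover have "\<forall>p\<in>flip ` T. \<bar>p $ 1\<bar> = 1 \<or> \<bar>p $ 2\<bar> = 1 \<longrightarrow> p \<in> {NW, NE, SW, SE}"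
    using T(1) by force
  moreover have "{NW, NE, SW, SE} \<subseteq> flip ` T"
    using T(2) by (auto simp: flip_image)
  moreover have "compact (flip ` T)"
    using T(3) compact_continuous_image[OF continuous_on_subset[OF gc subset_UNIV]] by blast
  ultimately have "tangle_colouring (flip ` T) (h \<circ> k) w s e n"
    unfolding tangle_colouring_def by (auto simp: flip_image)
  then show ?thesis using that by blast
qed

text \<open>The reflection keeps heights and carries the upper half of the square to the left half,
  so only horizontal sums have to be coloured by hand.\<close>

lemma vsum_flip: "vsum T T' = flip ` hsum (flip ` T) (flip ` T')"
proof -
  have pl: "flip (place c p) = place (flip c) (flip p)" for c p
    by (simp add: place_def vec_eq_iff forall_3)
  have c: "flip (vector [- (1/2), 0, 0]) = vector [0, 1/2, 0]" "flip (vector [1/2, 0, 0]) = vector [0, - (1/2), 0]"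
    by (simp_all add: vec_eq_iff forall_3 vector_3)
  have seg: "flip ` closed_segment a b = closed_segment (flip a) (flip b)" for a b
    by (rule closed_segment_linear_image[OF linear_flip, symmetric])
  show ?thesis
    by (simp add: vsum_def hsum_def Let_def image_Un image_image seg pl c closed_segment_commute Un_ac)
qed

section \<open>Colouring a horizontal sum\<close>

definition hsum_wires :: "(real ^ 3) set" where
  "hsum_wires = {p. p $ 3 = 0 \<and> (\<bar>p $ 2\<bar> = 1/4 \<and> \<bar>p $ 1\<bar> \<le> 1/4 \<or>
     \<bar>p $ 2\<bar> = 3 * \<bar>p $ 1\<bar> - 2 \<and> 3/4 \<le> \<bar>p $ 1\<bar> \<and> \<bar>p $ 1\<bar> \<le> 1)}"

lemma place_corners:
  "place (vector [a, b, 0]) NW = vector [a - 1/4, b + 1/4, 0]"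
  "place (vector [a, b, 0]) NE = vector [a + 1/4, b + 1/4, 0]"
  "place (vector [a, b, 0]) SW = vector [a - 1/4, b - 1/4, 0]"
  "place (vector [a, b, 0]) SE = vector [a + 1/4, b - 1/4, 0]"
  by (simp_all add: place_def NW_def NE_def SW_def SE_def vec_eq_iff forall_3 vector_3)

text \<open>Placed summands have their outer corners at distance 3/4 from the vertical axis and 1/4
  from the horizontal one. The wires from there to the corners of the square have slope 3 or -3,
  which is the equation with \<open>3 * \<bar>p $ 1\<bar> - 2\<close>.\<close>

lemma hsum_eq:
  "hsum T T' = hsum_wires \<union> place (vector [-1/2, 0, 0]) ` T \<union> place (vector [1/2, 0, 0]) ` T'"
proof -
  have s1: "closed_segment NW (vector [-3/4, 1/4, 0]) = {p. -1 \<le> p $ 1 \<and> p $ 1 \<le> -3/4 \<and> p $ 2 = -2 - 3 * p $ 1 \<and> p $ 3 = 0}"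
    unfolding NW_def by (subst closed_segment_graph) (auto simp: field_simps)
  have s2: "closed_segment SW (vector [-3/4, -1/4, 0]) = {p. -1 \<le> p $ 1 \<and> p $ 1 \<le> -3/4 \<and> p $ 2 = 2 + 3 * p $ 1 \<and> p $ 3 = 0}"
    unfolding SW_def by (subst closed_segment_graph) (auto simp: field_simps)
  have s3: "closed_segment (vector [3/4, 1/4, 0]) NE = {p. 3/4 \<le> p $ 1 \<and> p $ 1 \<le> 1 \<and> p $ 2 = 3 * p $ 1 - 2 \<and> p $ 3 = 0}"
    unfolding NE_def by (subst closed_segment_graph) (auto simp: field_simps)
  have s4: "closed_segment (vector [3/4, -1/4, 0]) SE = {p. 3/4 \<le> p $ 1 \<and> p $ 1 \<le> 1 \<and> p $ 2 = 2 - 3 * p $ 1 \<and> p $ 3 = 0}"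
    unfolding SE_def by (subst closed_segment_graph) (auto simp: field_simps)
  have s5: "closed_segment (vector [-1/4, b, 0]) (vector [1/4, b, 0]) = {p :: real ^ 3. -1/4 \<le> p $ 1 \<and> p $ 1 \<le> 1/4 \<and> p $ 2 = b \<and> p $ 3 = 0}" for b
    by (subst closed_segment_graph) auto
  have "hsum_wires = closed_segment (vector [-1/4, 1/4, 0]) (vector [1/4, 1/4, 0]) \<union>
      closed_segment (vector [-1/4, -1/4, 0]) (vector [1/4, -1/4, 0]) \<union>
      closed_segment NW (vector [-3/4, 1/4, 0]) \<union> closed_segment SW (vector [-3/4, -1/4, 0]) \<union>
      closed_segment (vector [3/4, 1/4, 0]) NE \<union> closed_segment (vector [3/4, -1/4, 0]) SE"
    unfolding hsum_wires_def s1 s2 s3 s4 s5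
  proof (intro set_eqI)
    fix p :: "real ^ 3"
    show "p \<in> {p. p $ 3 = 0 \<and> (\<bar>p $ 2\<bar> = 1/4 \<and> \<bar>p $ 1\<bar> \<le> 1/4 \<or>
          \<bar>p $ 2\<bar> = 3 * \<bar>p $ 1\<bar> - 2 \<and> 3/4 \<le> \<bar>p $ 1\<bar> \<and> \<bar>p $ 1\<bar> \<le> 1)} \<longleftrightarrow>
        p \<in> {p. -1/4 \<le> p $ 1 \<and> p $ 1 \<le> 1/4 \<and> p $ 2 = 1/4 \<and> p $ 3 = 0} \<union>
          {p. -1/4 \<le> p $ 1 \<and> p $ 1 \<le> 1/4 \<and> p $ 2 = -1/4 \<and> p $ 3 = 0} \<union>
          {p. -1 \<le> p $ 1 \<and> p $ 1 \<le> -3/4 \<and> p $ 2 = -2 - 3 * p $ 1 \<and> p $ 3 = 0} \<union>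
          {p. -1 \<le> p $ 1 \<and> p $ 1 \<le> -3/4 \<and> p $ 2 = 2 + 3 * p $ 1 \<and> p $ 3 = 0} \<union>
          {p. 3/4 \<le> p $ 1 \<and> p $ 1 \<le> 1 \<and> p $ 2 = 3 * p $ 1 - 2 \<and> p $ 3 = 0} \<union>
          {p. 3/4 \<le> p $ 1 \<and> p $ 1 \<le> 1 \<and> p $ 2 = 2 - 3 * p $ 1 \<and> p $ 3 = 0}"
      by (cases "0 \<le> p $ 1"; cases "0 \<le> p $ 2"; simp; linarith)
  qed
  then show ?thesis
    by (simp add: hsum_def Let_def place_corners closed_segment_commute[of NE] closed_segment_commute[of SE] Un_ac)
qed

definition hsum_outside :: "(real \<times> real) set" where
  "hsum_outside = {q \<in> square. \<bar>snd q\<bar> < 1/4 \<longrightarrow> 1/4 \<le> \<bar>fst q + 1/2\<bar> \<and> 1/4 \<le> \<bar>fst q - 1/2\<bar>}"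

text \<open>The first two tests pick the faces beyond the slanted wires on the left and on the
  right. They include every point of \<open>hsum_outside\<close> beside the small squares, so the
  third test is left with the face between the summands.\<close>

definition hsum_colour :: "'g \<Rightarrow> 'g \<Rightarrow> 'g \<Rightarrow> 'g \<Rightarrow> 'g \<Rightarrow> real \<times> real \<Rightarrow> 'g" where
  "hsum_colour n e s w c q =
     (if 3 * fst q + \<bar>snd q\<bar> < -2 then w else if 2 < 3 * fst q - \<bar>snd q\<bar> then e
      else if \<bar>snd q\<bar> < 1/4 then c else if 0 < snd q then n else s)"

lemma closed_hsum_outside: "closed hsum_outside"
proof -
  have "hsum_outside = {q. \<bar>fst q\<bar> \<le> 1 \<and> \<bar>snd q\<bar> \<le> 1 \<and>
      (1/4 \<le> \<bar>snd q\<bar> \<or> 1/4 \<le> \<bar>fst q + 1/2\<bar> \<and> 1/4 \<le> \<bar>fst q - 1/2\<bar>)}"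
    by (auto simp: hsum_outside_def square_def)
  also have "closed \<dots>"
    by (intro closed_Collect_conj closed_Collect_disj closed_Collect_le continuous_intros)
  finally show ?thesis .
qed

lemma hsum_outside_colouring:
  "colouring hsum_outside hsum_wires (hsum_colour n e s w c) m {}"
proof (rule colouring_planar)
  show "proj ` hsum_wires \<subseteq> hsum_outside"
    by (auto simp: hsum_wires_def hsum_outside_def square_def proj_def)
  show "loc_const (hsum_outside - proj ` hsum_wires) (hsum_colour n e s w c)" (is "loc_const ?S ?h")
  proof (rule loc_constI)
    fix q assume q: "q \<in> ?S"
    obtain x y where xy: "q = (x, y)" by (cases q)
    have box: "\<bar>x\<bar> \<le> 1" "\<bar>y\<bar> < 1/4 \<longrightarrow> 1/4 \<le> \<bar>x + 1/2\<bar> \<and> 1/4 \<le> \<bar>x - 1/2\<bar>"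
      using q by (auto simp: xy hsum_outside_def square_def)
    have "vector [x, y, 0] \<notin> hsum_wires"
    proof
      assume "vector [x, y, 0] \<in> hsum_wires"
      then have "proj (vector [x, y, 0]) \<in> proj ` hsum_wires" by (rule imageI)
      then show False using q by (simp add: xy proj_def vector_3)
    qed
    then have wire: "\<not> (\<bar>y\<bar> = 1/4 \<and> \<bar>x\<bar> \<le> 1/4)" "\<not> (\<bar>y\<bar> = 3 * \<bar>x\<bar> - 2 \<and> 3/4 \<le> \<bar>x\<bar>)"
      using box by (auto simp: hsum_wires_def vector_3)
    have box': "\<bar>snd q'\<bar> < 1/4 \<longrightarrow> 1/4 \<le> \<bar>fst q' + 1/2\<bar> \<and> 1/4 \<le> \<bar>fst q' - 1/2\<bar>" if "q' \<in> ?S" for q'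
      using that by (auto simp: hsum_outside_def)
    have nbhd: "\<exists>U. open U \<and> q \<in> U \<and> (\<forall>y\<in>U \<inter> ?S. ?h y = ?h q)"
      if "open {q. P q}" "P q" "\<And>q'. P q' \<Longrightarrow> q' \<in> ?S \<Longrightarrow> ?h q' = d" for P d
      using that q by (intro exI[of _ "{q. P q}"]) auto
    note opens = open_Collect_conj open_Collect_disj open_Collect_less continuous_intros
    have lt1: "-2 < 3 * x + \<bar>y\<bar>" if "\<not> 3 * x + \<bar>y\<bar> < -2"
      using that box wire(2) by linarith
    have lt2: "3 * x - \<bar>y\<bar> < 2" if "\<not> 2 < 3 * x - \<bar>y\<bar>"
      using that box wire(2) by linarith
    consider "3 * x + \<bar>y\<bar> < -2" | "2 < 3 * x - \<bar>y\<bar>"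
      | "-2 < 3 * x + \<bar>y\<bar>" "3 * x - \<bar>y\<bar> < 2" "\<bar>y\<bar> < 1/4"
      | "-2 < 3 * x + \<bar>y\<bar>" "3 * x - \<bar>y\<bar> < 2" "1/4 \<le> y"
      | "-2 < 3 * x + \<bar>y\<bar>" "3 * x - \<bar>y\<bar> < 2" "y \<le> -1/4"
      using lt1 lt2 by linarith
    then show "\<exists>U. open U \<and> q \<in> U \<and> (\<forall>y\<in>U \<inter> ?S. ?h y = ?h q)"
    proof cases
      case 1
      show ?thesis
      proof (rule nbhd)
        show "open {q :: real \<times> real. 3 * fst q + \<bar>snd q\<bar> < -2}" by (intro opens)
      qed (use 1 in \<open>simp_all add: xy hsum_colour_def\<close>)
    next
      case 2
      show ?thesis
      proof (rule nbhd)
        show "open {q :: real \<times> real. 2 < 3 * fst q - \<bar>snd q\<bar>}" by (intro opens)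
        fix q' :: "real \<times> real" assume "2 < 3 * fst q' - \<bar>snd q'\<bar>"
        then have "\<not> 3 * fst q' + \<bar>snd q'\<bar> < -2" "2 < 3 * fst q' - \<bar>snd q'\<bar>" by linarith+
        then show "?h q' = e" by (simp add: hsum_colour_def)
      qed (use 2 in \<open>simp add: xy\<close>)
    next
      case 3
      show ?thesis
      proof (rule nbhd)
        show "open {q :: real \<times> real. -2 < 3 * fst q + \<bar>snd q\<bar> \<and> 3 * fst q - \<bar>snd q\<bar> < 2 \<and> \<bar>snd q\<bar> < 1/4}"
          by (intro opens)
      qed (use 3 in \<open>simp_all add: xy hsum_colour_def\<close>)
    next
      \<comment> \<open>At a point on the side \<open>y = 1/4\<close> of a small square a
        neighbourhood has to reach below that side. With \<open>1/4 < \<bar>x\<bar>\<close> and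
        \<open>\<bar>x\<bar> < 3/4\<close> the part below falls into the open small squares, which
        \<open>hsum_outside\<close> omits.\<close>
      case 4
      show ?thesis
      proof (rule nbhd)
        show "open {q :: real \<times> real. -2 < 3 * fst q + \<bar>snd q\<bar> \<and> 3 * fst q - \<bar>snd q\<bar> < 2 \<and> 0 < snd q \<and>
            (1/4 < snd q \<or> 1/4 < \<bar>fst q\<bar> \<and> \<bar>fst q\<bar> < 3/4)}" by (intro opens)
        show "-2 < 3 * fst q + \<bar>snd q\<bar> \<and> 3 * fst q - \<bar>snd q\<bar> < 2 \<and> 0 < snd q \<and>
            (1/4 < snd q \<or> 1/4 < \<bar>fst q\<bar> \<and> \<bar>fst q\<bar> < 3/4)"
          using 4 wire(1) unfolding xy fst_conv snd_conv by linarith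
        fix q' :: "real \<times> real"
        assume *: "-2 < 3 * fst q' + \<bar>snd q'\<bar> \<and> 3 * fst q' - \<bar>snd q'\<bar> < 2 \<and> 0 < snd q' \<and>
            (1/4 < snd q' \<or> 1/4 < \<bar>fst q'\<bar> \<and> \<bar>fst q'\<bar> < 3/4)" and "q' \<in> ?S"
        then have "\<not> \<bar>snd q'\<bar> < 1/4" using box'[OF \<open>q' \<in> ?S\<close>] by linarith
        then show "?h q' = n" using * by (simp add: hsum_colour_def)
      qed
    next
      case 5
      show ?thesis
      proof (rule nbhd)
        show "open {q :: real \<times> real. -2 < 3 * fst q + \<bar>snd q\<bar> \<and> 3 * fst q - \<bar>snd q\<bar> < 2 \<and> snd q < 0 \<and>
            (snd q < -1/4 \<or> 1/4 < \<bar>fst q\<bar> \<and> \<bar>fst q\<bar> < 3/4)}" by (intro opens)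
        show "-2 < 3 * fst q + \<bar>snd q\<bar> \<and> 3 * fst q - \<bar>snd q\<bar> < 2 \<and> snd q < 0 \<and>
            (snd q < -1/4 \<or> 1/4 < \<bar>fst q\<bar> \<and> \<bar>fst q\<bar> < 3/4)"
          using 5 wire(1) unfolding xy fst_conv snd_conv by linarith
        fix q' :: "real \<times> real"
        assume *: "-2 < 3 * fst q' + \<bar>snd q'\<bar> \<and> 3 * fst q' - \<bar>snd q'\<bar> < 2 \<and> snd q' < 0 \<and>
            (snd q' < -1/4 \<or> 1/4 < \<bar>fst q'\<bar> \<and> \<bar>fst q'\<bar> < 3/4)" and "q' \<in> ?S"
        then have "\<not> \<bar>snd q'\<bar> < 1/4" using box'[OF \<open>q' \<in> ?S\<close>] by linarith
        then show "?h q' = s" using * by (simp add: hsum_colour_def)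
      qed
    qed
  qed
qed (simp add: hsum_wires_def)

text \<open>Treats both summands at once: for \<open>a = -1/2\<close> the inner side is the right
  one and for \<open>a = 1/2\<close> the left one, and in both cases it has colour \<open>c\<close>.
  The piece meets \<open>hsum_outside\<close> in the boundary of the small square only, so the
  comparison of colours reduces to its four sides.\<close>

lemma hsum_piece:
  fixes h :: "real \<times> real \<Rightarrow> 'g::group_add"
  assumes T: "tangle_colouring T h n e' s w'"
    and a: "a = -1/2 \<and> w' = w \<and> e' = c \<or> a = 1/2 \<and> w' = c \<and> e' = e"
  defines "S \<equiv> {q. \<bar>fst q - a\<bar> \<le> 1/4 \<and> \<bar>snd q\<bar> \<le> 1/4}" and "k \<equiv> \<lambda>q. (4 * (fst q - a), 4 * snd q)"
  shows "p \<in> hsum_wires \<Longrightarrow> proj p \<in> S \<Longrightarrow> p \<in> place (vector [a, 0, 0]) ` T"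
    and "p \<in> place (vector [a, 0, 0]) ` T \<Longrightarrow> proj p \<in> hsum_outside \<Longrightarrow> p \<in> hsum_wires"
    and "q \<in> hsum_outside \<Longrightarrow> q \<in> S \<Longrightarrow> q \<notin> proj ` hsum_wires \<Longrightarrow> hsum_colour n e s w c q = h (k q)"
    and "\<exists>m M. colouring S (place (vector [a, 0, 0]) ` T) (h \<circ> k) m M \<and> (\<forall>p\<in>M. proj p \<in> S - hsum_outside)"
    and "closed S"
proof -
  define g where "g p = 4 *\<^sub>R (p - vector [a, 0, 0])" for p :: "real ^ 3"
  obtain m M where col: "colouring square T h m M" "\<forall>p\<in>M. \<bar>p $ 1\<bar> < 1 \<and> \<bar>p $ 2\<bar> < 1"
    and h: "\<And>x. \<bar>x\<bar> < 1 \<Longrightarrow> h (x, 1) = n \<and> h (x, -1) = s \<and> h (1, x) = e' \<and> h (-1, x) = w'"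
    and T: "\<forall>p\<in>T. \<bar>p $ 1\<bar> = 1 \<or> \<bar>p $ 2\<bar> = 1 \<longrightarrow> p \<in> {NW, NE, SW, SE}" "{NW, NE, SW, SE} \<subseteq> T" "compact T"
    using T unfolding tangle_colouring_def by auto
  have g_nth [simp]: "g p $ 1 = 4 * (p $ 1 - a)" "g p $ 2 = 4 * p $ 2" "g p $ 3 = 4 * p $ 3" for p
    by (simp_all add: g_def vector_3)
  have inv: "g (place (vector [a, 0, 0]) p) = p" "place (vector [a, 0, 0]) (g p) = p" for p
    by (simp_all add: g_def place_def)
  have im: "place (vector [a, 0, 0]) ` T = g -` T"
    using inv by (auto simp: image_iff) metis
  have abs4: "\<bar>4 * t\<bar> \<le> 1 \<longleftrightarrow> \<bar>t\<bar> \<le> 1/4" "\<bar>4 * t\<bar> < 1 \<longleftrightarrow> \<bar>t\<bar> < 1/4" for t :: real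
    by (auto simp: abs_mult)
  have S: "S = k -` square"
    by (simp only: S_def k_def square_def vimage_def mem_Collect_eq fst_conv snd_conv abs4)
  have sq: "\<bar>p $ 1\<bar> \<le> 1" "\<bar>p $ 2\<bar> \<le> 1" if "p \<in> T" for p
    using col(1) that by (auto simp: colouring_def square_def proj_def)
  have corner: "p \<in> {NW, NE, SW, SE} \<longleftrightarrow> \<bar>p $ 1\<bar> = 1 \<and> \<bar>p $ 2\<bar> = 1 \<and> p $ 3 = 0" for p
    by (auto simp: NW_def NE_def SW_def SE_def vec_eq_iff forall_3 vector_3)
  have sides: "\<bar>fst (k q)\<bar> = 1 \<or> \<bar>snd (k q)\<bar> = 1" if "q \<in> hsum_outside" "q \<in> S" for q
    using that a by (auto simp: hsum_outside_def S_def k_def abs_if split: if_splits)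
  show "p \<in> place (vector [a, 0, 0]) ` T" if "p \<in> hsum_wires" "proj p \<in> S"
  proof -
    have "g p \<in> {NW, NE, SW, SE}"
      unfolding corner using that a by (auto simp: hsum_wires_def S_def proj_def abs_if split: if_splits)
    then show ?thesis using T(2) im by blast
  qed
  show "p \<in> hsum_wires" if "p \<in> place (vector [a, 0, 0]) ` T" "proj p \<in> hsum_outside"
  proof -
    have p: "g p \<in> T" using that(1) im by blast
    then have "proj p \<in> S"
      using sq[OF p] unfolding g_nth abs4 by (simp add: S_def proj_def)
    then have "\<bar>g p $ 1\<bar> = 1 \<or> \<bar>g p $ 2\<bar> = 1"
      using sides[OF that(2)] by (simp add: k_def proj_def)
    then have "\<bar>g p $ 1\<bar> = 1 \<and> \<bar>g p $ 2\<bar> = 1 \<and> g p $ 3 = 0" using T(1) p corner by blast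
    then show ?thesis
      using a by (auto simp: hsum_wires_def abs_if split: if_splits)
  qed
  show "hsum_colour n e s w c q = h (k q)" if q: "q \<in> hsum_outside" "q \<in> S" "q \<notin> proj ` hsum_wires"
  proof -
    obtain x y where xy: "q = (x, y)" by (cases q)
    have "vector [x, y, 0] \<notin> hsum_wires"
    proof
      assume "vector [x, y, 0] \<in> hsum_wires"
      then have "proj (vector [x, y, 0]) \<in> proj ` hsum_wires" by (rule imageI)
      then show False using q(3) by (simp add: xy proj_def vector_3)
    qed
    then have "\<not> (\<bar>fst (k q)\<bar> = 1 \<and> \<bar>snd (k q)\<bar> = 1)"
      using a by (auto simp: hsum_wires_def vector_3 k_def xy abs_if split: if_splits)
    moreover have "\<bar>fst (k q)\<bar> \<le> 1" "\<bar>snd (k q)\<bar> \<le> 1" using q(2) by (auto simp: S square_def)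
    ultimately consider "k q = (fst (k q), 1)" "\<bar>fst (k q)\<bar> < 1" | "k q = (fst (k q), -1)" "\<bar>fst (k q)\<bar> < 1"
      | "k q = (1, snd (k q))" "\<bar>snd (k q)\<bar> < 1" | "k q = (-1, snd (k q))" "\<bar>snd (k q)\<bar> < 1"
      using sides[OF q(1,2)] by (cases "k q") (auto simp: abs_if split: if_splits)
    then show ?thesis
    proof cases
      case 1
      then have "4 * y = 1" "\<bar>4 * (x - a)\<bar> < 1"
        unfolding k_def xy fst_conv snd_conv prod.inject by blast+
      then have "y = 1/4" "\<bar>x - a\<bar> < 1/4" unfolding abs4 by linarith+
      then show ?thesis using h[OF 1(2)] 1(1) a by (auto simp: hsum_colour_def xy abs_if split: if_splits)
    next
      case 2
      then have "4 * y = -1" "\<bar>4 * (x - a)\<bar> < 1"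
        unfolding k_def xy fst_conv snd_conv prod.inject by blast+
      then have "y = -1/4" "\<bar>x - a\<bar> < 1/4" unfolding abs4 by linarith+
      then show ?thesis using h[OF 2(2)] 2(1) a by (auto simp: hsum_colour_def xy abs_if split: if_splits)
    next
      case 3
      then have *: "4 * (x - a) = 1" "\<bar>4 * y\<bar> < 1"
        unfolding k_def xy fst_conv snd_conv prod.inject by blast+
      have "x = a + 1/4" using *(1) by (simp add: field_simps)
      moreover have "\<bar>y\<bar> < 1/4" using *(2) unfolding abs4 .
      ultimately show ?thesis using h[OF 3(2)] 3(1) a by (auto simp: hsum_colour_def xy)
    next
      case 4
      then have *: "4 * (x - a) = -1" "\<bar>4 * y\<bar> < 1"
        unfolding k_def xy fst_conv snd_conv prod.inject by blast+
      have "x = a - 1/4" using *(1) by (simp add: field_simps)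
      moreover have "\<bar>y\<bar> < 1/4" using *(2) unfolding abs4 .
      ultimately show ?thesis using h[OF 4(2)] 4(1) a by (auto simp: hsum_colour_def xy)
    qed
  qed
  have gc: "continuous_on UNIV g" unfolding g_def by (intro continuous_intros)
  have kc: "continuous_on UNIV k" unfolding k_def by (intro continuous_intros)
  have "surj g" by (rule surjI) (rule inv(1))
  have "colouring (k -` square) (g -` T) (h \<circ> k) (m \<circ> k) (g -` M)"
    by (rule colouring_vimage[OF col(1) gc \<open>surj g\<close> _ kc]) (auto simp: inj_def k_def proj_def)
  moreover have "proj p \<in> S - hsum_outside" if "p \<in> g -` M" for p
  proof -
    have "\<bar>g p $ 1\<bar> < 1" "\<bar>g p $ 2\<bar> < 1" using col(2) that by blast+
    then have "\<bar>p $ 1 - a\<bar> < 1/4" "\<bar>p $ 2\<bar> < 1/4" unfolding g_nth abs4 .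
    moreover have "\<bar>p $ 1 + 1/2\<bar> < 1/4 \<or> \<bar>p $ 1 - 1/2\<bar> < 1/4"
    proof -
      have "a = -1/2 \<or> a = 1/2" using a by blast
      then show ?thesis using calculation(1) by (elim disjE; hypsubst) simp_all
    qed
    ultimately show ?thesis by (auto simp: S_def hsum_outside_def proj_def)
  qed
  ultimately show "\<exists>m M. colouring S (place (vector [a, 0, 0]) ` T) (h \<circ> k) m M \<and> (\<forall>p\<in>M. proj p \<in> S - hsum_outside)"
    unfolding im S by blast
  show "closed S" unfolding S_def by (intro closed_Collect_conj closed_Collect_le continuous_intros)
qed

lemma tangle_colouring_hsum:
  fixes n e s w c :: "'g::group_add"
  assumes T: "tangle_colouring T h n c s w" and T': "tangle_colouring T' h' n e s c"
  obtains h'' where "tangle_colouring (hsum T T') h'' n e s w" "h'' (0, 0) = c" "(0, 0) \<notin> proj ` hsum T T'"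
proof -
  define S S' where "S = {q :: real \<times> real. \<bar>fst q - (-1/2)\<bar> \<le> 1/4 \<and> \<bar>snd q\<bar> \<le> 1/4}"
    and "S' = {q :: real \<times> real. \<bar>fst q - 1/2\<bar> \<le> 1/4 \<and> \<bar>snd q\<bar> \<le> 1/4}"
  define k k' where "k = (\<lambda>q :: real \<times> real. (4 * (fst q - (-1/2)), 4 * snd q))"
    and "k' = (\<lambda>q :: real \<times> real. (4 * (fst q - 1/2), 4 * snd q))"
  let ?l = "place (vector [-1/2, 0, 0])" and ?r = "place (vector [1/2, 0, 0])"
  let ?o = "hsum_colour n e s w c"
  have a: "(-1/2::real) = -1/2 \<and> w = w \<and> c = c \<or> (-1/2::real) = 1/2 \<and> w = c \<and> c = e"
    and a': "(1/2::real) = -1/2 \<and> c = w \<and> e = c \<or> (1/2::real) = 1/2 \<and> c = c \<and> e = e" by simp_all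
  note L = hsum_piece[OF T a, folded S_def k_def] and R = hsum_piece[OF T' a', folded S'_def k'_def]
  obtain m M where M: "colouring S (?l ` T) (h \<circ> k) m M" "\<And>p. p \<in> M \<Longrightarrow> proj p \<in> S - hsum_outside"
    using L(4) by blast
  obtain m' M' where M': "colouring S' (?r ` T') (h' \<circ> k') m' M'" "\<And>p. p \<in> M' \<Longrightarrow> proj p \<in> S' - hsum_outside"
    using R(4) by blast
  have disj: "S \<inter> S' = {}" by (auto simp: S_def S'_def abs_if split: if_splits)
  have "q \<in> S \<union> S'" if "q \<in> square" "q \<notin> hsum_outside" for q
  proof -
    have "\<bar>snd q\<bar> < 1/4" "\<bar>fst q + 1/2\<bar> < 1/4 \<or> \<bar>fst q - 1/2\<bar> < 1/4"
      using that by (auto simp: hsum_outside_def)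
    then show ?thesis by (auto simp: S_def S'_def)
  qed
  moreover have "q \<in> square" if "q \<in> S \<union> S'" for q
  proof -
    have "\<bar>snd q\<bar> \<le> 1/4" "\<bar>fst q + 1/2\<bar> \<le> 1/4 \<or> \<bar>fst q - 1/2\<bar> \<le> 1/4"
      using that by (auto simp: S_def S'_def)
    then have "\<bar>fst q\<bar> \<le> 1 \<and> \<bar>snd q\<bar> \<le> 1" by linarith
    then show ?thesis by (simp add: square_def)
  qed
  moreover have "hsum_outside \<subseteq> square" by (auto simp: hsum_outside_def)
  ultimately have un: "hsum_outside \<union> S \<union> S' = square" by blast
  have sub: "\<And>p. p \<in> ?l ` T \<Longrightarrow> proj p \<in> S" "\<And>p. p \<in> ?r ` T' \<Longrightarrow> proj p \<in> S'"
    using M(1) M'(1) by (auto simp: colouring_def)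
  let ?h1 = "\<lambda>q. if q \<in> hsum_outside then ?o q else (h \<circ> k) q"
  \<comment> \<open>The equal branches are the form in which \<open>colouring_Un\<close> returns the
    function; over \<open>hsum_outside\<close> the region between strands is empty.\<close>
  let ?m1 = "\<lambda>q. if q \<in> hsum_outside then m q else m q"
  have 1: "colouring (hsum_outside \<union> S) (hsum_wires \<union> ?l ` T) ?h1 ?m1 ({} \<union> M)"
    by (rule colouring_Un[OF hsum_outside_colouring M(1) closed_hsum_outside L(5)])
      (use L(1-3) M(2) in \<open>auto simp: k_def\<close>)
  let ?h2 = "\<lambda>q. if q \<in> hsum_outside \<union> S then ?h1 q else (h' \<circ> k') q"
  let ?m2 = "\<lambda>q. if q \<in> hsum_outside \<union> S then ?m1 q else m' q"
  have 2: "colouring (hsum_outside \<union> S \<union> S') (hsum_wires \<union> ?l ` T \<union> ?r ` T') ?h2 ?m2 ({} \<union> M \<union> M')"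
  proof (rule colouring_Un[OF 1 M'(1) closed_Un[OF closed_hsum_outside L(5)] R(5)])
    fix p assume "p \<in> hsum_wires \<union> ?l ` T" "proj p \<in> S'"
    then show "p \<in> ?r ` T'" using R(1) sub(1) disj by blast
  next
    fix p assume "p \<in> ?r ` T'" "proj p \<in> hsum_outside \<union> S"
    then show "p \<in> hsum_wires \<union> ?l ` T" using R(2) sub(2) disj by blast
  next
    fix q assume "q \<in> hsum_outside \<union> S" "q \<in> S'" "q \<notin> proj ` (hsum_wires \<union> ?l ` T)"
    then have "q \<in> hsum_outside" "q \<notin> proj ` hsum_wires" using disj by auto
    then show "?h1 q = (h' \<circ> k') q" using R(3) \<open>q \<in> S'\<close> by (simp add: k'_def)
  next
    fix p assume "p \<in> {} \<union> M"
    then show "proj p \<in> hsum_outside \<union> S - S'" using M(2) disj by blast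
  next
    fix p assume "p \<in> M'"
    then show "proj p \<in> S' - (hsum_outside \<union> S)" using M'(2) disj by blast
  qed
  have inner: "\<bar>fst q\<bar> < 1" "\<bar>snd q\<bar> < 1" if "q \<in> S \<or> q \<in> S'" for q
    using that by (auto simp: S_def S'_def abs_if split: if_splits)
  have b1: "\<forall>p\<in>{} \<union> M \<union> M'. \<bar>p $ 1\<bar> < 1 \<and> \<bar>p $ 2\<bar> < 1"
    using M(2) M'(2) inner by (fastforce simp: proj_def)
  have b2: "?h2 (x, 1) = n \<and> ?h2 (x, -1) = s \<and> ?h2 (1, x) = e \<and> ?h2 (-1, x) = w" if "\<bar>x\<bar> < 1" for x
    using that by (auto simp: hsum_outside_def square_def hsum_colour_def abs_if split: if_splits)
  have b3: "p \<in> {NW, NE, SW, SE}" if p: "p \<in> hsum T T'" "\<bar>p $ 1\<bar> = 1 \<or> \<bar>p $ 2\<bar> = 1" for p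
  proof -
    have "\<not> (proj p \<in> S \<or> proj p \<in> S')" using inner[of "proj p"] p(2) by (auto simp: proj_def)
    then have "p \<in> hsum_wires" using p(1) sub unfolding hsum_eq by blast
    then have "\<bar>p $ 1\<bar> = 1 \<and> \<bar>p $ 2\<bar> = 1 \<and> p $ 3 = 0" using p(2) by (auto simp: hsum_wires_def)
    then show ?thesis by (auto simp: NW_def NE_def SW_def SE_def vec_eq_iff forall_3 vector_3 abs_if split: if_splits)
  qed
  have b4: "{NW, NE, SW, SE} \<subseteq> hsum T T'"
    unfolding hsum_def Let_def by auto
  have pc: "compact (place c ` T)" if "compact T" for c T
    by (rule compact_continuous_image[OF _ that]) (simp add: place_def continuous_intros)
  have "compact T" "compact T'" using T T' by (simp_all add: tangle_colouring_def)
  then have b5: "compact (hsum T T')"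
    unfolding hsum_def Let_def by (intro compact_Un pc compact_segment)
  have z: "(0, 0) \<in> hsum_outside" "(0, 0) \<notin> S" "(0, 0) \<notin> S'"
    by (auto simp: hsum_outside_def square_def S_def S'_def)
  have "(0, 0) \<notin> proj ` hsum T T'"
  proof
    assume "(0, 0) \<in> proj ` hsum T T'"
    then obtain p where p: "p \<in> hsum T T'" "proj p = (0, 0)" by auto
    then have "p \<in> hsum_wires" using sub z unfolding hsum_eq by (metis UnE)
    then show False using p by (auto simp: hsum_wires_def proj_def)
  qed
  moreover have "?h2 (0, 0) = c" using z by (simp add: hsum_colour_def)
  moreover have "tangle_colouring (hsum T T') ?h2 n e s w"
    unfolding tangle_colouring_def using 2[unfolded un, folded hsum_eq] b1 b2 b3 b4 b5 by blast
  ultimately show ?thesis using that by blast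
qed

lemma tangle_colouring_vsum:
  fixes n e s w c :: "'g::group_add"
  assumes "tangle_colouring T h n e c w" and "tangle_colouring T' h' c e s w"
  obtains h'' where "tangle_colouring (vsum T T') h'' n e s w"
proof -
  obtain f where f: "tangle_colouring (flip ` T) f w c e n" using tangle_colouring_flip[OF assms(1)] .
  obtain f' where f': "tangle_colouring (flip ` T') f' w s e c" using tangle_colouring_flip[OF assms(2)] .
  obtain f'' where "tangle_colouring (hsum (flip ` T) (flip ` T')) f'' w s e n"
    using tangle_colouring_hsum[OF f f'] by blast
  then show ?thesis using that tangle_colouring_flip unfolding vsum_flip by metis
qed

section \<open>The Kinoshita diagram outside its tangle\<close>

definition outer_wires :: "(real ^ 3) set" where
  "outer_wires = {p. p $ 3 = 0 \<and> (1 \<le> \<bar>p $ 2\<bar> \<and> \<bar>p $ 1\<bar> + \<bar>p $ 2\<bar> = 2 \<or> 0 \<le> p $ 1 \<and> 2 * p $ 1 + 3 * \<bar>p $ 2\<bar> = 6)}"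

lemma kinoshita_graph_eq: "kinoshita_graph = Some ` (outer_wires \<union> tangle_M)"
proof -
  have s1: "closed_segment NW (vector [0, 2, 0]) = {p. -1 \<le> p $ 1 \<and> p $ 1 \<le> 0 \<and> p $ 2 = 2 + p $ 1 \<and> p $ 3 = 0}"
    unfolding NW_def by (subst closed_segment_graph) (auto simp: field_simps)
  have s2: "closed_segment (vector [0, 2, 0]) NE = {p. 0 \<le> p $ 1 \<and> p $ 1 \<le> 1 \<and> p $ 2 = 2 - p $ 1 \<and> p $ 3 = 0}"
    unfolding NE_def by (subst closed_segment_graph) (auto simp: field_simps)
  have s3: "closed_segment SW (vector [0, -2, 0]) = {p. -1 \<le> p $ 1 \<and> p $ 1 \<le> 0 \<and> p $ 2 = -2 - p $ 1 \<and> p $ 3 = 0}"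
    unfolding SW_def by (subst closed_segment_graph) (auto simp: field_simps)
  have s4: "closed_segment (vector [0, -2, 0]) SE = {p. 0 \<le> p $ 1 \<and> p $ 1 \<le> 1 \<and> p $ 2 = p $ 1 - 2 \<and> p $ 3 = 0}"
    unfolding SE_def by (subst closed_segment_graph) (auto simp: field_simps)
  have s5: "closed_segment (vector [0, 2, 0]) (vector [3, 0, 0]) = {p :: real ^ 3. 0 \<le> p $ 1 \<and> p $ 1 \<le> 3 \<and> 3 * p $ 2 = 6 - 2 * p $ 1 \<and> p $ 3 = 0}"
    by (subst closed_segment_graph) (auto simp: field_simps)
  have s6: "closed_segment (vector [0, -2, 0]) (vector [3, 0, 0]) = {p :: real ^ 3. 0 \<le> p $ 1 \<and> p $ 1 \<le> 3 \<and> 3 * p $ 2 = 2 * p $ 1 - 6 \<and> p $ 3 = 0}"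
    by (subst closed_segment_graph) (auto simp: field_simps)
  have "outer_wires = closed_segment NW (vector [0, 2, 0]) \<union> closed_segment (vector [0, 2, 0]) NE \<union>
      closed_segment SW (vector [0, -2, 0]) \<union> closed_segment (vector [0, -2, 0]) SE \<union>
      closed_segment (vector [0, 2, 0]) (vector [3, 0, 0]) \<union> closed_segment (vector [0, -2, 0]) (vector [3, 0, 0])"
    unfolding outer_wires_def s1 s2 s3 s4 s5 s6
  proof (intro set_eqI)
    fix p :: "real ^ 3"
    show "p \<in> {p. p $ 3 = 0 \<and> (1 \<le> \<bar>p $ 2\<bar> \<and> \<bar>p $ 1\<bar> + \<bar>p $ 2\<bar> = 2 \<or> 0 \<le> p $ 1 \<and> 2 * p $ 1 + 3 * \<bar>p $ 2\<bar> = 6)} \<longleftrightarrow>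
      p \<in> {p. -1 \<le> p $ 1 \<and> p $ 1 \<le> 0 \<and> p $ 2 = 2 + p $ 1 \<and> p $ 3 = 0} \<union>
       {p. 0 \<le> p $ 1 \<and> p $ 1 \<le> 1 \<and> p $ 2 = 2 - p $ 1 \<and> p $ 3 = 0} \<union>
       {p. -1 \<le> p $ 1 \<and> p $ 1 \<le> 0 \<and> p $ 2 = -2 - p $ 1 \<and> p $ 3 = 0} \<union>
       {p. 0 \<le> p $ 1 \<and> p $ 1 \<le> 1 \<and> p $ 2 = p $ 1 - 2 \<and> p $ 3 = 0} \<union>
       {p. 0 \<le> p $ 1 \<and> p $ 1 \<le> 3 \<and> 3 * p $ 2 = 6 - 2 * p $ 1 \<and> p $ 3 = 0} \<union>
       {p. 0 \<le> p $ 1 \<and> p $ 1 \<le> 3 \<and> 3 * p $ 2 = 2 * p $ 1 - 6 \<and> p $ 3 = 0}"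
      by (cases "0 \<le> p $ 1"; cases "0 \<le> p $ 2"; simp; linarith)
  qed
  then show ?thesis
    by (simp add: kinoshita_graph_def Let_def closed_segment_commute[of _ NW] closed_segment_commute[of _ SW]
        closed_segment_commute[of "vector [3, 0, 0]"] Un_ac)
qed

text \<open>Three faces meet at each vertex: the triangle next to the tangle, the face between the
  tangle and the third edge, and the unbounded face. The unbounded face is also the one to the left
  of the tangle, so it has colour \<open>w\<close>.\<close>

definition outer_colour :: "'g \<Rightarrow> 'g \<Rightarrow> 'g \<Rightarrow> 'g \<Rightarrow> real \<times> real \<Rightarrow> 'g" where
  "outer_colour n e s w q =
     (if 1 \<le> snd q \<and> \<bar>fst q\<bar> + snd q < 2 then n else if snd q \<le> -1 \<and> \<bar>fst q\<bar> - snd q < 2 then s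
      else if 0 < fst q \<and> 2 * fst q + 3 * \<bar>snd q\<bar> < 6 then e else w)"

lemma outer_colouring:
  "colouring {q. 1 \<le> \<bar>fst q\<bar> \<or> 1 \<le> \<bar>snd q\<bar>} outer_wires (outer_colour n e s w) m {}"
proof (rule colouring_planar)
  let ?O = "{q :: real \<times> real. 1 \<le> \<bar>fst q\<bar> \<or> 1 \<le> \<bar>snd q\<bar>}"
  show "proj ` outer_wires \<subseteq> ?O"
  proof
    fix q assume "q \<in> proj ` outer_wires"
    then obtain p where p: "p \<in> outer_wires" "q = proj p" by blast
    then have "1 \<le> \<bar>p $ 1\<bar> \<or> 1 \<le> \<bar>p $ 2\<bar>"
      unfolding outer_wires_def mem_Collect_eq by linarith
    then show "q \<in> ?O" using p by (simp add: proj_def)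
  qed
  show "loc_const (?O - proj ` outer_wires) (outer_colour n e s w)" (is "loc_const ?S ?h")
  proof (rule loc_constI)
    fix q assume q: "q \<in> ?S"
    obtain x y where xy: "q = (x, y)" by (cases q)
    have box: "1 \<le> \<bar>x\<bar> \<or> 1 \<le> \<bar>y\<bar>" using q by (auto simp: xy)
    have "vector [x, y, 0] \<notin> outer_wires"
    proof
      assume "vector [x, y, 0] \<in> outer_wires"
      then have "proj (vector [x, y, 0]) \<in> proj ` outer_wires" by (rule imageI)
      then show False using q by (simp add: xy proj_def vector_3)
    qed
    then have wire: "\<not> (1 \<le> \<bar>y\<bar> \<and> \<bar>x\<bar> + \<bar>y\<bar> = 2)" "\<not> (0 \<le> x \<and> 2 * x + 3 * \<bar>y\<bar> = 6)"
      by (auto simp: outer_wires_def vector_3)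
    have nbhd: "\<exists>U. open U \<and> q \<in> U \<and> (\<forall>y\<in>U \<inter> ?S. ?h y = ?h q)"
      if "open {q. P q}" "P q" "\<And>q'. P q' \<Longrightarrow> 1 \<le> \<bar>fst q'\<bar> \<or> 1 \<le> \<bar>snd q'\<bar> \<Longrightarrow> ?h q' = d" for P d
      using that q by (intro exI[of _ "{q. P q}"]) auto
    note opens = open_Collect_conj open_Collect_disj open_Collect_less continuous_intros
    consider "1 \<le> y" "\<bar>x\<bar> + y < 2" | "y \<le> -1" "\<bar>x\<bar> - y < 2"
      | "0 < x" "2 * x + 3 * \<bar>y\<bar> < 6" "\<bar>y\<bar> < 1 \<or> 2 < \<bar>x\<bar> + \<bar>y\<bar>"
      | "x < 0 \<or> 6 < 2 * x + 3 * \<bar>y\<bar>" "\<bar>y\<bar> < 1 \<or> 2 < \<bar>x\<bar> + \<bar>y\<bar>"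
      using wire box by linarith
    then show "\<exists>U. open U \<and> q \<in> U \<and> (\<forall>y\<in>U \<inter> ?S. ?h y = ?h q)"
    proof cases
      case 1
      show ?thesis
      proof (rule nbhd)
        show "open {q :: real \<times> real. 0 < snd q \<and> \<bar>fst q\<bar> + snd q < 2 \<and> (1 < snd q \<or> \<bar>fst q\<bar> < 1)}" by (intro opens)
        show "0 < snd q \<and> \<bar>fst q\<bar> + snd q < 2 \<and> (1 < snd q \<or> \<bar>fst q\<bar> < 1)"
          using 1 unfolding xy fst_conv snd_conv by linarith
        fix q' :: "real \<times> real"
        assume "0 < snd q' \<and> \<bar>fst q'\<bar> + snd q' < 2 \<and> (1 < snd q' \<or> \<bar>fst q'\<bar> < 1)" "1 \<le> \<bar>fst q'\<bar> \<or> 1 \<le> \<bar>snd q'\<bar>"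
        then have "1 \<le> snd q' \<and> \<bar>fst q'\<bar> + snd q' < 2" by linarith
        then show "?h q' = n" by (simp add: outer_colour_def)
      qed
    next
      case 2
      show ?thesis
      proof (rule nbhd)
        show "open {q :: real \<times> real. snd q < 0 \<and> \<bar>fst q\<bar> - snd q < 2 \<and> (snd q < -1 \<or> \<bar>fst q\<bar> < 1)}" by (intro opens)
        show "snd q < 0 \<and> \<bar>fst q\<bar> - snd q < 2 \<and> (snd q < -1 \<or> \<bar>fst q\<bar> < 1)"
          using 2 unfolding xy fst_conv snd_conv by linarith
        fix q' :: "real \<times> real"
        assume "snd q' < 0 \<and> \<bar>fst q'\<bar> - snd q' < 2 \<and> (snd q' < -1 \<or> \<bar>fst q'\<bar> < 1)" "1 \<le> \<bar>fst q'\<bar> \<or> 1 \<le> \<bar>snd q'\<bar>"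
        then have "snd q' \<le> -1 \<and> \<bar>fst q'\<bar> - snd q' < 2" by linarith
        then show "?h q' = s" by (simp add: outer_colour_def)
      qed
    next
      case 3
      show ?thesis
      proof (rule nbhd)
        show "open {q :: real \<times> real. 0 < fst q \<and> 2 * fst q + 3 * \<bar>snd q\<bar> < 6 \<and> (\<bar>snd q\<bar> < 1 \<or> 2 < \<bar>fst q\<bar> + \<bar>snd q\<bar>)}"
          by (intro opens)
        fix q' :: "real \<times> real"
        assume *: "0 < fst q' \<and> 2 * fst q' + 3 * \<bar>snd q'\<bar> < 6 \<and> (\<bar>snd q'\<bar> < 1 \<or> 2 < \<bar>fst q'\<bar> + \<bar>snd q'\<bar>)"
        then have "\<not> (1 \<le> snd q' \<and> \<bar>fst q'\<bar> + snd q' < 2)" "\<not> (snd q' \<le> -1 \<and> \<bar>fst q'\<bar> - snd q' < 2)" by linarith+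
        then show "?h q' = e" using * by (auto simp: outer_colour_def)
      qed (use 3 in \<open>simp add: xy\<close>)
    next
      case 4
      show ?thesis
      proof (rule nbhd)
        show "open {q :: real \<times> real. (fst q < 0 \<or> 6 < 2 * fst q + 3 * \<bar>snd q\<bar>) \<and> (\<bar>snd q\<bar> < 1 \<or> 2 < \<bar>fst q\<bar> + \<bar>snd q\<bar>)}"
          by (intro opens)
        fix q' :: "real \<times> real"
        assume *: "(fst q' < 0 \<or> 6 < 2 * fst q' + 3 * \<bar>snd q'\<bar>) \<and> (\<bar>snd q'\<bar> < 1 \<or> 2 < \<bar>fst q'\<bar> + \<bar>snd q'\<bar>)"
        then have "\<not> (1 \<le> snd q' \<and> \<bar>fst q'\<bar> + snd q' < 2)" "\<not> (snd q' \<le> -1 \<and> \<bar>fst q'\<bar> - snd q' < 2)"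
          "\<not> (0 < fst q' \<and> 2 * fst q' + 3 * \<bar>snd q'\<bar> < 6)" by linarith+
        then show "?h q' = w" by (auto simp: outer_colour_def)
      qed (use 4 in \<open>simp add: xy\<close>)
    qed
  qed
qed (simp add: outer_wires_def)

text \<open>
  The colours of the faces inside the two summands of \<^term>\<open>tangle_M\<close> are \<open>p\<^sub>1, p\<^sub>2\<close> and
  \<open>q, r\<^sub>1, r\<^sub>2\<close>, from top to bottom; \<open>c\<close> is the colour of the face between the summands.
\<close>

lemma kinoshita_colouring:
  fixes n e s w c p1 p2 q r1 r2 :: "'g::group_add"
  assumes A: "- n + c = - w + p1" "- p1 + c = - w + p2" "- p2 + c = - w + s"
    and F: "- n + c = - q + r1" "- n + q = - e + r1" "- r1 + c = - e + r2" "- r2 + c = - e + s"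
  obtains K and h :: "real \<times> real \<Rightarrow> 'g" and m M where
    "kinoshita_graph = Some ` K" "compact K" "colouring UNIV K h m M"
    "\<And>q. 4 \<le> \<bar>fst q\<bar> \<or> 4 \<le> \<bar>snd q\<bar> \<Longrightarrow> q \<notin> proj ` K \<and> h q = w"
    "(0, 0) \<notin> proj ` K" "h (0, 0) = c" "(0, 3/2) \<notin> proj ` K" "h (0, 3/2) = n"
    "(2, 0) \<notin> proj ` K" "h (2, 0) = e"
proof -
  obtain a1 where a1: "tangle_colouring pos_crossing a1 n c p1 w" using tangle_colouring_pos_crossing[OF A(1)] .
  obtain a2 where a2: "tangle_colouring pos_crossing a2 p1 c p2 w" using tangle_colouring_pos_crossing[OF A(2)] .
  obtain a3 where a3: "tangle_colouring pos_crossing a3 p2 c s w" using tangle_colouring_pos_crossing[OF A(3)] .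
  obtain a4 where a4: "tangle_colouring (vsum pos_crossing pos_crossing) a4 n c p2 w"
    using tangle_colouring_vsum[OF a1 a2] .
  obtain a where a: "tangle_colouring tangle_A a n c s w"
    using tangle_colouring_vsum[OF a4 a3] unfolding tangle_A_def .
  obtain f1 where f1: "tangle_colouring neg_crossing f1 n q r1 c" using tangle_colouring_neg_crossing[OF F(1)] .
  obtain f2 where f2: "tangle_colouring neg_crossing f2 n e r1 q" using tangle_colouring_neg_crossing[OF F(2)] .
  obtain f3 where f3: "tangle_colouring neg_crossing f3 r1 e r2 c" using tangle_colouring_neg_crossing[OF F(3)] .
  obtain f4 where f4: "tangle_colouring neg_crossing f4 r2 e s c" using tangle_colouring_neg_crossing[OF F(4)] .
  obtain f5 where f5: "tangle_colouring (hsum neg_crossing neg_crossing) f5 n e r1 c"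
    using tangle_colouring_hsum[OF f1 f2] by blast
  obtain f6 where f6: "tangle_colouring (vsum (hsum neg_crossing neg_crossing) neg_crossing) f6 n e r2 c"
    using tangle_colouring_vsum[OF f5 f3] .
  obtain f where f: "tangle_colouring tangle_F f n e s c"
    using tangle_colouring_vsum[OF f6 f4] unfolding tangle_F_def .
  obtain h where "tangle_colouring tangle_M h n e s w" and h0: "h (0, 0) = c" "(0, 0) \<notin> proj ` tangle_M"
    using tangle_colouring_hsum[OF a f] unfolding tangle_M_def by blast
  then obtain m M where col: "colouring square tangle_M h m M" "\<forall>p\<in>M. \<bar>p $ 1\<bar> < 1 \<and> \<bar>p $ 2\<bar> < 1"
    and h: "\<And>x. \<bar>x\<bar> < 1 \<Longrightarrow> h (x, 1) = n \<and> h (x, -1) = s \<and> h (1, x) = e \<and> h (-1, x) = w"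
    and T: "\<forall>p\<in>tangle_M. \<bar>p $ 1\<bar> = 1 \<or> \<bar>p $ 2\<bar> = 1 \<longrightarrow> p \<in> {NW, NE, SW, SE}"
      "{NW, NE, SW, SE} \<subseteq> tangle_M" "compact tangle_M"
    unfolding tangle_colouring_def by auto
  have corner: "p \<in> {NW, NE, SW, SE} \<longleftrightarrow> \<bar>p $ 1\<bar> = 1 \<and> \<bar>p $ 2\<bar> = 1 \<and> p $ 3 = 0" for p
    by (auto simp: NW_def NE_def SW_def SE_def vec_eq_iff forall_3 vector_3 abs_if split: if_splits)
  let ?O = "{q :: real \<times> real. 1 \<le> \<bar>fst q\<bar> \<or> 1 \<le> \<bar>snd q\<bar>}"
  let ?K = "outer_wires \<union> tangle_M" and ?o = "outer_colour n e s w"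
  let ?h = "\<lambda>q. if q \<in> ?O then ?o q else h q" and ?m = "\<lambda>q. if q \<in> ?O then m q else m q"
  have sq: "proj p \<in> square" if "p \<in> tangle_M" for p
    using col(1) that by (auto simp: colouring_def)
  have "closed ?O" by (intro closed_Collect_disj closed_Collect_le continuous_intros)
  moreover have "closed square"
    unfolding square_def by (intro closed_Collect_conj closed_Collect_le continuous_intros)
  ultimately have "colouring (?O \<union> square) ?K ?h ?m ({} \<union> M)"
  proof (rule colouring_Un[OF outer_colouring col(1)])
    fix p assume "p \<in> outer_wires" "proj p \<in> square"
    then have "\<bar>p $ 1\<bar> = 1 \<and> \<bar>p $ 2\<bar> = 1 \<and> p $ 3 = 0"
      unfolding outer_wires_def square_def proj_def mem_Collect_eq fst_conv snd_conv by linarith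
    then show "p \<in> tangle_M" using T(2) corner by blast
  next
    fix p assume p: "p \<in> tangle_M" "proj p \<in> ?O"
    then have "\<bar>p $ 1\<bar> = 1 \<or> \<bar>p $ 2\<bar> = 1"
      using sq[OF p(1)] unfolding square_def proj_def mem_Collect_eq fst_conv snd_conv by linarith
    then have "\<bar>p $ 1\<bar> = 1 \<and> \<bar>p $ 2\<bar> = 1 \<and> p $ 3 = 0" using T(1) p(1) corner by blast
    then show "p \<in> outer_wires" by (simp add: outer_wires_def)
  next
    fix q assume q: "q \<in> ?O" "q \<in> square" "q \<notin> proj ` outer_wires"
    obtain x y where xy: "q = (x, y)" by (cases q)
    have "vector [x, y, 0] \<notin> outer_wires"
    proof
      assume "vector [x, y, 0] \<in> outer_wires"
      then have "proj (vector [x, y, 0]) \<in> proj ` outer_wires" by (rule imageI)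
      then show False using q(3) by (simp add: xy proj_def vector_3)
    qed
    then have "\<not> (\<bar>x\<bar> = 1 \<and> \<bar>y\<bar> = 1)" by (auto simp: outer_wires_def vector_3)
    then consider "y = 1" "\<bar>x\<bar> < 1" | "y = -1" "\<bar>x\<bar> < 1" | "x = 1" "\<bar>y\<bar> < 1" | "x = -1" "\<bar>y\<bar> < 1"
      using q(1,2) unfolding xy square_def mem_Collect_eq fst_conv snd_conv by linarith
    then show "?o q = h q"
      by cases (use h in \<open>auto simp: xy outer_colour_def\<close>)
  next
    fix p assume "p \<in> M"
    then show "proj p \<in> square - ?O" using col(2) by (force simp: square_def proj_def)
  qed simp
  moreover have "?O \<union> square = UNIV"
  proof -
    have "q \<in> ?O \<or> q \<in> square" for q unfolding square_def mem_Collect_eq by linarith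
    then show ?thesis by blast
  qed
  ultimately have 1: "colouring UNIV ?K ?h ?m M" by simp
  have outside: "q \<notin> proj ` ?K"
    if "q \<notin> square" "\<not> (1 \<le> \<bar>snd q\<bar> \<and> \<bar>fst q\<bar> + \<bar>snd q\<bar> = 2)" "\<not> (0 \<le> fst q \<and> 2 * fst q + 3 * \<bar>snd q\<bar> = 6)" for q
  proof
    assume "q \<in> proj ` ?K"
    then obtain p where p: "p \<in> ?K" "q = proj p" by blast
    then have "p \<in> outer_wires" using that(1) sq by blast
    then show False using that p(2) by (auto simp: outer_wires_def proj_def)
  qed
  show ?thesis
  proof (rule that[OF kinoshita_graph_eq _ 1])
    have "compact outer_wires"
    proof (rule compact_eq_bounded_closed[THEN iffD2], rule conjI)
      have "\<bar>p $ 1\<bar> \<le> 3 \<and> \<bar>p $ 2\<bar> \<le> 2 \<and> \<bar>p $ 3\<bar> \<le> 0" if "p \<in> outer_wires" for p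
        using that unfolding outer_wires_def mem_Collect_eq by linarith
      then show "bounded outer_wires"
        by (intro boundedI[of _ 5] order_trans[OF norm_le_l1_cart]) (auto simp: sum_3, fastforce)
      show "closed outer_wires"
        unfolding outer_wires_def
        by (intro closed_Collect_conj closed_Collect_disj closed_Collect_le closed_Collect_eq continuous_intros)
    qed
    then show "compact ?K" using T(3) by (rule compact_Un)
    fix q :: "real \<times> real" assume q: "4 \<le> \<bar>fst q\<bar> \<or> 4 \<le> \<bar>snd q\<bar>"
    then have "q \<notin> square" "\<not> (1 \<le> \<bar>snd q\<bar> \<and> \<bar>fst q\<bar> + \<bar>snd q\<bar> = 2)"
      "\<not> (0 \<le> fst q \<and> 2 * fst q + 3 * \<bar>snd q\<bar> = 6)" "q \<in> ?O"
      unfolding square_def mem_Collect_eq by linarith+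
    moreover have "\<not> (1 \<le> snd q \<and> \<bar>fst q\<bar> + snd q < 2)" "\<not> (snd q \<le> -1 \<and> \<bar>fst q\<bar> - snd q < 2)"
      "\<not> (0 < fst q \<and> 2 * fst q + 3 * \<bar>snd q\<bar> < 6)"
      using q by linarith+
    ultimately show "q \<notin> proj ` ?K \<and> ?h q = w"
      using outside by (auto simp: outer_colour_def)
  next
    show "(0, 0) \<notin> proj ` ?K"
      using h0(2) by (auto simp: outer_wires_def proj_def)
    show "(0, 3/2) \<notin> proj ` ?K" "(2, 0) \<notin> proj ` ?K"
      by (rule outside; simp add: square_def)+
  qed (use h0(1) in \<open>auto simp: outer_colour_def\<close>)
qed

section \<open>The structure group\<close>

text \<open>\<open>F4_w\<close> is a root of \<open>x^2 + x + 1\<close> and \<open>F4_v\<close> is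
  its square, so both are primitive cube roots of unity. In characteristic two negation is the
  identity.\<close>

datatype f4 = F4_0 | F4_1 | F4_w | F4_v

instantiation f4 :: field
begin

definition zero_f4 :: f4 where "zero_f4 = F4_0"
definition one_f4 :: f4 where "one_f4 = F4_1"

fun plus_f4 :: "f4 \<Rightarrow> f4 \<Rightarrow> f4" where
  "plus_f4 F4_0 y = y"
| "plus_f4 x F4_0 = x"
| "plus_f4 F4_1 F4_w = F4_v"
| "plus_f4 F4_w F4_1 = F4_v"
| "plus_f4 F4_1 F4_v = F4_w"
| "plus_f4 F4_v F4_1 = F4_w"
| "plus_f4 F4_w F4_v = F4_1"
| "plus_f4 F4_v F4_w = F4_1"
| "plus_f4 F4_1 F4_1 = F4_0"
| "plus_f4 F4_w F4_w = F4_0"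
| "plus_f4 F4_v F4_v = F4_0"

fun times_f4 :: "f4 \<Rightarrow> f4 \<Rightarrow> f4" where
  "times_f4 F4_0 y = F4_0"
| "times_f4 x F4_0 = F4_0"
| "times_f4 F4_1 y = y"
| "times_f4 x F4_1 = x"
| "times_f4 F4_w F4_w = F4_v"
| "times_f4 F4_v F4_v = F4_w"
| "times_f4 F4_w F4_v = F4_1"
| "times_f4 F4_v F4_w = F4_1"

fun inverse_f4 :: "f4 \<Rightarrow> f4" where
  "inverse_f4 F4_w = F4_v"
| "inverse_f4 F4_v = F4_w"
| "inverse_f4 x = x"

definition uminus_f4 :: "f4 \<Rightarrow> f4" where "uminus_f4 x = x"
definition minus_f4 :: "f4 \<Rightarrow> f4 \<Rightarrow> f4" where "minus_f4 x y = x + y"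
definition divide_f4 :: "f4 \<Rightarrow> f4 \<Rightarrow> f4" where "divide_f4 x y = x * inverse y"

instance
proof
  fix x y z :: f4
  show "x + y + z = x + (y + z)" by (cases x; cases y; cases z) simp_all
  show "x + y = y + x" by (cases x; cases y) simp_all
  show "0 + x = x" by (simp add: zero_f4_def)
  show "- x + x = 0" by (cases x) (simp_all add: zero_f4_def uminus_f4_def)
  show "x - y = x + - y" by (simp add: minus_f4_def uminus_f4_def)
  show "x * y * z = x * (y * z)" by (cases x; cases y; cases z) simp_all
  show "x * y = y * x" by (cases x; cases y) simp_all
  show "1 * x = x" by (cases x) (simp_all add: one_f4_def)
  show "(x + y) * z = x * z + y * z" by (cases x; cases y; cases z) simp_all
  show "(0::f4) \<noteq> 1" by (simp add: zero_f4_def one_f4_def)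
  show "x \<noteq> 0 \<Longrightarrow> inverse x * x = 1" by (cases x) (simp_all add: zero_f4_def one_f4_def)
  show "x div y = x * inverse y" by (rule divide_f4_def)
  show "inverse (0::f4) = 0" by (simp add: zero_f4_def)
qed

end

section \<open>The affine group and its representation of dimension three\<close>

typedef affine4 = "{g :: f4 \<times> f4 \<times> f4. fst g \<noteq> 0}"
  by (rule exI[of _ "(1, 0, 0)"]) simp

text \<open>
  For \<open>a \<noteq> 0\<close>, \<open>aff a b c\<close> stands for the map \<open>u \<mapsto> a u + (b, c)\<close> of the affine plane over the field
  with four elements; it is unspecified for \<open>a = 0\<close>.
\<close>

definition aff :: "f4 \<Rightarrow> f4 \<Rightarrow> f4 \<Rightarrow> affine4" where
  "aff a b c = Abs_affine4 (a, b, c)"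

lemma affine4_cases [cases type: affine4]:
  obtains a b c where "g = aff a b c" "a \<noteq> 0"
proof (cases g rule: Abs_affine4_cases)
  case (Abs_affine4 y)
  then show ?thesis using that by (cases y) (auto simp: aff_def)
qed

lemma Rep_aff: "a \<noteq> 0 \<Longrightarrow> Rep_affine4 (aff a b c) = (a, b, c)"
  by (simp add: aff_def Abs_affine4_inverse)

lemma aff_eq_iff: "a \<noteq> 0 \<Longrightarrow> a' \<noteq> 0 \<Longrightarrow> aff a b c = aff a' b' c' \<longleftrightarrow> a = a' \<and> b = b' \<and> c = c'"
  by (metis Rep_aff prod.inject)

instantiation affine4 :: group_add
begin

definition zero_affine4 :: affine4 where "zero_affine4 = aff 1 0 0"

definition plus_affine4 :: "affine4 \<Rightarrow> affine4 \<Rightarrow> affine4" where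
  "plus_affine4 g h = (case Rep_affine4 g of (a, b, c) \<Rightarrow> case Rep_affine4 h of (a', b', c') \<Rightarrow>
     aff (a * a') (a * b' + b) (a * c' + c))"

definition uminus_affine4 :: "affine4 \<Rightarrow> affine4" where
  "uminus_affine4 g = (case Rep_affine4 g of (a, b, c) \<Rightarrow> aff (inverse a) (- (b / a)) (- (c / a)))"

definition minus_affine4 :: "affine4 \<Rightarrow> affine4 \<Rightarrow> affine4" where
  "minus_affine4 g h = g + - h"

lemma aff_add: "a \<noteq> 0 \<Longrightarrow> a' \<noteq> 0 \<Longrightarrow>
    aff a b c + aff a' b' c' = aff (a * a') (a * b' + b) (a * c' + c)"
  by (simp add: plus_affine4_def Rep_aff)

lemma aff_uminus: "a \<noteq> 0 \<Longrightarrow> - aff a b c = aff (inverse a) (- (b / a)) (- (c / a))"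
  by (simp add: uminus_affine4_def Rep_aff)

instance
proof
  fix x y z :: affine4
  show "x + y + z = x + (y + z)"
    by (cases x; cases y; cases z) (simp add: aff_add algebra_simps)
  show "0 + x = x"
    by (cases x) (simp add: zero_affine4_def aff_add)
  show "x + 0 = x"
    by (cases x) (simp add: zero_affine4_def aff_add)
  show "- x + x = 0"
    by (cases x) (simp add: zero_affine4_def aff_add aff_uminus field_simps)
  show "x + - y = x - y"
    by (simp add: minus_affine4_def)
qed

end

text \<open>
  The linear functional \<open>(x, y)\<close> maps the affine plane to a line, on which the group acts by
  \<open>u \<mapsto> a u + b x + c y\<close>.
\<close>

definition act :: "affine4 \<Rightarrow> f4 \<times> f4 \<times> f4 \<Rightarrow> f4 \<times> f4 \<times> f4" where
  "act g v = (case Rep_affine4 g of (a, b, c) \<Rightarrow> case v of (x, y, u) \<Rightarrow> (x, y, a * u + b * x + c * y))"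

lemma act_aff: "a \<noteq> 0 \<Longrightarrow> act (aff a b c) (x, y, u) = (x, y, a * u + b * x + c * y)"
  by (simp add: act_def Rep_aff)

lemma act_add: "act (g + h) v = act g (act h v)"
  by (cases g; cases h; cases v) (simp add: aff_add act_aff algebra_simps)

lemma act_0: "act 0 v = v"
  by (cases v) (simp add: zero_affine4_def act_aff)

lemma act_nonzero: "v \<noteq> (0, 0, 0) \<Longrightarrow> act g v \<noteq> (0, 0, 0)"
  by (cases g; cases v) (auto simp: act_aff)

text \<open>The cross product of the coefficient vectors solves both equations. If it vanishes, the
  vectors are proportional, and any nonzero vector orthogonal to a nonzero one of them will
  do.\<close>

lemma two_equations_nontrivial_solution:
  fixes p q r p' q' r' :: "'a::field"
  obtains x y z where "(x, y, z) \<noteq> (0, 0, 0)" "p * x + q * y + r * z = 0" "p' * x + q' * y + r' * z = 0"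
proof (cases "q * r' = r * q' \<and> r * p' = p * r' \<and> p * q' = q * p'")
  case False
  then show ?thesis
    by (intro that[of "q * r' - r * q'" "r * p' - p * r'" "p * q' - q * p'"]) (auto simp: algebra_simps)
next
  case minors: True
  have ortho: "\<exists>x y z. (x, y, z) \<noteq> (0, 0, 0) \<and> a * x + b * y + c * z = 0 \<and> a' * x + b' * y + c' * z = 0"
    if "b * c' = c * b'" "c * a' = a * c'" "a * b' = b * a'" "(a, b, c) \<noteq> (0, 0, 0)" for a b c a' b' c' :: 'a
  proof (cases "a = 0 \<and> b = 0")
    case True
    then show ?thesis using that by (intro exI[of _ 1] exI[of _ 0]) auto
  next
    case False
    then show ?thesis using that by (intro exI[of _ b] exI[of _ "- a"] exI[of _ 0]) (auto simp: algebra_simps)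
  qed
  show ?thesis
  proof (cases "(p, q, r) = (0, 0, 0)")
    case True
    show ?thesis
    proof (cases "(p', q', r') = (0, 0, 0)")
      case True
      then show ?thesis using that[of 1 0 0] \<open>(p, q, r) = (0, 0, 0)\<close> by simp
    next
      case False
      have "q' * r = r' * q" "r' * p = p' * r" "p' * q = q' * p"
        using \<open>(p, q, r) = (0, 0, 0)\<close> by simp_all
      then show ?thesis
        using ortho[where a = p' and b = q' and c = r' and a' = p and b' = q and c' = r] False that by blast
    qed
  next
    case False
    then show ?thesis using ortho[where a = p and b = q and c = r and a' = p' and b' = q' and c' = r'] minors that by blast
  qed
qed

lemma common_fixed_vector: "\<exists>v. v \<noteq> (0, 0, 0) \<and> act g v = v \<and> act h v = v"
proof -
  obtain a b c where g: "g = aff a b c" "a \<noteq> 0" by (cases g)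
  obtain a' b' c' where h: "h = aff a' b' c'" "a' \<noteq> 0" by (cases h)
  obtain x y z where "(x, y, z) \<noteq> (0, 0, 0)" "b * x + c * y + (a - 1) * z = 0" "b' * x + c' * y + (a' - 1) * z = 0"
    using two_equations_nontrivial_solution[of b c "a - 1" b' c' "a' - 1"] by blast
  then show ?thesis
    using g h by (intro exI[of _ "(x, y, z)"]) (auto simp: act_aff algebra_simps)
qed

text \<open>The unbounded face has colour 0, the bottom face shares \<open>n\<close> with the top
  one, and the face between the first two crossings of \<open>tangle_F\<close> shares
  \<open>r2\<close>. Around either vertex the linear parts are 1, \<open>F4_w\<close>,
  \<open>F4_v\<close>. With linear parts fixed, each of the two translation coordinates separately
  solves the homogeneous linear system of the seven crossings. A conjugation makes the translation
  of \<open>c\<close> zero, and the coordinates are the solutions whose values at \<open>n\<close>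
  and \<open>e\<close> are 1, 0 and 0, 1.\<close>

lemma kinoshita_colours:
  defines "n \<equiv> aff F4_w 1 0" and "e \<equiv> aff F4_v 0 1" and "c \<equiv> aff F4_v 0 0"
  defines "p1 \<equiv> aff F4_w F4_v 0" and "p2 \<equiv> aff F4_w F4_w 0"
    and "r1 \<equiv> aff F4_w 1 F4_w" and "r2 \<equiv> aff F4_1 F4_w F4_w"
  shows "- n + c = - 0 + p1" "- p1 + c = - 0 + p2" "- p2 + c = - 0 + n"
    and "- n + c = - r2 + r1" "- n + r2 = - e + r1" "- r1 + c = - e + r2" "- r2 + c = - e + n"
    and "act n v = v \<Longrightarrow> act c v = v \<Longrightarrow> act e v = v \<Longrightarrow> v = (0, 0, 0)"
proof -
  have nz: "F4_1 \<noteq> 0" "F4_w \<noteq> 0" "F4_v \<noteq> 0" by (simp_all add: zero_f4_def)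
  note s = n_def e_def c_def p1_def p2_def r1_def r2_def zero_affine4_def aff_uminus aff_add nz
    aff_eq_iff divide_f4_def uminus_f4_def one_f4_def
  show "- n + c = - 0 + p1" "- p1 + c = - 0 + p2" "- p2 + c = - 0 + n"
    "- n + c = - r2 + r1" "- n + r2 = - e + r1" "- r1 + c = - e + r2" "- r2 + c = - e + n"
    unfolding s by (simp_all add: s) (simp_all add: zero_f4_def one_f4_def)
  show "act n v = v \<Longrightarrow> act c v = v \<Longrightarrow> act e v = v \<Longrightarrow> v = (0, 0, 0)"
  proof -
    assume fixed: "act n v = v" "act c v = v" "act e v = v"
    obtain x y u where v: "v = (x, y, u)" by (cases v)
    have "u = 0" using fixed(2) by (cases u) (simp_all add: v c_def act_aff nz, simp_all add: zero_f4_def)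
    then show ?thesis using fixed(1,3) by (simp add: v n_def e_def act_aff nz)
  qed
qed

section \<open>The complement of the Kinoshita graph\<close>

text \<open>The set is the sum of the compact set \<open>K\<close> and a closed vertical half-line.
  The sign \<open>s\<close> treats shadow and roof together.\<close>

lemma closed_vertical_hull:
  assumes "compact K"
  shows "closed {p. \<exists>t\<in>K. proj t = proj p \<and> s * p $ 3 \<le> s * t $ 3}"
proof -
  have "{p. \<exists>t\<in>K. proj t = proj p \<and> s * p $ 3 \<le> s * t $ 3} =
      (\<Union>x\<in>K. \<Union>y\<in>{y. proj y = (0, 0) \<and> s * y $ 3 \<le> 0}. {x + y})" (is "?L = ?R")
  proof (intro equalityI subsetI)
    fix p assume "p \<in> ?L"
    then obtain t where t: "t \<in> K" "proj t = proj p" "s * p $ 3 \<le> s * t $ 3" by blast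
    have "p - t \<in> {y. proj y = (0, 0) \<and> s * y $ 3 \<le> 0}"
      using t(2,3) by (simp add: proj_def right_diff_distrib)
    moreover have "p = t + (p - t)" by simp
    ultimately show "p \<in> ?R" using t(1) by blast
  next
    fix p assume "p \<in> ?R"
    then obtain x y where "x \<in> K" "proj y = (0, 0)" "s * y $ 3 \<le> 0" "p = x + y" by blast
    then show "p \<in> ?L" by (auto simp: proj_def distrib_left intro!: bexI[of _ x])
  qed
  moreover have "closed {y :: real ^ 3. proj y = (0, 0) \<and> s * y $ 3 \<le> 0}"
    unfolding proj_def prod.inject
    by (intro closed_Collect_conj closed_Collect_eq closed_Collect_le continuous_intros)
  ultimately show ?thesis
    using compact_closed_sums[OF assms] by simp
qed

lemma closed_shadow: "compact K \<Longrightarrow> closed (shadow K)"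
  using closed_vertical_hull[of K 1] by (simp add: shadow_def)

lemma closed_roof: "compact K \<Longrightarrow> closed (roof K)"
  using closed_vertical_hull[of K "-1"] by (simp add: roof_def)

text \<open>From each point of the set a vertical ray stays inside it and ends in one fixed
  half-space beyond all of \<open>K\<close>.\<close>

lemma connected_vertical_hull_compl:
  assumes "compact K" and s: "s = 1 \<or> s = -1"
  shows "connected {p. \<forall>t\<in>K. proj t = proj p \<longrightarrow> s * t $ 3 < s * p $ 3}" (is "connected ?V")
proof -
  obtain B where B: "\<And>t. t \<in> K \<Longrightarrow> norm t \<le> B"
    using compact_imp_bounded[OF assms(1)] bounded_iff by metis
  have B3: "s * t $ 3 \<le> B" if "t \<in> K" for t
    using B[OF that] component_le_norm_cart[of t 3] s by auto
  define H where "H = {p :: real ^ 3. B < s * p $ 3}"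
  define R where "R p = {q :: real ^ 3. q $ 1 = p $ 1 \<and> q $ 2 = p $ 2 \<and> s * p $ 3 \<le> s * q $ 3}" for p :: "real ^ 3"
  have HV: "H \<subseteq> ?V" using B3 by (fastforce simp: H_def)
  have lin: "linear (\<lambda>q::real^3. s * q $ 3)" "linear (\<lambda>q::real^3. q $ 1)" "linear (\<lambda>q::real^3. q $ 2)"
    by (auto intro!: linearI simp: algebra_simps)
  have "H = (\<lambda>p. s * p $ 3) -` {B<..}" by (auto simp: H_def)
  then have cH: "convex H" using convex_linear_vimage[OF lin(1), of "{B<..}"] by simp
  have "R p = (\<lambda>q. q $ 1) -` {p $ 1} \<inter> (\<lambda>q. q $ 2) -` {p $ 2} \<inter> (\<lambda>q. s * q $ 3) -` {s * p $ 3..}" for p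
    by (auto simp: R_def)
  then have cR: "convex (R p)" for p
    using convex_linear_vimage[OF lin(1), of "{s * p $ 3..}"] convex_linear_vimage[OF lin(2), of "{p $ 1}"]
      convex_linear_vimage[OF lin(3), of "{p $ 2}"] by (simp add: convex_Int)
  have meet: "R p \<inter> H \<noteq> {}" for p
  proof -
    have "vector [p $ 1, p $ 2, s * (max B (s * p $ 3) + 1)] \<in> R p \<inter> H"
      using s by (auto simp: R_def H_def vector_3)
    then show ?thesis by blast
  qed
  have RV: "R p \<subseteq> ?V" if "p \<in> ?V" for p
    using that by (force simp: R_def proj_def)
  have "connected (R p \<union> H)" for p
    using meet cR cH by (intro connected_Un convex_connected) auto
  then have "connected (\<Union>p\<in>?V. R p \<union> H)"
    using meet by (intro connected_Union) auto
  moreover have "(\<Union>p\<in>?V. R p \<union> H) = ?V"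
    using RV HV by (auto simp: R_def)
  ultimately show ?thesis by simp
qed

lemma connected_compl_shadow:
  assumes "compact K"
  shows "connected (- shadow K)"
proof -
  have "- shadow K = {p. \<forall>t\<in>K. proj t = proj p \<longrightarrow> 1 * t $ 3 < 1 * p $ 3}"
    by (simp add: set_eq_iff shadow_def not_le)
  then show ?thesis using connected_vertical_hull_compl[OF assms, of 1] by simp
qed

lemma connected_compl_roof:
  assumes "compact K"
  shows "connected (- roof K)"
proof -
  have "- roof K = {p. \<forall>t\<in>K. proj t = proj p \<longrightarrow> -1 * t $ 3 < -1 * p $ 3}"
    by (simp add: set_eq_iff roof_def not_le)
  then show ?thesis using connected_vertical_hull_compl[OF assms, of "-1"] by simp
qed

section \<open>The local system of a coloured diagram\<close>

abbreviation lift :: "(real ^ 3 \<Rightarrow> 'g::zero) \<Rightarrow> (real ^ 3) option \<Rightarrow> 'g" where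
  "lift \<phi> \<equiv> case_option 0 \<phi>"

lemma topspace_S3 [simp]: "topspace S3 = UNIV"
  unfolding S3_def by (auto simp: UNIV_option_conv)

lemma openin_S3_Some [simp]: "openin S3 (Some ` U) \<longleftrightarrow> open U"
  by (simp add: S3_def)

lemma continuous_map_Some_S3: "continuous_map euclidean S3 Some"
  unfolding S3_def by (rule continuous_map_Some)

lemma openin_S3_infinity: "compact C \<Longrightarrow> openin S3 (insert None (Some ` (- C)))"
  unfolding S3_def openin_Alexandroff_compactification
  by (intro disjI2 exI[of _ C]) (simp add: compact_imp_closed Compl_eq_Diff_UNIV)

definition graph_complement :: "(real ^ 3) set \<Rightarrow> (real ^ 3) option topology" where
  "graph_complement K = subtopology S3 (- Some ` K)"

lemma topspace_graph_complement: "topspace (graph_complement K) = - Some ` K"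
  by (simp add: graph_complement_def)

lemma agree_at_lift:
  assumes "agree_at euclidean p \<phi> \<psi>" "closed K" "p \<notin> K"
  shows "agree_at (graph_complement K) (Some p) (lift \<phi>) (lift \<psi>)"
proof -
  obtain W c where W: "open W" "p \<in> W" "\<forall>y\<in>W. \<psi> y = c + \<phi> y"
    using assms(1) unfolding agree_at_def by auto
  have "openin (graph_complement K) (Some ` (W - K))"
    unfolding graph_complement_def openin_subtopology
    using W(1) by (intro exI[of _ "Some ` W"]) auto
  then show ?thesis
    unfolding agree_at_def using W assms(3) by (intro exI[of _ "Some ` (W - K)"] exI[of _ c]) auto
qed

lemma agree_at_open:
  "open W \<Longrightarrow> p \<in> W \<Longrightarrow> (\<And>y. y \<in> W \<Longrightarrow> \<psi> y = c + \<phi> y) \<Longrightarrow> agree_at euclidean p \<phi> \<psi>"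
  unfolding agree_at_def by auto

lemma agree_at_refl: "p \<in> topspace X \<Longrightarrow> agree_at X p \<phi> \<phi>"
  unfolding agree_at_def by (intro exI[of _ "topspace X"] exI[of _ 0]) auto

text \<open>Outside a large box this chart changes from the upper to the lower one across height 0.
  The change is harmless because there the colour is that of the unbounded face, normalised to 0; so
  the local system extends over infinity.\<close>

definition infinity_chart :: "(real \<times> real \<Rightarrow> 'g::zero) \<Rightarrow> real ^ 3 \<Rightarrow> 'g" where
  "infinity_chart h p = (if p $ 3 < 0 then h (proj p) else 0)"

definition colouring_atlas ::
    "(real ^ 3) set \<Rightarrow> (real \<times> real \<Rightarrow> 'g::group_add) \<Rightarrow> (real \<times> real \<Rightarrow> 'g) \<Rightarrow> (real ^ 3) set \<Rightarrow>
     (real ^ 3) set \<Rightarrow> ((real ^ 3) option set \<times> ((real ^ 3) option \<Rightarrow> 'g)) set" where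
  "colouring_atlas K h m M C =
     {(Some ` (- shadow K), lift (\<lambda>p. 0)), (Some ` (- roof K), lift (\<lambda>p. h (proj p))),
      (Some ` M, lift (\<lambda>p. m (proj p))), (insert None (Some ` (- C)), lift (infinity_chart h))}"

text \<open>The upper and lower charts overlap exactly over the faces, where \<open>h\<close> is
  locally constant, and the remaining clauses of \<open>colouring\<close> compare both with the
  middle chart. The work lies in the chart at infinity.\<close>

lemma colouring_flat_atlas:
  fixes h :: "real \<times> real \<Rightarrow> 'g::group_add"
  assumes K: "compact K" and col: "colouring UNIV K h m M"
    and far: "\<And>q. 4 \<le> \<bar>fst q\<bar> \<or> 4 \<le> \<bar>snd q\<bar> \<Longrightarrow> q \<notin> proj ` K \<and> h q = 0"
  obtains C where "flat_atlas (graph_complement K) (colouring_atlas K h m M C)"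
proof -
  obtain B where B: "\<And>t. t \<in> K \<Longrightarrow> norm t \<le> B"
    using compact_imp_bounded[OF K] bounded_iff by metis
  have B3: "\<bar>t $ 3\<bar> \<le> \<bar>B\<bar>" if "t \<in> K" for t
    using B[OF that] component_le_norm_cart[of t 3] by linarith
  \<comment> \<open>Where a horizontal coordinate exceeds 4 in absolute value, \<open>far\<close>
    leaves only the unbounded face. Above height \<open>\<bar>B\<bar>\<close>, or below its
    negative, all of \<open>K\<close> lies on one side.\<close>
  define C where "C = {p :: real ^ 3. \<bar>p $ 1\<bar> \<le> 4 \<and> \<bar>p $ 2\<bar> \<le> 4 \<and> \<bar>p $ 3\<bar> \<le> \<bar>B\<bar>}"
  have C: "compact C"
  proof (rule compact_eq_bounded_closed[THEN iffD2], rule conjI)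
    show "bounded C"
      by (intro boundedI[of _ "8 + \<bar>B\<bar>"] order_trans[OF norm_le_l1_cart]) (auto simp: sum_3 C_def)
    show "closed C"
      unfolding C_def by (intro closed_Collect_conj closed_Collect_le continuous_intros)
  qed
  have clK: "closed K" using K by (rule compact_imp_closed)
  have oS: "open (- shadow K)" "open (- roof K)"
    using closed_shadow[OF K] closed_roof[OF K] by auto
  note col = col[unfolded colouring_def]
  have oM: "open M" "M \<inter> K = {}" using col by auto
  have opr: "open (- proj ` K)"
    using compact_imp_closed[OF compact_continuous_image[OF continuous_on_proj K]] by auto
  have KS: "K \<subseteq> shadow K" "K \<subseteq> roof K" by (auto simp: shadow_def roof_def)
  let ?h = "\<lambda>p. h (proj p)" and ?m = "\<lambda>p. m (proj p)" and ?i = "infinity_chart h"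
  have h_const: "\<exists>W. open W \<and> p \<in> W \<and> (\<forall>y\<in>W. h (proj y) = h (proj p))" if p: "proj p \<notin> proj ` K" for p
  proof -
    have "loc_const (UNIV - proj ` K) h" using col by blast
    then obtain U where U: "open U" "proj p \<in> U" "\<And>y. y \<in> U \<Longrightarrow> y \<in> UNIV - proj ` K \<Longrightarrow> h y = h (proj p)"
      by (rule loc_constD) (use p in auto)
    have "open (proj -` (U - proj ` K))"
      using open_vimage[OF _ continuous_on_proj] U(1) opr by (simp add: Diff_eq open_Int)
    moreover have "\<forall>y\<in>proj -` (U - proj ` K). h (proj y) = h (proj p)"
      by (intro ballI U(3)) simp_all
    moreover have "p \<in> proj -` (U - proj ` K)" using U(2) p by simp
    ultimately show ?thesis by blast
  qed
  have far': "proj p \<notin> proj ` K" "h (proj p) = 0" if "4 < \<bar>p $ 1\<bar> \<or> 4 < \<bar>p $ 2\<bar>" for p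
    using far[of "proj p"] that by (auto simp: proj_def)
  have opens: "open {p :: real ^ 3. 4 < \<bar>p $ 1\<bar> \<or> 4 < \<bar>p $ 2\<bar>}" "open {p :: real ^ 3. p $ 3 < 0}" "open {p :: real ^ 3. 0 < p $ 3}"
    by (intro open_Collect_disj open_Collect_less continuous_intros)+
  have face: "proj p \<notin> proj ` K" if "p \<notin> shadow K" "p \<notin> roof K" for p
  proof
    assume "proj p \<in> proj ` K"
    then obtain t where "t \<in> K" "proj t = proj p" by force
    then have "p \<in> shadow K \<or> p \<in> roof K"
      using linear[of "p $ 3" "t $ 3"] unfolding shadow_def roof_def by blast
    then show False using that by blast
  qed
  have ag_sd: "agree_at euclidean p (\<lambda>p. 0) ?h" if p: "p \<notin> shadow K" "p \<notin> roof K" for p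
  proof -
    obtain W where W: "open W" "p \<in> W" "\<forall>y\<in>W. h (proj y) = h (proj p)"
      using h_const[OF face[OF p]] by blast
    show ?thesis by (rule agree_at_open[OF W(1,2), of _ "h (proj p)"]) (use W(3) in auto)
  qed
  have ag_sm: "agree_at euclidean p (\<lambda>p. 0) ?m" if p: "p \<notin> shadow K" "p \<in> M" for p
  proof -
    have "loc_const (M - shadow K) ?m" using col by blast
    then obtain U where U: "open U" "p \<in> U" "\<And>y. y \<in> U \<Longrightarrow> y \<in> M - shadow K \<Longrightarrow> ?m y = ?m p"
      by (rule loc_constD) (use p in auto)
    show ?thesis
    proof (rule agree_at_open[of "U \<inter> (M \<inter> - shadow K)" _ _ "?m p"])
      fix y assume "y \<in> U \<inter> (M \<inter> - shadow K)"
      then have "?m y = ?m p" by (intro U(3)) simp_all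
      then show "?m y = ?m p + 0" by simp
    next
      show "open (U \<inter> (M \<inter> - shadow K))" using U(1) oM(1) oS(1) by (intro open_Int)
    qed (use U(2) p in blast)
  qed
  have ag_dm: "agree_at euclidean p ?h ?m" if p: "p \<notin> roof K" "p \<in> M" for p
  proof -
    have "loc_const (M - roof K) (\<lambda>p. ?m p - ?h p)" using col by blast
    then obtain U where U: "open U" "p \<in> U" "\<And>y. y \<in> U \<Longrightarrow> y \<in> M - roof K \<Longrightarrow> ?m y - ?h y = ?m p - ?h p"
      by (rule loc_constD) (use p in auto)
    show ?thesis
    proof (rule agree_at_open[of "U \<inter> (M \<inter> - roof K)" _ _ "?m p - ?h p"])
      fix y assume "y \<in> U \<inter> (M \<inter> - roof K)"
      then have "?m y - ?h y = ?m p - ?h p" by (intro U(3)) simp_all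
      then show "?m y = ?m p - ?h p + ?h y" by (metis diff_add_cancel)
    next
      show "open (U \<inter> (M \<inter> - roof K))" using U(1) oM(1) oS(2) by (intro open_Int)
    qed (use U(2) p in blast)
  qed
  have ag_i: "(p \<notin> shadow K \<longrightarrow> agree_at euclidean p (\<lambda>p. 0) ?i) \<and> (p \<notin> roof K \<longrightarrow> agree_at euclidean p ?h ?i) \<and>
      (p \<notin> shadow K \<or> p \<notin> roof K)" if p: "p \<notin> C" for p
  proof -
    consider "4 < \<bar>p $ 1\<bar> \<or> 4 < \<bar>p $ 2\<bar>" | "\<bar>B\<bar> < p $ 3" | "p $ 3 < - \<bar>B\<bar>"
      using p by (auto simp: C_def abs_le_iff not_le)
    then show ?thesis
    proof cases
      case 1
      have "agree_at euclidean p (\<lambda>p. 0) ?i"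
        by (rule agree_at_open[OF opens(1), of _ _ 0]) (use 1 far' in \<open>auto simp: infinity_chart_def\<close>)
      moreover have "agree_at euclidean p ?h ?i"
        by (rule agree_at_open[OF opens(1), of _ _ 0]) (use 1 far' in \<open>auto simp: infinity_chart_def\<close>)
      moreover have "p \<notin> shadow K"
      proof
        assume "p \<in> shadow K"
        then obtain t where t: "t \<in> K" "proj t = proj p" by (auto simp: shadow_def)
        then have "proj t \<in> proj ` K" by blast
        then show False using far'(1)[OF 1] t(2) by simp
      qed
      ultimately show ?thesis by blast
    next
      case 2
      then have ns: "p \<notin> shadow K" using B3 by (force simp: shadow_def)
      have *: "agree_at euclidean p (\<lambda>p. 0) ?i"
        by (rule agree_at_open[OF opens(3), of _ _ 0]) (use 2 in \<open>auto simp: infinity_chart_def\<close>)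
      then show ?thesis using ns agree_at_trans[OF agree_at_sym[OF ag_sd[OF ns]] *] by blast
    next
      case 3
      then have nr: "p \<notin> roof K" using B3 by (force simp: roof_def)
      have *: "agree_at euclidean p ?h ?i"
        by (rule agree_at_open[OF opens(2), of _ _ 0]) (use 3 in \<open>auto simp: infinity_chart_def\<close>)
      then show ?thesis using nr agree_at_trans[OF ag_sd[OF _ nr] *] by blast
    qed
  qed
  \<comment> \<open>Outside \<open>C\<close> a point is off the shadow or off the roof, so the
    middle chart is compared with the chart at infinity through one of the two large charts.\<close>
  have ag_mi: "agree_at euclidean p ?m ?i" if p: "p \<in> M" "p \<notin> C" for p
    using ag_i[OF p(2)] agree_at_trans[OF agree_at_sym[OF ag_sm[OF _ p(1)]], of ?i]
      agree_at_trans[OF agree_at_sym[OF ag_dm[OF _ p(1)]], of ?i] by blast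
  have KC: "K \<subseteq> C"
    using ag_i KS by blast
  let ?X = "graph_complement K" and ?A = "colouring_atlas K h m M C"
  have "flat_atlas ?X ?A"
    unfolding flat_atlas_def
  proof (intro conjI allI impI ballI)
    fix U \<phi> assume U: "(U, \<phi>) \<in> ?A"
    have "openin S3 U"
      using U openin_S3_infinity[OF C] oS oM(1) by (auto simp: colouring_atlas_def)
    moreover have "U \<subseteq> - Some ` K"
      using U KS KC oM(2) by (auto simp: colouring_atlas_def)
    ultimately show "openin ?X U"
      unfolding graph_complement_def openin_subtopology by blast
  next
    fix x assume x: "x \<in> topspace ?X"
    show "\<exists>U \<phi>. (U, \<phi>) \<in> ?A \<and> x \<in> U"
    proof (cases x)
      case None
      then show ?thesis unfolding colouring_atlas_def by blast
    next
      case (Some p)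
      then have "p \<notin> shadow K \<or> p \<notin> roof K \<or> p \<in> M"
        using x col by (auto simp: topspace_graph_complement)
      then show ?thesis unfolding colouring_atlas_def Some by blast
    qed
  next
    fix U \<phi> V \<psi> x assume *: "(U, \<phi>) \<in> ?A" "(V, \<psi>) \<in> ?A" "x \<in> U" "x \<in> V"
    show "agree_at ?X x \<phi> \<psi>"
    proof (cases x)
      case None
      then have "\<phi> = \<psi>" using * by (auto simp: colouring_atlas_def)
      then show ?thesis using None by (auto intro!: agree_at_refl simp: topspace_graph_complement)
    next
      case (Some p)
      have pK: "p \<notin> K" using *(1,3) KS KC oM(2) by (auto simp: colouring_atlas_def Some)
      have lift: "agree_at ?X x (lift \<alpha>) (lift \<beta>)" "agree_at ?X x (lift \<beta>) (lift \<alpha>)"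
        if "agree_at euclidean p \<alpha> \<beta>" for \<alpha> \<beta> :: "real ^ 3 \<Rightarrow> 'g"
        using agree_at_lift[OF that clK pK] agree_at_lift[OF agree_at_sym[OF that] clK pK] Some by auto
      have refl: "agree_at ?X x \<phi> \<phi>" by (rule agree_at_refl) (use pK Some in \<open>auto simp: topspace_graph_complement\<close>)
      have "p \<notin> shadow K \<and> \<phi> = lift (\<lambda>p. 0) \<or> p \<notin> roof K \<and> \<phi> = lift ?h \<or> p \<in> M \<and> \<phi> = lift ?m \<or> p \<notin> C \<and> \<phi> = lift ?i"
        using *(1,3) by (auto simp: colouring_atlas_def Some)
      moreover have "p \<notin> shadow K \<and> \<psi> = lift (\<lambda>p. 0) \<or> p \<notin> roof K \<and> \<psi> = lift ?h \<or> p \<in> M \<and> \<psi> = lift ?m \<or> p \<notin> C \<and> \<psi> = lift ?i"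
        using *(2,4) by (auto simp: colouring_atlas_def Some)
      ultimately show ?thesis
        using refl lift[OF ag_sd] lift[OF ag_sm] lift[OF ag_dm] lift[OF ag_mi] ag_i lift by metis
    qed
  qed
  then show ?thesis using that by blast
qed

lemma locally_eq_imp_constant:
  assumes "connected S" and "\<And>x. x \<in> S \<Longrightarrow> \<exists>W v. open W \<and> x \<in> W \<and> (\<forall>y\<in>W. f y = v)"
  shows "\<exists>v. \<forall>x\<in>S. f x = v"
proof -
  have "f constant_on S"
  proof (rule locally_constant_imp_constant[OF assms(1)])
    fix x assume "x \<in> S"
    then obtain W v where "open W" "x \<in> W" "\<forall>y\<in>W. f y = v" using assms(2) by blast
    then show "\<exists>T. openin (top_of_set S) T \<and> x \<in> T \<and> (\<forall>y\<in>T. f y = f x)"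
      using \<open>x \<in> S\<close> by (intro exI[of _ "S \<inter> W"]) auto
  qed
  then show ?thesis unfolding constant_on_def .
qed

text \<open>
  A flat section is constant above the graph and, after applying \<open>h\<close>, constant below it, so its
  value is fixed by all colours.  One point \<open>a\<close> is left out because the homeomorphism to the
  complement of the trivial graph may send it to infinity.
\<close>

lemma flat_section_fixed:
  fixes h :: "real \<times> real \<Rightarrow> 'g::group_add" and act :: "'g \<Rightarrow> 'f \<Rightarrow> 'f"
  assumes K: "compact K" and far: "\<And>q. 4 \<le> \<bar>fst q\<bar> \<or> 4 \<le> \<bar>snd q\<bar> \<Longrightarrow> q \<notin> proj ` K \<and> h q = 0"
    and act_0: "\<And>v. act 0 v = v"
    and flat: "\<And>p U \<phi>. p \<notin> K \<Longrightarrow> p \<noteq> a \<Longrightarrow> (U, \<phi>) \<in> colouring_atlas K h m M C \<Longrightarrow> Some p \<in> U \<Longrightarrow>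
           \<exists>W v. open W \<and> p \<in> W \<and> (\<forall>y\<in>W. act (\<phi> (Some y)) (\<tau> y) = v)"
  shows "\<exists>p. \<forall>q. q \<notin> proj ` K \<longrightarrow> act (h q) (\<tau> p) = \<tau> p"
proof -
  have dim: "2 \<le> DIM(real ^ 3)" by simp
  have KS: "K \<subseteq> shadow K" "K \<subseteq> roof K" by (auto simp: shadow_def roof_def)
  \<comment> \<open>In dimension at least two, removing a point from a connected open set leaves it
    connected.\<close>
  have "connected (- shadow K - {a})"
    using closed_shadow[OF K] connected_compl_shadow[OF K] by (intro connected_open_delete dim) auto
  moreover have "\<exists>W v. open W \<and> x \<in> W \<and> (\<forall>y\<in>W. \<tau> y = v)" if x: "x \<in> - shadow K - {a}" for x
  proof -
    have "\<exists>W v. open W \<and> x \<in> W \<and> (\<forall>y\<in>W. act (lift (\<lambda>p. 0) (Some y)) (\<tau> y) = v)"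
      by (rule flat[of _ "Some ` (- shadow K)"]) (use x KS in \<open>auto simp: colouring_atlas_def\<close>)
    then show ?thesis by (simp add: act_0)
  qed
  ultimately have "\<exists>v. \<forall>x\<in>- shadow K - {a}. \<tau> x = v"
    by (rule locally_eq_imp_constant)
  then obtain v where v: "\<And>x. x \<in> - shadow K - {a} \<Longrightarrow> \<tau> x = v" by blast
  have "connected (- roof K - {a})"
    using closed_roof[OF K] connected_compl_roof[OF K] by (intro connected_open_delete dim) auto
  moreover have "\<exists>W v. open W \<and> x \<in> W \<and> (\<forall>y\<in>W. act (h (proj y)) (\<tau> y) = v)" if x: "x \<in> - roof K - {a}" for x
  proof -
    have "\<exists>W v. open W \<and> x \<in> W \<and> (\<forall>y\<in>W. act (lift (\<lambda>p. h (proj p)) (Some y)) (\<tau> y) = v)"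
      by (rule flat[of _ "Some ` (- roof K)"]) (use x KS in \<open>auto simp: colouring_atlas_def\<close>)
    then show ?thesis by simp
  qed
  ultimately have "\<exists>v. \<forall>x\<in>- roof K - {a}. act (h (proj x)) (\<tau> x) = v"
    by (rule locally_eq_imp_constant)
  then obtain v' where v': "\<And>x. x \<in> - roof K - {a} \<Longrightarrow> act (h (proj x)) (\<tau> x) = v'" by blast
  \<comment> \<open>Over a face the upper and lower charts contain points of every height, so one
    point tests both constants; the height \<open>a $ 3 + 1\<close> keeps it away from
    \<open>a\<close>.\<close>
  define over where "over q = (vector [fst q, snd q, a $ 3 + 1] :: real ^ 3)" for q
  have over: "proj (over q) = q" "over q \<noteq> a" for q
    by (simp_all add: over_def proj_def vec_eq_iff forall_3 vector_3)
  have both: "\<tau> (over q) = v" "act (h q) v = v'" if "q \<notin> proj ` K" for q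
  proof -
    have "over q \<notin> shadow K" "over q \<notin> roof K"
      using that over(1)[of q] by (force simp: shadow_def roof_def)+
    then show "\<tau> (over q) = v" "act (h q) v = v'"
      using v[of "over q"] v'[of "over q"] over by auto
  qed
  \<comment> \<open>Over the unbounded face the colour is 0, which identifies the constant below
    with the constant above. Hence every colour fixes \<open>v\<close>.\<close>
  have "(5, 0) \<notin> proj ` K" "h (5, 0) = 0" using far[of "(5, 0)"] by simp_all
  then have "v' = v" "\<tau> (over (5, 0)) = v" using both[of "(5, 0)"] act_0 by simp_all
  then show ?thesis using both(2) by (intro exI[of _ "over (5, 0)"]) simp
qed

theorem theorem1:
  shows "nontrivial kinoshita_graph"
  unfolding nontrivial_def
proof
  assume "ambient_isotopic kinoshita_graph trivial_theta_graph"
  then obtain \<Phi> where \<Phi>: "ambient_isotopy \<Phi>" and HK: "\<Phi> 1 ` kinoshita_graph = trivial_theta_graph"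
    unfolding ambient_isotopic_def by blast
  define H where "H = \<Phi> 1"
  have H: "homeomorphic_map S3 S3 H"
    using \<Phi> by (simp add: ambient_isotopy_def H_def)
  obtain G where G: "homeomorphic_maps S3 S3 H G"
    using H homeomorphic_map_maps by blast
  have GH: "G (H x) = x" "H (G x) = x" for x
    using G by (simp_all add: homeomorphic_maps_def)
  obtain K h m M where K: "kinoshita_graph = Some ` K" "compact K" and col: "colouring UNIV K h m M"
    and far: "\<And>q. 4 \<le> \<bar>fst q\<bar> \<or> 4 \<le> \<bar>snd q\<bar> \<Longrightarrow> q \<notin> proj ` K \<and> h q = 0"
    and faces: "(0, 0) \<notin> proj ` K" "h (0, 0) = aff F4_v 0 0" "(0, 3/2) \<notin> proj ` K" "h (0, 3/2) = aff F4_w 1 0"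
      "(2, 0) \<notin> proj ` K" "h (2, 0) = aff F4_v 0 1"
    using kinoshita_colouring[OF kinoshita_colours(1-7)] by blast
  obtain C where atlas: "flat_atlas (graph_complement K) (colouring_atlas K h m M C)"
    using colouring_flat_atlas[OF K(2) col far] by blast
  have HK': "H ` Some ` K = Some ` theta" using HK unfolding K(1) trivial_theta_graph_eq H_def .
  \<comment> \<open>The inverse homeomorphism on finite points. Its values may include infinity, so
    its target is the complement of the Kinoshita graph in the sphere.\<close>
  define f where "f y = G (Some y)" for y
  have "f y \<notin> Some ` K" if "y \<notin> theta" for y
  proof
    assume "f y \<in> Some ` K"
    then have "H (f y) \<in> Some ` theta" using HK' by blast
    then show False using that GH by (auto simp: f_def)
  qed
  moreover have "continuous_map euclidean S3 f"
    using continuous_map_compose[OF continuous_map_Some_S3, of S3 G] G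
    by (simp add: homeomorphic_maps_def f_def[abs_def] comp_def)
  ultimately have f: "continuous_map (top_of_set (- theta)) (graph_complement K) f"
    unfolding graph_complement_def continuous_map_in_subtopology
    by (auto intro: continuous_map_from_subtopology)
  let ?B = "(\<lambda>(U, \<phi>). ({y \<in> topspace (top_of_set (- theta)). f y \<in> U}, \<phi> \<circ> f)) ` colouring_atlas K h m M C"
  have "\<exists>\<sigma>. (\<forall>x. \<sigma> x \<noteq> (0, 0, 0)) \<and> (\<forall>x V \<phi>. x \<notin> theta \<longrightarrow> (V, \<phi>) \<in> ?B \<longrightarrow> x \<in> V \<longrightarrow>
      (\<exists>W v. open W \<and> x \<in> W \<and> (\<forall>y\<in>W. act (\<phi> y) (\<sigma> y) = v)))"
    by (rule theta_flat_section[OF flat_atlas_pullback[OF atlas f] act_add act_0 common_fixed_vector act_nonzero])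
  then obtain \<sigma> where \<sigma>: "\<And>x. \<sigma> x \<noteq> (0, 0, 0)"
    and flat: "\<And>x V \<phi>. x \<notin> theta \<Longrightarrow> (V, \<phi>) \<in> ?B \<Longrightarrow> x \<in> V \<Longrightarrow>
        \<exists>W v. open W \<and> x \<in> W \<and> (\<forall>y\<in>W. act (\<phi> y) (\<sigma> y) = v)"
    by blast
  define a where "a = the (G None)"
  define \<tau> where "\<tau> p = \<sigma> (the (H (Some p)))" for p
  have flat_\<tau>: "\<exists>W v. open W \<and> p \<in> W \<and> (\<forall>y\<in>W. act (\<phi> (Some y)) (\<tau> y) = v)"
    if p: "p \<notin> K" "p \<noteq> a" and U: "(U, \<phi>) \<in> colouring_atlas K h m M C" "Some p \<in> U" for p U \<phi>
  proof -
    have "H (Some p) \<noteq> None"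
    proof
      assume "H (Some p) = None"
      then have "G None = Some p" using GH(1)[of "Some p"] by simp
      then show False using p(2) by (simp add: a_def)
    qed
    then obtain y where y: "H (Some p) = Some y" by blast
    then have fy: "f y = Some p" using GH(1)[of "Some p"] by (simp add: f_def)
    have y_theta: "y \<notin> theta"
    proof
      assume "y \<in> theta"
      then obtain k where "k \<in> K" "H (Some k) = Some y" using HK' by (metis (no_types, lifting) imageE imageI)
      then show False using y GH(1) p(1) by (metis option.inject)
    qed
    have "({y \<in> topspace (top_of_set (- theta)). f y \<in> U}, \<phi> \<circ> f) \<in> ?B"
      by (rule image_eqI[OF _ U(1)]) simp
    from flat[OF y_theta this] obtain W v where W: "open W" "y \<in> W" "\<forall>y\<in>W. act ((\<phi> \<circ> f) y) (\<sigma> y) = v"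
      using y_theta fy U(2) by auto
    have "continuous_map euclidean S3 (H \<circ> Some)"
      using continuous_map_compose[OF continuous_map_Some_S3, of S3 H] G
      by (simp add: homeomorphic_maps_def)
    then have "open {x. H (Some x) \<in> Some ` W}"
      using openin_continuous_map_preimage[of euclidean S3 "H \<circ> Some" "Some ` W"] W(1) by simp
    moreover have "act (\<phi> (Some x)) (\<tau> x) = v" if x: "H (Some x) \<in> Some ` W" for x
    proof -
      obtain z where z: "z \<in> W" "H (Some x) = Some z" using x by blast
      then have "f z = Some x" using GH(1)[of "Some x"] by (simp add: f_def)
      then show ?thesis using W(3) z by (force simp: \<tau>_def)
    qed
    ultimately show ?thesis using y W(2) by (intro exI[of _ "{x. H (Some x) \<in> Some ` W}"] exI[of _ v]) auto
  qed
  have "\<exists>p. \<forall>q. q \<notin> proj ` K \<longrightarrow> act (h q) (\<tau> p) = \<tau> p"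
    by (rule flat_section_fixed[where a = a and m = m and M = M and C = C]) (fact K(2) far act_0 flat_\<tau>)+
  then obtain p where fixed: "\<And>q. q \<notin> proj ` K \<Longrightarrow> act (h q) (\<tau> p) = \<tau> p" by blast
  then have "\<tau> p = (0, 0, 0)"
    using kinoshita_colours(8) faces by metis
  then show False using \<sigma> by (simp add: \<tau>_def)
qed

end
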